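(* Let $A\in\mathbb{C}^{2^n\times 2^n}$ be a matrix with a total of $s$ non-zero entries, represented by a dictionary data structure with $s_0$ data items, i.e. $A=\sum_{l=0}^{s_0-1}\sum_{j\in S_c(l)}A_l\ket{c_l(j)}\bra{j}$ with non-zero $A_l\in\mathbb{C}$, sets $S_c(l)\subseteq[0,2^n-1]$ and injective maps $c_l:S_c(l)\to[0,2^n-1]$ such that the pairs $(c_l(j),j)$ are pairwise distinct, and assume $\lceil\log_2 s_0\rceil=\mathcal{O}(n)$. Then there exists a dictionary-based block encoding of $A$ (with subnormalization $\sum_{l=0}^{s_0-1}|A_l|$, of the form $(\mathrm{UNPREP}\otimes I)O_c(\mathrm{PREP}\otimes I)$ as described in the context) which can be implemented, using only single- and two-qubit gates, with circuit depth $\mathcal{O}(\log(ns))$ and $\mathcal{O}(n^2s)$ ancillary qubits.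
   Context: A block encoding of $A$ with subnormalization $\alpha$ is a unitary $U_A$ on $a+n$ qubits with $(\bra{0}^{\otimes a}\otimes I_{2^n})U_A(\ket{0}^{\otimes a}\otimes I_{2^n})=A/\alpha$. The dictionary-based block encoding is $U_A=(\mathrm{UNPREP}\otimes I_{2^{n+1}})O_c(\mathrm{PREP}\otimes I_{2^{n+1}})$ on registers idx ($m=\lceil\log_2 s_0\rceil$ qubits), del (1 qubit), system ($n$ qubits), where $O_c$ is a unitary with $O_c\ket{l}\ket{0}_{\rm del}\ket{j}=\ket{l}\ket{0}_{\rm del}\ket{c_l(j)}$ if $l\in[0,s_0-1]$ and $j\in S_c(l)$, and $=\ket{l}\ket{1}_{\rm del}\ket{j}$ otherwise; $\mathrm{PREP}\ket{0}^{\otimes m}=\frac{1}{\sqrt{\sum_l|A_l|}}\sum_{l}\sqrt{A_l}\ket{l}$ and $\mathrm{UNPREP}^\dagger\ket{0}^{\otimes m}=\frac{1}{\sqrt{\sum_l|A_l|}}\sum_l\sqrt{A_l}^{*}\ket{l}$, with $\sqrt{c}=\sqrt{|c|}e^{\imath\theta/2}$ for $c=|c|e^{\imath\theta}$. Ancillary qubits (beyond those of the registers) initialized to $\ket{0}$ and returned to $\ket{0}$ may be used. Circuit depth is the maximum number of layers of elementary (single- and two-qubit) gates. *)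

theory Defs
  imports Complex_Main "Jordan_Normal_Form.Matrix"
begin

definition cadj :: "complex mat \<Rightarrow> complex mat" where
  "cadj U = mat (dim_col U) (dim_row U) (\<lambda>(i,j). cnj (U $$ (j,i)))"

definition unitary_mat :: "nat \<Rightarrow> complex mat \<Rightarrow> bool" where
  "unitary_mat d U \<longleftrightarrow> U \<in> carrier_mat d d \<and> cadj U * U = 1\<^sub>m d"

definition dsqrt :: "complex \<Rightarrow> complex" where
  "dsqrt c = complex_of_real (sqrt (cmod c)) * cis (Arg c / 2)"

definition qbit :: "nat \<Rightarrow> nat \<Rightarrow> nat" where
  "qbit q x = (x div 2 ^ q) mod 2"

datatype gate = G1 nat "complex mat" | G2 nat nat "complex mat"

fun gate_support :: "gate \<Rightarrow> nat set" where
  "gate_support (G1 q U) = {q}"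
| "gate_support (G2 a b U) = {a, b}"

fun gate_ok :: "nat \<Rightarrow> gate \<Rightarrow> bool" where
  "gate_ok N (G1 q U) \<longleftrightarrow> q < N \<and> unitary_mat 2 U"
| "gate_ok N (G2 a b U) \<longleftrightarrow> a < N \<and> b < N \<and> a \<noteq> b \<and> unitary_mat 4 U"

fun gate_local :: "gate \<Rightarrow> nat \<Rightarrow> nat" where
  "gate_local (G1 q U) x = qbit q x"
| "gate_local (G2 a b U) x = 2 * qbit a x + qbit b x"

fun gate_umat :: "gate \<Rightarrow> complex mat" where
  "gate_umat (G1 q U) = U"
| "gate_umat (G2 a b U) = U"

definition gate_mat :: "nat \<Rightarrow> gate \<Rightarrow> complex mat" where
  "gate_mat N g = mat (2 ^ N) (2 ^ N) (\<lambda>(x,y).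
     if (\<forall>q<N. q \<notin> gate_support g \<longrightarrow> qbit q x = qbit q y)
     then gate_umat g $$ (gate_local g x, gate_local g y) else 0)"

type_synonym layer = "gate list"

definition layer_ok :: "nat \<Rightarrow> layer \<Rightarrow> bool" where
  "layer_ok N L \<longleftrightarrow> (\<forall>g\<in>set L. gate_ok N g) \<and>
     (\<forall>i<length L. \<forall>j<length L. i \<noteq> j \<longrightarrow> gate_support (L ! i) \<inter> gate_support (L ! j) = {})"

definition layer_mat :: "nat \<Rightarrow> layer \<Rightarrow> complex mat" where
  "layer_mat N L = foldr (\<lambda>g M. gate_mat N g * M) L (1\<^sub>m (2 ^ N))"

type_synonym circuit = "layer list"

definition circuit_ok :: "nat \<Rightarrow> circuit \<Rightarrow> bool" where
  "circuit_ok N C \<longleftrightarrow> (\<forall>L\<in>set C. layer_ok N L)"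

fun circ_mat :: "nat \<Rightarrow> circuit \<Rightarrow> complex mat" where
  "circ_mat N [] = 1\<^sub>m (2 ^ N)"
| "circ_mat N (L # Ls) = circ_mat N Ls * layer_mat N L"

definition circuit_depth :: "circuit \<Rightarrow> nat" where
  "circuit_depth C = length C"

(* Circuit C on anc ancillary qubits (the top qubits) plus k register qubits implements U,
   with ancillas starting in |0> and returned to |0> *)
definition implements :: "nat \<Rightarrow> nat \<Rightarrow> circuit \<Rightarrow> complex mat \<Rightarrow> bool" where
  "implements k anc C U \<longleftrightarrow>
     (\<forall>x<2 ^ k. \<forall>i<2 ^ (k + anc).
        circ_mat (k + anc) C $$ (i, x) = (if i < 2 ^ k then U $$ (i, x) else 0))"

(* Block encoding on a ancillas + n system qubits; basis index of |i>_anc|j>_sys is i*2^n + j *)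
definition block_encoding :: "nat \<Rightarrow> nat \<Rightarrow> real \<Rightarrow> complex mat \<Rightarrow> complex mat \<Rightarrow> bool" where
  "block_encoding a n \<alpha> A U \<longleftrightarrow> unitary_mat (2 ^ (a + n)) U \<and>
     (\<forall>i<2 ^ n. \<forall>j<2 ^ n. U $$ (i, j) = A $$ (i, j) / complex_of_real \<alpha>)"

definition kron_id :: "complex mat \<Rightarrow> nat \<Rightarrow> complex mat" where
  "kron_id P k = mat (dim_row P * 2 ^ k) (dim_col P * 2 ^ k)
     (\<lambda>(x,y). if x mod 2 ^ k = y mod 2 ^ k then P $$ (x div 2 ^ k, y div 2 ^ k) else 0)"

end

theory Submission
  imports Defs
begin

text \<open>A basis string \<open>u\<^sub>p\<close> out of a list of \<open>P\<close> distinct strings can be exchanged, in logarithmic depth, with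
  the single excitation \<open>e\<^sub>p\<close> of a fresh register of \<open>P\<close> qubits: compare \<open>P\<close> copies of the input with all
  the \<open>u\<^sub>p\<close> by trees of Toffoli gates, and then use the excitation to erase the input string.
  On single excitations, two-qubit gates that preserve the excitation number act as two-level
  unitaries. Hence every product of layers of two-level unitaries on the span of the \<open>u\<^sub>p\<close> is implemented
  with clean ancillas at an additive logarithmic cost.
  State preparation is a binary tree of such rotations, its inverse gives UNPREP, and the oracle is a NOT gate on
  the deletion qubit followed by a single layer of swaps. All circuits are analysed on basis
  assignments \<open>nat \<Rightarrow> bool\<close>, independently of the number of qubits.\<close>

section \<open>Circuits acting on wave functions\<close>

text \<open>The obstacle is depth. A qubit takes part in one gate per layer, so testing the input
  against P strings needs P copies of it, and a bit that acts on k qubits needs k copies of itself.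
  Doubling produces the copies in logarithmically many layers, and the garbage disappears when the
  computation is run backwards after its result has been copied out. Single excitations pay off
  because disjoint pairs of them can be mixed in one layer, whereas on the binary strings each
  mixing would be a multiply controlled gate on shared qubits. A string outside the list creates no
  excitation, and the vacuum is fixed by the gates in the middle, so such inputs pass through
  unchanged. The price is P excitation qubits and P rows of 2 (k + 1) cells. Here k is O(n) and P is
  at most twice the number of non-zero entries, so the ancilla count is even linear in n. The final
  depth 2 m + 120 T + 120 T' + 308 comes from three conjugations (PREP, oracle, UNPREP): in each, 4
  T + 4 T' + 10 classical levels are run before and after the middle circuit, at five layers per
  level.\<close>

type_synonym asg = "nat \<Rightarrow> bool"
type_synonym wave = "asg \<Rightarrow> complex"

definition ket :: "asg \<Rightarrow> wave" where
  "ket a b = (if b = a then 1 else 0)"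

fun gdim :: "gate \<Rightarrow> nat" where
  "gdim (G1 q U) = 2"
| "gdim (G2 p q U) = 4"

fun loc :: "gate \<Rightarrow> asg \<Rightarrow> nat" where
  "loc (G1 q U) a = of_bool (a q)"
| "loc (G2 p q U) a = 2 * of_bool (a p) + of_bool (a q)"

fun wr :: "gate \<Rightarrow> nat \<Rightarrow> asg \<Rightarrow> asg" where
  "wr (G1 q U) y a = a(q := odd y)"
| "wr (G2 p q U) y a = a(p := 2 \<le> y, q := odd y)"

text \<open>The amplitude at \<open>a\<close> is a sum along a row of the gate matrix. No number of
  qubits enters, and nothing outside the support is touched, so tensor products never
  appear.\<close>

definition gop :: "gate \<Rightarrow> wave \<Rightarrow> wave" where
  "gop g \<psi> a = (\<Sum>y<gdim g. gate_umat g $$ (loc g a, y) * \<psi> (wr g y a))"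

text \<open>\<open>foldr\<close> mirrors \<open>layer_mat\<close>, where the head of the list is the
  leftmost factor and acts last; in a circuit the head layer acts first, hence \<open>fold\<close>
  in \<open>cop\<close>.\<close>

definition lop :: "layer \<Rightarrow> wave \<Rightarrow> wave" where
  "lop L = foldr gop L"

definition cop :: "circuit \<Rightarrow> wave \<Rightarrow> wave" where
  "cop C = fold lop C"

lemma cop_simps [simp]: "cop [] \<psi> = \<psi>" "cop (L # C) \<psi> = cop C (lop L \<psi>)"
  "cop (C @ D) \<psi> = cop D (cop C \<psi>)"
  by (simp_all add: cop_def)

lemma lop_simps [simp]: "lop [] \<psi> = \<psi>" "lop (g # L) \<psi> = gop g (lop L \<psi>)"
  "lop (L @ M) \<psi> = lop L (lop M \<psi>)"
  by (simp_all add: lop_def)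

lemma sum_lessThan_4: "(\<Sum>y<(4::nat). f y) = f 0 + f 1 + f 2 + (f 3 :: 'a::comm_monoid_add)"
  by (simp add: numeral_eq_Suc add.assoc)

lemma sum_lessThan_2: "(\<Sum>y<(2::nat). f y) = f 0 + (f 1 :: 'a::comm_monoid_add)"
  by (simp add: numeral_eq_Suc)

lemma less_4_cases: "y < (4::nat) \<Longrightarrow> y = 0 \<or> y = 1 \<or> y = 2 \<or> y = 3"
  by linarith

lemma loc_less: "loc g a < gdim g"
  by (cases g) auto

text \<open>The part of \<open>gate_ok\<close> that does not depend on \<open>N\<close>: if the two
  qubits coincided, \<open>wr\<close> could not store four different local values.\<close>

fun gate_wf :: "gate \<Rightarrow> bool" where
  "gate_wf (G1 q U) = True"
| "gate_wf (G2 p q U) = (p \<noteq> q)"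

lemma gate_ok_wf: "gate_ok N g \<Longrightarrow> gate_wf g"
  by (cases g) auto

lemma wr_outside: "q \<notin> gate_support g \<Longrightarrow> wr g y a q = a q"
  by (cases g) auto

lemma loc_wr: "gate_wf g \<Longrightarrow> y < gdim g \<Longrightarrow> loc g (wr g y a) = y"
  by (cases g) (auto simp: less_2_cases_iff dest!: less_4_cases)

lemma wr_loc_eqI: "gate_wf g \<Longrightarrow> (\<And>q. q \<notin> gate_support g \<Longrightarrow> a q = b q) \<Longrightarrow> wr g (loc g a) b = a"
  by (cases g) (auto simp: fun_eq_iff)

lemma wr_eq_iff:
  assumes "gate_wf g" "y < gdim g"
  shows "wr g y b = a \<longleftrightarrow> y = loc g a \<and> (\<forall>q. q \<notin> gate_support g \<longrightarrow> a q = b q)"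
  using assms by (metis loc_wr wr_outside wr_loc_eqI)

text \<open>\<open>gop\<close> sums along a row, but a basis state selects a column. Both sums
  reduce to the same single entry, which is present exactly when \<open>a\<close> and
  \<open>b\<close> agree outside the gate.\<close>

lemma gop_ket:
  assumes "gate_wf g"
  shows "gop g (ket a) b = (\<Sum>y<gdim g. gate_umat g $$ (y, loc g a) * ket (wr g y a) b)"
proof -
  let ?A = "\<forall>q. q \<notin> gate_support g \<longrightarrow> a q = b q"
  have "gop g (ket a) b = (\<Sum>y<gdim g. if y = loc g a then (if ?A then gate_umat g $$ (loc g b, loc g a) else 0) else 0)"
    unfolding gop_def ket_def by (rule sum.cong) (auto simp: wr_eq_iff[OF assms])
  also have "\<dots> = (if ?A then gate_umat g $$ (loc g b, loc g a) else 0)"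
    by (simp add: loc_less)
  also have "\<dots> = (\<Sum>y<gdim g. if y = loc g b then (if ?A then gate_umat g $$ (loc g b, loc g a) else 0) else 0)"
    by (simp add: loc_less)
  also have "\<dots> = (\<Sum>y<gdim g. gate_umat g $$ (y, loc g a) * ket (wr g y a) b)"
  proof (rule sum.cong[OF refl])
    fix y assume y: "y \<in> {..<gdim g}"
    then have "(b = wr g y a) = (y = loc g b \<and> ?A)"
      using wr_eq_iff[OF assms, of y a b] by auto
    then show "(if y = loc g b then (if ?A then gate_umat g $$ (loc g b, loc g a) else 0) else 0)
        = gate_umat g $$ (y, loc g a) * ket (wr g y a) b"
      unfolding ket_def by auto
  qed
  finally show ?thesis .
qed

lemma gop_sum: "gop g (\<lambda>b. \<Sum>i\<in>I. c i * \<phi> i b) = (\<lambda>b. \<Sum>i\<in>I. c i * gop g (\<phi> i) b)"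
  unfolding gop_def sum_distrib_left by (subst sum.swap) (simp add: mult.left_commute)

lemma lop_sum: "lop L (\<lambda>b. \<Sum>i\<in>I. c i * \<phi> i b) = (\<lambda>b. \<Sum>i\<in>I. c i * lop L (\<phi> i) b)"
  by (induction L arbitrary: \<phi>) (simp_all add: gop_sum)

lemma cop_sum: "cop C (\<lambda>b. \<Sum>i\<in>I. c i * \<phi> i b) = (\<lambda>b. \<Sum>i\<in>I. c i * cop C (\<phi> i) b)"
  by (induction C arbitrary: \<phi>) (simp_all add: lop_sum)

lemma gop_commute:
  assumes "gate_support g \<inter> gate_support h = {}"
  shows "gop g (gop h \<psi>) = gop h (gop g \<psi>)"
proof
  fix a
  have w: "wr g y (wr h z a) = wr h z (wr g y a)" for y z
    using assms by (cases g; cases h) (auto simp: fun_eq_iff)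
  have l1: "loc g (wr h z a) = loc g a" for z
    using assms by (cases g; cases h) auto
  have l2: "loc h (wr g z a) = loc h a" for z
    using assms by (cases g; cases h) auto
  show "gop g (gop h \<psi>) a = gop h (gop g \<psi>) a"
    unfolding gop_def l1 l2 sum_distrib_left
    by (subst sum.swap) (simp add: w mult.left_commute)
qed

section \<open>Relation to the matrix semantics\<close>

lemma qbit_bit: "qbit q x = of_bool (bit x q)"
  by (simp add: qbit_def bit_iff_odd mod_2_eq_odd)

lemma gate_local_eq_loc: "gate_local g x = loc g (bit x)"
  by (cases g) (simp_all add: qbit_bit)

lemma bit_less_exp: "x < 2 ^ N \<Longrightarrow> N \<le> q \<Longrightarrow> \<not> bit (x::nat) q"
  by (metis bit_take_bit_iff leD take_bit_nat_eq_self)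

text \<open>Basis indices below \<open>2 ^ N\<close> are the binary codes of the assignments that
  vanish from qubit \<open>N\<close> on; the Horner sum computes the code.\<close>

lemma ex_bit_eq:
  assumes "\<And>q. N \<le> q \<Longrightarrow> \<not> b q"
  shows "\<exists>x<2 ^ N. bit (x::nat) = b"
proof -
  let ?x = "take_bit N (horner_sum of_bool (2::nat) (map b [0..<N]))"
  have "bit ?x = b"
  proof
    fix q
    show "bit ?x q = b q"
      using assms[of q] by (cases "q < N") (auto simp: bit_take_bit_iff bit_horner_sum_bit_iff)
  qed
  then show ?thesis using take_bit_nat_less_exp by blast
qed

lemma bit_eq_iff_nat: "bit (x::nat) = bit y \<longleftrightarrow> x = y"
  by (metis bit_eqI)

lemma ket_bit: "ket (bit (x::nat)) (bit y) = (if y = x then 1 else 0)"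
  by (simp add: ket_def bit_eq_iff_nat)

lemma gate_support_less: "gate_ok N g \<Longrightarrow> q \<in> gate_support g \<Longrightarrow> q < N"
  by (cases g) auto

text \<open>The bridge between the two semantics: row \<open>x\<close> of the gate matrix lives on
  the indices that agree with \<open>x\<close> outside the gate, and these correspond to the local
  values of the gate.\<close>

lemma gate_mat_apply:
  assumes ok: "gate_ok N g" and x: "x < 2 ^ N"
  shows "(\<Sum>y<2 ^ N. gate_mat N g $$ (x, y) * \<psi> (bit y)) = gop g \<psi> (bit x)"
proof -
  define A where "A = {y. y < 2 ^ N \<and> (\<forall>q<N. q \<notin> gate_support g \<longrightarrow> qbit q x = qbit q y)}"
  have wf: "gate_wf g" using ok by (rule gate_ok_wf)
  have agree: "(\<forall>q<N. q \<notin> gate_support g \<longrightarrow> qbit q x = qbit q y) \<longleftrightarrow>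
      (\<forall>q. q \<notin> gate_support g \<longrightarrow> bit y q = bit x q)" if "y < 2 ^ N" for y
    using bit_less_exp[OF that] bit_less_exp[OF x]
    by (auto simp: qbit_bit of_bool_eq_iff) (metis not_le)+
  have ex: "\<exists>y::nat<2 ^ N. bit y = wr g z (bit x)" for z
    using bit_less_exp[OF x] gate_support_less[OF ok]
    by (intro ex_bit_eq) (metis leD wr_outside)
  \<comment> \<open>The inverse of the correspondence: \<open>e z\<close> is the index obtained by
    writing the local value \<open>z\<close> into \<open>x\<close>.\<close>
  define e where "e z = (SOME y::nat. y < 2 ^ N \<and> bit y = wr g z (bit x))" for z
  have e: "e z < 2 ^ N" "bit (e z) = wr g z (bit x)" for z
    using someI_ex[of "\<lambda>y. y < 2 ^ N \<and> bit y = wr g z (bit x)"] ex[of z] unfolding e_def by auto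
  have "(\<Sum>y<2 ^ N. gate_mat N g $$ (x, y) * \<psi> (bit y))
      = (\<Sum>y\<in>A. gate_umat g $$ (loc g (bit x), loc g (bit y)) * \<psi> (bit y))"
    unfolding A_def gate_mat_def
    by (rule sum.mono_neutral_cong_right) (use x in \<open>auto simp: gate_local_eq_loc\<close>)
  also have "\<dots> = (\<Sum>z<gdim g. gate_umat g $$ (loc g (bit x), z) * \<psi> (wr g z (bit x)))"
  proof (rule sum.reindex_bij_witness[where i = e and j = "\<lambda>y. loc g (bit y)"])
    fix y assume y: "y \<in> A"
    then have w: "wr g (loc g (bit y)) (bit x) = bit y"
      using agree by (intro wr_loc_eqI[OF wf]) (auto simp: A_def)
    show "e (loc g (bit y)) = y" using e(2)[of "loc g (bit y)"] w by (simp add: bit_eq_iff_nat)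
    show "loc g (bit y) \<in> {..<gdim g}" by (simp add: loc_less)
    show "gate_umat g $$ (loc g (bit x), loc g (bit y)) * \<psi> (wr g (loc g (bit y)) (bit x)) =
         gate_umat g $$ (loc g (bit x), loc g (bit y)) * \<psi> (bit y)" by (simp add: w)
  next
    fix z assume z: "z \<in> {..<gdim g}"
    show "loc g (bit (e z)) = z" using z by (simp add: e loc_wr[OF wf])
    show "e z \<in> A" using e[of z] agree[of "e z"] by (auto simp: A_def wr_outside)
  qed
  finally show ?thesis by (simp add: gop_def)
qed

lemma gate_mat_carrier [simp]: "gate_mat N g \<in> carrier_mat (2 ^ N) (2 ^ N)"
  by (simp add: gate_mat_def)

lemma layer_mat_carrier: "layer_mat N L \<in> carrier_mat (2 ^ N) (2 ^ N)"
  unfolding layer_mat_def by (induction L) (auto intro!: mult_carrier_mat[of _ _ "2 ^ N"])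

lemma circ_mat_carrier: "circ_mat N C \<in> carrier_mat (2 ^ N) (2 ^ N)"
  by (induction C) (auto intro: mult_carrier_mat layer_mat_carrier)

lemma times_mat_apply:
  fixes A B :: "complex mat"
  assumes "A \<in> carrier_mat d d" "B \<in> carrier_mat d d" "x < d"
  shows "(\<Sum>y<d. (A * B) $$ (x, y) * f y) = (\<Sum>z<d. A $$ (x, z) * (\<Sum>y<d. B $$ (z, y) * f y))"
proof -
  have "(\<Sum>y<d. (A * B) $$ (x, y) * f y) = (\<Sum>y<d. \<Sum>z<d. A $$ (x, z) * (B $$ (z, y) * f y))"
    using assms
    by (intro sum.cong) (auto simp: times_mat_def scalar_prod_def sum_distrib_right mult.assoc atLeast0LessThan)
  then show ?thesis by (subst (asm) sum.swap) (simp add: sum_distrib_left)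
qed

lemma one_mat_apply:
  assumes x: "x < d"
  shows "(\<Sum>y<d. (1\<^sub>m d :: complex mat) $$ (x, y) * f y) = f x"
proof -
  have "(\<Sum>y<d. (1\<^sub>m d :: complex mat) $$ (x, y) * f y) = (\<Sum>y<d. if y = x then f y else 0)"
    using x by (intro sum.cong) auto
  then show ?thesis using x by simp
qed

lemma layer_mat_apply:
  assumes "\<forall>g\<in>set L. gate_ok N g" "x < 2 ^ N"
  shows "(\<Sum>y<2 ^ N. layer_mat N L $$ (x, y) * \<psi> (bit y)) = lop L \<psi> (bit x)"
  using assms
proof (induction L arbitrary: x)
  case Nil
  then show ?case using one_mat_apply[of x "2 ^ N"] by (simp add: layer_mat_def del: index_one_mat)
next
  case (Cons g L)
  have "layer_mat N (g # L) = gate_mat N g * layer_mat N L" by (simp add: layer_mat_def)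
  then have "(\<Sum>y<2 ^ N. layer_mat N (g # L) $$ (x, y) * \<psi> (bit y))
      = (\<Sum>z<2 ^ N. gate_mat N g $$ (x, z) * lop L \<psi> (bit z))"
    using Cons by (simp add: times_mat_apply[OF gate_mat_carrier layer_mat_carrier])
  then show ?case using Cons.prems by (simp add: gate_mat_apply)
qed

lemma circ_mat_apply:
  assumes "circuit_ok N C" "x < 2 ^ N"
  shows "(\<Sum>y<2 ^ N. circ_mat N C $$ (x, y) * \<psi> (bit y)) = cop C \<psi> (bit x)"
  using assms
proof (induction C arbitrary: \<psi>)
  case Nil
  then show ?case using one_mat_apply[of x "2 ^ N"] by (simp del: index_one_mat)
next
  case (Cons L C)
  have "(\<Sum>y<2 ^ N. circ_mat N (L # C) $$ (x, y) * \<psi> (bit y))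
      = (\<Sum>z<2 ^ N. circ_mat N C $$ (x, z) * lop L \<psi> (bit z))"
    using Cons.prems
    by (auto simp: times_mat_apply[OF circ_mat_carrier layer_mat_carrier] circuit_ok_def layer_ok_def
        layer_mat_apply intro!: sum.cong)
  then show ?case using Cons by (simp add: circuit_ok_def)
qed

lemma circ_mat_entry:
  assumes "circuit_ok N C" "i < 2 ^ N" "x < 2 ^ N"
  shows "circ_mat N C $$ (i, x) = cop C (ket (bit x)) (bit i)"
proof -
  have "cop C (ket (bit x)) (bit i) = (\<Sum>y<2 ^ N. if y = x then circ_mat N C $$ (i, y) else 0)"
    unfolding circ_mat_apply[OF assms(1,2), symmetric] by (intro sum.cong) (auto simp: ket_bit)
  then show ?thesis using assms(3) by simp
qed

section \<open>Reversible classical levels\<close>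

datatype rop = NOT nat | CX nat nat | CCX nat nat nat

fun tgt :: "rop \<Rightarrow> nat" where
  "tgt (NOT t) = t" | "tgt (CX c t) = t" | "tgt (CCX c d t) = t"

fun ctls :: "rop \<Rightarrow> nat set" where
  "ctls (NOT t) = {}" | "ctls (CX c t) = {c}" | "ctls (CCX c d t) = {c, d}"

definition supp :: "rop \<Rightarrow> nat set" where
  "supp r = insert (tgt r) (ctls r)"

definition fires :: "rop \<Rightarrow> asg \<Rightarrow> bool" where
  "fires r a \<longleftrightarrow> (\<forall>c\<in>ctls r. a c)"

definition rop_ok :: "nat \<Rightarrow> rop \<Rightarrow> bool" where
  "rop_ok N r \<longleftrightarrow> (\<forall>q\<in>supp r. q < N) \<and> tgt r \<notin> ctls r \<and> (\<forall>c d t. r = CCX c d t \<longrightarrow> c \<noteq> d)"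

definition rfun :: "rop \<Rightarrow> asg \<Rightarrow> asg" where
  "rfun r a = a(tgt r := (a (tgt r) \<noteq> fires r a))"

text \<open>A set is enough because the operations of a level have disjoint supports, so all of them
  may read the old assignment. On booleans, \<open>\<noteq>\<close> is exclusive or.\<close>

definition lev :: "rop set \<Rightarrow> asg \<Rightarrow> asg" where
  "lev R a q \<longleftrightarrow> (a q \<noteq> (\<exists>r\<in>R. tgt r = q \<and> fires r a))"

definition level_ok :: "nat \<Rightarrow> rop set \<Rightarrow> bool" where
  "level_ok N R \<longleftrightarrow> finite R \<and> (\<forall>r\<in>R. rop_ok N r) \<and> (\<forall>r\<in>R. \<forall>r'\<in>R. r \<noteq> r' \<longrightarrow> supp r \<inter> supp r' = {})"

text \<open>This is a I + b X, and \<open>cu\<close> is the same operator controlled by the first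
  qubit, which has weight 2 in the local index.\<close>

definition nu :: "complex \<Rightarrow> complex \<Rightarrow> complex mat" where
  "nu a b = mat 2 2 (\<lambda>(i,j). if i = j then a else b)"

definition cu :: "complex \<Rightarrow> complex \<Rightarrow> complex mat" where
  "cu a b = mat 4 4 (\<lambda>(i,j). if i < 2 \<and> j < 2 then (if i = j then 1 else 0)
     else if 2 \<le> i \<and> 2 \<le> j then (if i = j then a else b) else 0)"

text \<open>The Toffoli gate uses a square root \<open>V\<close> of the NOT gate:
  \<open>V\<close> is applied \<open>c + d - (c \<oplus> d) = 2 c d\<close> times.\<close>

fun rgates :: "rop \<Rightarrow> gate list" where
  "rgates (NOT t) = [G1 t (nu 0 1), G1 t (nu 1 0), G1 t (nu 1 0), G1 t (nu 1 0), G1 t (nu 1 0)]"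
| "rgates (CX c t) = [G2 c t (cu 0 1), G2 c t (cu 1 0), G2 c t (cu 1 0), G2 c t (cu 1 0), G2 c t (cu 1 0)]"
| "rgates (CCX c d t) =
    [G2 c t (cu ((1 + \<i>) / 2) ((1 - \<i>) / 2)), G2 c d (cu 0 1),
     G2 d t (cu ((1 - \<i>) / 2) ((1 + \<i>) / 2)), G2 c d (cu 0 1),
     G2 d t (cu ((1 + \<i>) / 2) ((1 - \<i>) / 2))]"

text \<open>The identities \<open>nu 1 0\<close> and \<open>cu 1 0\<close> pad NOT and CX to the
  length of a Toffoli gate, so that a level of mixed operations is exactly five layers.\<close>

lemma length_rgates [simp]: "length (rgates r) = 5"
  by (cases r) auto

lemma gop_nu: "gop (G1 t (nu a b)) \<psi> x = a * \<psi> x + b * \<psi> (x(t := \<not> x t))"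
proof -
  have e: "x(t := x t) = x" by auto
  show ?thesis using e by (cases "x t") (simp_all add: gop_def nu_def sum_lessThan_2)
qed

lemma gop_cu:
  assumes "c \<noteq> t"
  shows "gop (G2 c t (cu a b)) \<psi> x = (if x c then a * \<psi> x + b * \<psi> (x(t := \<not> x t)) else \<psi> x)"
proof -
  have e: "x(c := x c, t := x t) = x" "x(c := x c, t := \<not> x t) = x(t := \<not> x t)" by auto
  show ?thesis using e assms
    by (cases "x t"; cases "x c") (simp_all add: gop_def cu_def sum_lessThan_4)
qed

lemma unitary_nu: "cmod a ^ 2 + cmod b ^ 2 = 1 \<Longrightarrow> cnj a * b + cnj b * a = 0 \<Longrightarrow> unitary_mat 2 (nu a b)"
proof -
  assume h: "cmod a ^ 2 + cmod b ^ 2 = 1" "cnj a * b + cnj b * a = 0"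
  have "cnj a * a + cnj b * b = 1"
    using h(1) by (metis complex_norm_square mult.commute of_real_1 of_real_add of_real_power)
  then show ?thesis using h(2)
    by (auto simp: unitary_mat_def nu_def cadj_def scalar_prod_def less_2_cases_iff add.commute
        sum_lessThan_2[unfolded lessThan_atLeast0] intro!: eq_matI)
qed

lemma unitary_cu: "cmod a ^ 2 + cmod b ^ 2 = 1 \<Longrightarrow> cnj a * b + cnj b * a = 0 \<Longrightarrow> unitary_mat 4 (cu a b)"
proof -
  assume h: "cmod a ^ 2 + cmod b ^ 2 = 1" "cnj a * b + cnj b * a = 0"
  have "cnj a * a + cnj b * b = 1"
    using h(1) by (metis complex_norm_square mult.commute of_real_1 of_real_add of_real_power)
  then show ?thesis using h(2)
    by (auto simp: unitary_mat_def cu_def cadj_def scalar_prod_def add.commute dest!: less_4_cases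
        simp: sum_lessThan_4[unfolded lessThan_atLeast0] intro!: eq_matI)
qed

lemma rgates_ok: "rop_ok N r \<Longrightarrow> g \<in> set (rgates r) \<Longrightarrow> gate_ok N g"
proof -
  have m: "cmod ((1 + \<i>) / 2) ^ 2 = 1/2" "cmod ((1 - \<i>) / 2) ^ 2 = 1/2"
    unfolding cmod_power2 by (simp_all add: power2_eq_square)
  have o: "cnj ((1 + \<i>) / 2) * ((1 - \<i>) / 2) + cnj ((1 - \<i>) / 2) * ((1 + \<i>) / 2) = 0"
    by (simp add: algebra_simps)
  have u: "unitary_mat 4 (cu ((1 + \<i>) / 2) ((1 - \<i>) / 2))" "unitary_mat 4 (cu ((1 - \<i>) / 2) ((1 + \<i>) / 2))"
    by (rule unitary_cu; simp only: m o; simp)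
       (rule unitary_cu; simp only: m o add.commute[of "cnj ((1 - \<i>) / 2) * _"]; simp)
  have u': "unitary_mat 4 (cu 0 1)" "unitary_mat 4 (cu 1 0)" "unitary_mat 2 (nu 0 1)" "unitary_mat 2 (nu 1 0)"
    by (rule unitary_cu unitary_nu; simp)+
  show "rop_ok N r \<Longrightarrow> g \<in> set (rgates r) \<Longrightarrow> gate_ok N g"
    using u u' by (cases r) (auto simp: rop_ok_def supp_def simp del: One_nat_def)
qed

lemma rgates_support: "g \<in> set (rgates r) \<Longrightarrow> gate_support g \<subseteq> supp r"
  by (cases r) (auto simp: supp_def)

text \<open>Waves are pulled back along \<open>rfun\<close>; since \<open>rfun\<close> is an
  involution, this is the same as pushing basis states forward.\<close>

lemma rgates_action:
  assumes "rop_ok N r"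
  shows "fold gop (rgates r) \<psi> = (\<lambda>x. \<psi> (rfun r x))"
proof (cases r)
  case (NOT t)
  have n: "gop (G1 t (nu 0 1)) \<psi> = (\<lambda>x. \<psi> (x(t := \<not> x t)))" "gop (G1 t (nu 1 0)) \<psi> = \<psi>" for \<psi>
    by (auto simp: gop_nu)
  show ?thesis using NOT by (simp add: n rfun_def fires_def)
next
  case (CX c t)
  then have ct: "c \<noteq> t" using assms by (auto simp: rop_ok_def)
  have n: "gop (G2 c t (cu 0 1)) \<psi> = (\<lambda>x. \<psi> (x(t := (x t \<noteq> x c))))"
     "gop (G2 c t (cu 1 0)) \<psi> = \<psi>" for \<psi>
    using ct by (auto simp: gop_cu)
  show ?thesis using CX by (simp add: n rfun_def fires_def)
next
  case (CCX c d t)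
  then have d: "c \<noteq> t" "c \<noteq> d" "d \<noteq> t" "t \<noteq> c" "d \<noteq> c" "t \<noteq> d" using assms by (auto simp: rop_ok_def)
  define v w :: complex where "v = (1 + \<i>) / 2" and "w = (1 - \<i>) / 2"
  have vw: "v * w = 1 / 2" "v * v = - (w * w)" by (simp_all add: v_def w_def field_simps)
  \<comment> \<open>With V = v I + w X and adjoint w I + v X, the first two say that V and its
    adjoint cancel in either order (exactly one control set), the third that V applied twice is X
    (both controls set).\<close>
  have i1: "v * (w * p + v * q) + w * (w * q + v * p) = p"
    and i2: "w * (v * p + w * q) + v * (v * q + w * p) = p"
    and i3: "v * (v * p + w * q) + w * (v * q + w * p) = q" for p q
  proof -
    have "v * (w * p + v * q) + w * (w * q + v * p) = 2 * (v * w) * p + (v * v + w * w) * q"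
      "w * (v * p + w * q) + v * (v * q + w * p) = 2 * (v * w) * p + (v * v + w * w) * q"
      "v * (v * p + w * q) + w * (v * q + w * p) = 2 * (v * w) * q + (v * v + w * w) * p"
      by (simp_all only: algebra_simps) (simp_all add: mult_ac)
    then show "v * (w * p + v * q) + w * (w * q + v * p) = p"
      "w * (v * p + w * q) + v * (v * q + w * p) = p"
      "v * (v * p + w * q) + w * (v * q + w * p) = q"
      by (simp_all add: vw)
  qed
  show ?thesis
  proof
    fix x :: asg
    have e: "x(d := b, t := b', d := b'') = x(d := b'', t := b')"
      "x(d := b, t := b', d := b'', t := bb) = x(d := b'', t := bb)"
      "x(d := b, t := b', d := b'', t := bb, d := c') = x(d := c', t := bb)" for b b' b'' bb c'
      using d by (auto simp: fun_eq_iff)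
    have e2: "x d \<Longrightarrow> x(d := True, t := b) = x(t := b)" "x d \<Longrightarrow> x(d := True) = x"
       "\<not> x d \<Longrightarrow> x(d := False, t := b) = x(t := b)" "\<not> x d \<Longrightarrow> x(d := False) = x"
       "x(t := x t) = x" "x d \<Longrightarrow> x(t := b, d := True) = x(t := b)" for b
      using d by (auto simp: fun_eq_iff)
    have "fold gop (rgates r) \<psi> x = \<psi> (if x c \<and> x d then x(t := \<not> x t) else x)"
      using d unfolding CCX rgates.simps v_def[symmetric] w_def[symmetric]
      by (cases "x c"; cases "x d") (simp_all add: gop_cu e e2 i1 i2 i3)
    then show "fold gop (rgates r) \<psi> x = \<psi> (rfun r x)"
      using CCX by (auto simp: rfun_def fires_def)
  qed
qed

lemma rfun_rfun: "rop_ok N r \<Longrightarrow> rfun r (rfun r a) = a"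
  by (cases r) (auto simp: rfun_def fires_def rop_ok_def fun_eq_iff)

lemma ket_involution: "(\<And>x. f (f x) = x) \<Longrightarrow> (\<lambda>x. ket a (f x)) = ket (f a)"
  unfolding ket_def by (rule ext) metis

lemma gop_lop_commute:
  "(\<And>h. h \<in> set L \<Longrightarrow> gate_support g \<inter> gate_support h = {}) \<Longrightarrow> gop g (lop L \<psi>) = lop L (gop g \<psi>)"
  by (induction L) (auto simp: gop_commute[of g])

lemma gop_cop_commute:
  "(\<And>L h. L \<in> set C \<Longrightarrow> h \<in> set L \<Longrightarrow> gate_support g \<inter> gate_support h = {}) \<Longrightarrow>
    gop g (cop C \<psi>) = cop C (gop g \<psi>)"
proof (induction C arbitrary: \<psi>)
  case Nil
  then show ?case by simp
next
  case (Cons L C)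
  have "gop g (lop L \<psi>) = lop L (gop g \<psi>)"
    by (rule gop_lop_commute) (use Cons.prems in auto)
  moreover have "gop g (cop C \<phi>) = cop C (gop g \<phi>)" for \<phi>
    by (rule Cons.IH) (use Cons.prems in auto)
  ultimately show ?case by simp
qed

text \<open>Think of a grid with time steps \<open>rs\<close> and columns \<open>x # xs\<close>. The
  gates of column \<open>x\<close> commute with those of all other columns, so the column can be
  collected and applied after the rest.\<close>

lemma cop_parallel_Cons:
  assumes "\<And>r s y. y \<in> set xs \<Longrightarrow> r \<in> set rs \<Longrightarrow> s \<in> set rs \<Longrightarrow> gate_support (g r x) \<inter> gate_support (g s y) = {}"
  shows "cop (map (\<lambda>r. map (g r) (x # xs)) rs) \<psi>
    = fold gop (map (\<lambda>r. g r x) rs) (cop (map (\<lambda>r. map (g r) xs) rs) \<psi>)"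
  using assms
proof (induction rs arbitrary: \<psi>)
  case Nil
  then show ?case by simp
next
  case (Cons r rs)
  have "cop (map (\<lambda>r. map (g r) xs) rs) (gop (g r x) (lop (map (g r) xs) \<psi>))
      = gop (g r x) (cop (map (\<lambda>r. map (g r) xs) rs) (lop (map (g r) xs) \<psi>))"
    by (rule gop_cop_commute[symmetric]) (use Cons.prems in \<open>auto simp: disjoint_iff; blast\<close>)
  then show ?case using Cons by simp
qed

definition levc :: "rop list \<Rightarrow> circuit" where
  "levc rs = map (\<lambda>i. map (\<lambda>r. rgates r ! i) rs) [0..<5]"

lemma map_nth_rgates: "map (\<lambda>i. rgates r ! i) [0..<5] = rgates r"
  by (metis length_rgates map_nth)

lemma fires_cong: "(\<And>q. q \<in> supp r \<Longrightarrow> a q = b q) \<Longrightarrow> fires r a = fires r b"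
  by (auto simp: fires_def supp_def)

lemma lev_outside: "(\<And>r. r \<in> R \<Longrightarrow> tgt r \<noteq> q) \<Longrightarrow> lev R a q = a q"
  by (auto simp: lev_def)

lemma levc_action:
  assumes "distinct rs" "level_ok N (set rs)"
  shows "cop (levc rs) (ket a) = ket (lev (set rs) a)"
  using assms
proof (induction rs)
  case Nil
  have "lev {} a = a" by (simp add: lev_def fun_eq_iff)
  moreover have "cop (map (\<lambda>i. []) is) \<psi> = \<psi>" for "is" :: "nat list" and \<psi> by (induction "is") auto
  ultimately show ?case by (simp add: levc_def)
next
  case (Cons r rs)
  have ok: "rop_ok N r" "level_ok N (set rs)" and dis: "\<And>r'. r' \<in> set rs \<Longrightarrow> supp r \<inter> supp r' = {}"
    using Cons.prems by (auto simp: level_ok_def)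
  have s: "gate_support (rgates r ! i) \<inter> gate_support (rgates r' ! j) = {}"
    if "r' \<in> set rs" "i \<in> set [0..<5]" "j \<in> set [0..<5]" for r' i j
  proof -
    have "gate_support (rgates r ! i) \<subseteq> supp r" "gate_support (rgates r' ! j) \<subseteq> supp r'"
      using that by (auto intro!: rgates_support nth_mem)
    then show ?thesis using dis[OF that(1)] by blast
  qed
  have "cop (levc (r # rs)) (ket a) = fold gop (rgates r) (cop (levc rs) (ket a))"
    unfolding levc_def
    by (subst cop_parallel_Cons[of rs "[0..<5]" "\<lambda>i r. rgates r ! i" r])
       (use s in \<open>auto simp: map_nth_rgates simp del: upt_Suc\<close>)
  also have "\<dots> = ket (rfun r (lev (set rs) a))"
    using Cons.IH Cons.prems(1) ok(2) ket_involution[of "rfun r", OF rfun_rfun[OF ok(1)]]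
    by (simp only: rgates_action[OF ok(1)] distinct.simps)
  also have "rfun r (lev (set rs) a) = lev (set (r # rs)) a"
  proof
    fix q
    have out: "lev (set rs) a p = a p" if "p \<in> supp r" for p
      using that dis by (intro lev_outside) (auto simp: supp_def)
    then have f: "fires r (lev (set rs) a) = fires r a" by (intro fires_cong) auto
    have "r' \<in> set rs \<Longrightarrow> tgt r' \<noteq> tgt r" for r' using dis by (auto simp: supp_def)
    then show "rfun r (lev (set rs) a) q = lev (set (r # rs)) a q"
      using f out[of "tgt r"] by (auto simp: rfun_def lev_def supp_def)
  qed
  finally show ?case .
qed

lemma layer_ok_map:
  assumes "distinct xs" "\<And>x. x \<in> set xs \<Longrightarrow> gate_ok N (g x)"
    "\<And>x y. x \<in> set xs \<Longrightarrow> y \<in> set xs \<Longrightarrow> x \<noteq> y \<Longrightarrow> gate_support (g x) \<inter> gate_support (g y) = {}"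
  shows "layer_ok N (map g xs)"
  unfolding layer_ok_def
proof (intro conjI ballI allI impI)
  fix h assume "h \<in> set (map g xs)"
  then show "gate_ok N h" using assms(2) by auto
next
  fix i j assume "i < length (map g xs)" "j < length (map g xs)" "i \<noteq> j"
  then show "gate_support (map g xs ! i) \<inter> gate_support (map g xs ! j) = {}"
    using assms(1,3) by (simp add: nth_eq_iff_index_eq)
qed

lemma levc_ok:
  assumes "distinct rs" "level_ok N (set rs)"
  shows "circuit_ok N (levc rs)"
proof -
  have "layer_ok N (map (\<lambda>r. rgates r ! i) rs)" if "i < 5" for i
  proof (rule layer_ok_map[OF assms(1)])
    fix r assume "r \<in> set rs"
    then show "gate_ok N (rgates r ! i)"
      using assms(2) that by (auto simp: level_ok_def intro!: rgates_ok nth_mem)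
  next
    fix r r' assume "r \<in> set rs" "r' \<in> set rs" "r \<noteq> r'"
    then have "supp r \<inter> supp r' = {}" using assms(2) by (auto simp: level_ok_def)
    moreover have "gate_support (rgates r ! i) \<subseteq> supp r" "gate_support (rgates r' ! i) \<subseteq> supp r'"
      using that by (auto intro!: rgates_support nth_mem)
    ultimately show "gate_support (rgates r ! i) \<inter> gate_support (rgates r' ! i) = {}" by blast
  qed
  then show ?thesis by (auto simp: circuit_ok_def levc_def)
qed

definition clev :: "rop set list \<Rightarrow> asg \<Rightarrow> asg" where
  "clev K = fold lev K"

lemma clev_simps [simp]: "clev [] a = a" "clev (R # K) a = clev K (lev R a)"
  "clev (K @ K') a = clev K' (clev K a)"
  by (simp_all add: clev_def)

lemma clev_circuit:
  assumes "\<forall>R\<in>set K. level_ok N R"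
  shows "\<exists>C. circuit_ok N C \<and> length C = 5 * length K \<and> (\<forall>a. cop C (ket a) = ket (clev K a))"
  using assms
proof (induction K)
  case Nil
  then show ?case by (intro exI[of _ "[]"]) (simp add: circuit_ok_def)
next
  case (Cons R K)
  then obtain C where C: "circuit_ok N C" "length C = 5 * length K" "\<forall>a. cop C (ket a) = ket (clev K a)"
    by auto
  obtain rs where rs: "distinct rs" "set rs = R"
    using Cons.prems finite_distinct_list[of R] by (auto simp: level_ok_def)
  then have ok: "level_ok N (set rs)" using Cons.prems by simp
  have "circuit_ok N (levc rs @ C)" using levc_ok[OF rs(1) ok] C(1) by (auto simp: circuit_ok_def)
  moreover have "length (levc rs @ C) = 5 * length (R # K)" using C(2) by (simp add: levc_def)
  moreover have "cop (levc rs @ C) (ket a) = ket (clev (R # K) a)" for a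
    using levc_action[OF rs(1) ok] C(3) rs(2) by simp
  ultimately show ?case by blast
qed

text \<open>No target of a level is a control in the same level, so a second application fires
  exactly the same operations.\<close>

lemma lev_lev:
  assumes "level_ok N R"
  shows "lev R (lev R a) = a"
proof
  fix q
  have "fires r (lev R a) = fires r a" if r: "r \<in> R" for r
  proof -
    have "lev R a c = a c" if c: "c \<in> ctls r" for c
    proof (rule lev_outside)
      fix r' assume r': "r' \<in> R"
      show "tgt r' \<noteq> c"
      proof (cases "r' = r")
        case True
        then show ?thesis using c r assms by (auto simp: level_ok_def rop_ok_def)
      next
        case False
        then have "supp r' \<inter> supp r = {}" using assms r r' by (auto simp: level_ok_def)
        then show ?thesis using c by (auto simp: supp_def)
      qed
    qed
    then show ?thesis by (auto simp: fires_def)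
  qed
  then show "lev R (lev R a) q = a q" by (auto simp: lev_def)
qed

lemma clev_rev: "\<forall>R\<in>set K. level_ok N R \<Longrightarrow> clev (rev K) (clev K a) = a"
  by (induction K arbitrary: a) (auto simp: lev_lev)

lemma lev_mask:
  assumes "\<And>r q. r \<in> R \<Longrightarrow> q \<in> supp r \<Longrightarrow> \<not> m q"
  shows "lev R (\<lambda>q. a q \<noteq> m q) = (\<lambda>q. lev R a q \<noteq> m q)"
proof -
  have "fires r (\<lambda>q. a q \<noteq> m q) = fires r a" if "r \<in> R" for r
    using assms[OF that] by (intro fires_cong) auto
  then show ?thesis by (auto simp: lev_def fun_eq_iff)
qed

lemma clev_mask:
  assumes "\<And>R r q. R \<in> set K \<Longrightarrow> r \<in> R \<Longrightarrow> q \<in> supp r \<Longrightarrow> \<not> m q"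
  shows "clev K (\<lambda>q. a q \<noteq> m q) = (\<lambda>q. clev K a q \<noteq> m q)"
  using assms
proof (induction K arbitrary: a)
  case Nil
  then show ?case by simp
next
  case (Cons R K)
  have "lev R (\<lambda>q. a q \<noteq> m q) = (\<lambda>q. lev R a q \<noteq> m q)"
    by (rule lev_mask) (use Cons.prems in auto)
  moreover have "clev K (\<lambda>q. b q \<noteq> m q) = (\<lambda>q. clev K b q \<noteq> m q)" for b
    by (rule Cons.IH) (use Cons.prems in auto)
  ultimately show ?case by simp
qed

text \<open>Copying out only toggles qubits that the computation \<open>K\<close> never touches.
  Such a mask commutes with \<open>K\<close>, so the reversed computation still cancels the forward
  one.\<close>

lemma clev_compute_copy_uncompute:
  assumes ok: "\<forall>R\<in>set K. level_ok N R"
    and avoid: "\<And>R r r'. R \<in> set K \<Longrightarrow> r \<in> R \<Longrightarrow> r' \<in> M \<Longrightarrow> tgt r' \<notin> supp r"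
  shows "clev (K @ M # rev K) a = (\<lambda>q. a q \<noteq> (\<exists>r\<in>M. tgt r = q \<and> fires r (clev K a)))"
proof -
  define m where "m q \<longleftrightarrow> (\<exists>r\<in>M. tgt r = q \<and> fires r (clev K a))" for q
  have "lev M (clev K a) = (\<lambda>q. clev K a q \<noteq> m q)"
    by (auto simp: lev_def m_def fun_eq_iff)
  \<comment> \<open>Moving the mask to the input exposes an application of \<open>K\<close> for
    \<open>rev K\<close> to undo.\<close>
  also have "\<dots> = clev K (\<lambda>q. a q \<noteq> m q)"
    by (rule clev_mask[symmetric]) (use avoid in \<open>auto simp: m_def\<close>)
  finally show ?thesis using clev_rev[OF ok] by (simp add: m_def)
qed

lemma clev_outside: "(\<And>R r. R \<in> set K \<Longrightarrow> r \<in> R \<Longrightarrow> tgt r \<noteq> q) \<Longrightarrow> clev K a q = a q"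
proof (induction K arbitrary: a)
  case Nil
  then show ?case by simp
next
  case (Cons R K)
  have "lev R a q = a q" by (rule lev_outside) (use Cons.prems in auto)
  moreover have "clev K b q = b q" for b by (rule Cons.IH) (use Cons.prems in auto)
  ultimately show ?case by simp
qed

section \<open>Logarithmic-depth fan-out, gathering and conjunction\<close>

text \<open>Workspaces are given by an address function instead of intervals, so that the same
  doubling lemmas run down the rows and, with the arguments exchanged, along a row.\<close>

definition grid_inj :: "(nat \<Rightarrow> nat \<Rightarrow> nat) \<Rightarrow> nat \<Rightarrow> nat set \<Rightarrow> bool" where
  "grid_inj c P X \<longleftrightarrow> (\<forall>p<P. \<forall>p'<P. \<forall>x\<in>X. \<forall>x'\<in>X. c p x = c p' x' \<longrightarrow> p = p' \<and> x = x')"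

lemma grid_injD:
  "grid_inj c P X \<Longrightarrow> p < P \<Longrightarrow> p' < P \<Longrightarrow> x \<in> X \<Longrightarrow> x' \<in> X \<Longrightarrow> c p x = c p' x' \<longleftrightarrow> p = p' \<and> x = x'"
  unfolding grid_inj_def by blast

lemma lev_CX_image: "lev ((\<lambda>i. CX (f i) (g i)) ` I) a q \<longleftrightarrow> (a q \<noteq> (\<exists>i\<in>I. g i = q \<and> a (f i)))"
  by (auto simp: lev_def fires_def)

lemma lev_NOT_image: "lev ((\<lambda>i. NOT (g i)) ` I) a q \<longleftrightarrow> (a q \<noteq> (\<exists>i\<in>I. g i = q))"
  by (auto simp: lev_def fires_def)

lemma level_ok_image:
  assumes "finite I" "\<And>i. i \<in> I \<Longrightarrow> rop_ok N (f i)"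
    "\<And>i j. i \<in> I \<Longrightarrow> j \<in> I \<Longrightarrow> i \<noteq> j \<Longrightarrow> supp (f i) \<inter> supp (f j) = {}"
  shows "level_ok N (f ` I)"
  using assms unfolding level_ok_def by (metis (no_types, lifting) finite_imageI imageE)

text \<open>One doubling step: each row below \<open>2 ^ t\<close> meets the row
  \<open>2 ^ t\<close> above it. The bound \<open>P\<close> truncates the steps when
  \<open>P\<close> is not a power of two.\<close>

definition dbl_pairs :: "nat \<Rightarrow> nat set \<Rightarrow> nat \<Rightarrow> (nat \<times> nat) set" where
  "dbl_pairs P X t = {(p, x). p < 2 ^ t \<and> p + 2 ^ t < P \<and> x \<in> X}"

definition fan_lev :: "(nat \<Rightarrow> nat \<Rightarrow> nat) \<Rightarrow> nat \<Rightarrow> nat set \<Rightarrow> nat \<Rightarrow> rop set" where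
  "fan_lev c P X t = (\<lambda>i. CX (c (fst i) (snd i)) (c (fst i + 2 ^ t) (snd i))) ` dbl_pairs P X t"

definition gather_lev :: "(nat \<Rightarrow> nat \<Rightarrow> nat) \<Rightarrow> nat \<Rightarrow> nat set \<Rightarrow> nat \<Rightarrow> rop set" where
  "gather_lev c P X t = (\<lambda>i. CX (c (fst i + 2 ^ t) (snd i)) (c (fst i) (snd i))) ` dbl_pairs P X t"

definition fan :: "(nat \<Rightarrow> nat \<Rightarrow> nat) \<Rightarrow> nat \<Rightarrow> nat set \<Rightarrow> nat \<Rightarrow> rop set list" where
  "fan c P X T = map (fan_lev c P X) [0..<T]"

definition gather :: "(nat \<Rightarrow> nat \<Rightarrow> nat) \<Rightarrow> nat \<Rightarrow> nat set \<Rightarrow> nat \<Rightarrow> rop set list" where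
  "gather c P X T = map (gather_lev c P X) (rev [0..<T])"

lemma finite_dbl_pairs: "finite X \<Longrightarrow> finite (dbl_pairs P X t)"
  by (rule finite_subset[of _ "{..<P} \<times> X"]) (auto simp: dbl_pairs_def)

lemma
  assumes inj: "grid_inj c P X" and fin: "finite X" and N: "\<And>p x. p < P \<Longrightarrow> x \<in> X \<Longrightarrow> c p x < N"
  shows fan_lev_ok: "level_ok N (fan_lev c P X t)"
    and gather_lev_ok: "level_ok N (gather_lev c P X t)"
proof -
  have d: "c (fst i) (snd i) \<noteq> c (fst i + 2 ^ t) (snd i)" if "i \<in> dbl_pairs P X t" for i
    using that by (auto simp: dbl_pairs_def grid_injD[OF inj])
  have b: "c (fst i) (snd i) < N" "c (fst i + 2 ^ t) (snd i) < N" if "i \<in> dbl_pairs P X t" for i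
    using that N by (auto simp: dbl_pairs_def)
  have s: "{c (fst i) (snd i), c (fst i + 2 ^ t) (snd i)} \<inter> {c (fst j) (snd j), c (fst j + 2 ^ t) (snd j)} = {}"
    if "i \<in> dbl_pairs P X t" "j \<in> dbl_pairs P X t" "i \<noteq> j" for i j
    using that by (auto simp: dbl_pairs_def grid_injD[OF inj])
  show "level_ok N (fan_lev c P X t)"
    unfolding fan_lev_def
  proof (rule level_ok_image[OF finite_dbl_pairs[OF fin]])
    fix i assume i: "i \<in> dbl_pairs P X t"
    show "rop_ok N (CX (c (fst i) (snd i)) (c (fst i + 2 ^ t) (snd i)))"
      using d[OF i] b[OF i] by (auto simp: rop_ok_def supp_def)
  next
    fix i j assume "i \<in> dbl_pairs P X t" "j \<in> dbl_pairs P X t" "i \<noteq> j"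
    from s[OF this] show "supp (CX (c (fst i) (snd i)) (c (fst i + 2 ^ t) (snd i))) \<inter>
        supp (CX (c (fst j) (snd j)) (c (fst j + 2 ^ t) (snd j))) = {}"
      by (auto simp: supp_def)
  qed
  show "level_ok N (gather_lev c P X t)"
    unfolding gather_lev_def
  proof (rule level_ok_image[OF finite_dbl_pairs[OF fin]])
    fix i assume i: "i \<in> dbl_pairs P X t"
    show "rop_ok N (CX (c (fst i + 2 ^ t) (snd i)) (c (fst i) (snd i)))"
      using d[OF i] b[OF i] by (auto simp: rop_ok_def supp_def)
  next
    fix i j assume "i \<in> dbl_pairs P X t" "j \<in> dbl_pairs P X t" "i \<noteq> j"
    from s[OF this] show "supp (CX (c (fst i + 2 ^ t) (snd i)) (c (fst i) (snd i))) \<inter>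
        supp (CX (c (fst j + 2 ^ t) (snd j)) (c (fst j) (snd j))) = {}"
      by (auto simp: supp_def)
  qed
qed

lemma dbl_pairsD: "i \<in> dbl_pairs P X t \<Longrightarrow> fst i < P \<and> fst i + 2 ^ t < P \<and> snd i \<in> X"
  by (auto simp: dbl_pairs_def)

lemma fan_supp: "R \<in> set (fan c P X T) \<Longrightarrow> r \<in> R \<Longrightarrow> q \<in> supp r \<Longrightarrow> \<exists>p<P. \<exists>x\<in>X. q = c p x"
proof -
  assume h: "R \<in> set (fan c P X T)" "r \<in> R" "q \<in> supp r"
  then obtain t i where i: "i \<in> dbl_pairs P X t" "q = c (fst i) (snd i) \<or> q = c (fst i + 2 ^ t) (snd i)"
    by (auto simp: fan_def fan_lev_def supp_def)
  then show ?thesis using dbl_pairsD[OF i(1)] by blast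
qed

lemma gather_supp: "R \<in> set (gather c P X T) \<Longrightarrow> r \<in> R \<Longrightarrow> q \<in> supp r \<Longrightarrow> \<exists>p<P. \<exists>x\<in>X. q = c p x"
proof -
  assume h: "R \<in> set (gather c P X T)" "r \<in> R" "q \<in> supp r"
  then obtain t i where i: "i \<in> dbl_pairs P X t" "q = c (fst i) (snd i) \<or> q = c (fst i + 2 ^ t) (snd i)"
    by (auto simp: gather_def gather_lev_def supp_def)
  then show ?thesis using dbl_pairsD[OF i(1)] by blast
qed

lemma fan_lev_cell:
  assumes inj: "grid_inj c P X" and "p < P" "x \<in> X"
  shows "lev (fan_lev c P X t) a (c p x) \<longleftrightarrow>
    (a (c p x) \<noteq> (2 ^ t \<le> p \<and> p < 2 ^ Suc t \<and> a (c (p - 2 ^ t) x)))"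
proof -
  have "(\<exists>i\<in>dbl_pairs P X t. c (fst i + 2 ^ t) (snd i) = c p x \<and> a (c (fst i) (snd i)))
      \<longleftrightarrow> (\<exists>i\<in>dbl_pairs P X t. fst i + 2 ^ t = p \<and> snd i = x \<and> a (c (fst i) (snd i)))"
    using assms(2,3) by (intro bex_cong[OF refl]) (auto simp: dbl_pairs_def grid_injD[OF inj])
  also have "\<dots> \<longleftrightarrow> (2 ^ t \<le> p \<and> p < 2 ^ Suc t \<and> a (c (p - 2 ^ t) x))"
    using assms(2,3) by (auto simp: dbl_pairs_def intro!: exI[of _ "p - 2 ^ t"])
  finally show ?thesis by (simp only: fan_lev_def lev_CX_image)
qed

lemma gather_lev_cell:
  assumes inj: "grid_inj c P X" and "p < P" "x \<in> X"
  shows "lev (gather_lev c P X t) a (c p x) \<longleftrightarrow>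
    (a (c p x) \<noteq> (p < 2 ^ t \<and> p + 2 ^ t < P \<and> a (c (p + 2 ^ t) x)))"
proof -
  have "(\<exists>i\<in>dbl_pairs P X t. c (fst i) (snd i) = c p x \<and> a (c (fst i + 2 ^ t) (snd i)))
      \<longleftrightarrow> (\<exists>i\<in>dbl_pairs P X t. fst i = p \<and> snd i = x \<and> a (c (fst i + 2 ^ t) (snd i)))"
    using assms(2,3) by (intro bex_cong[OF refl]) (auto simp: dbl_pairs_def grid_injD[OF inj])
  also have "\<dots> \<longleftrightarrow> (p < 2 ^ t \<and> p + 2 ^ t < P \<and> a (c (p + 2 ^ t) x))"
    using assms(2,3) by (auto simp: dbl_pairs_def)
  finally show ?thesis by (simp only: gather_lev_def lev_CX_image)
qed

text \<open>Step \<open>t\<close> fills row \<open>p\<close> with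
  \<open>2 ^ t \<le> p < 2 ^ Suc t\<close> from row \<open>p - 2 ^ t\<close>, so the number of
  copies doubles.\<close>

lemma fan_cell:
  assumes inj: "grid_inj c P X" and x: "x \<in> X" and z: "\<And>p. 0 < p \<Longrightarrow> p < P \<Longrightarrow> \<not> a (c p x)"
    and p: "p < P"
  shows "clev (fan c P X T) a (c p x) \<longleftrightarrow> p < 2 ^ T \<and> a (c 0 x)"
  using p
proof (induction T arbitrary: p)
  case 0
  then show ?case using z[of p] by (cases "p = 0") (auto simp: fan_def)
next
  case (Suc T)
  have f: "clev (fan c P X (Suc T)) a = lev (fan_lev c P X T) (clev (fan c P X T) a)"
    by (simp add: fan_def)
  show ?case unfolding f fan_lev_cell[OF inj Suc.prems x]
    using Suc.IH[OF Suc.prems] Suc.IH[of "p - 2 ^ T"] Suc.prems by auto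
qed

text \<open>Doubling read backwards is a tree of exclusive ors into row 0. With at most one occupied
  row the total is the value in that row.\<close>

lemma gather_cell:
  assumes inj: "grid_inj c P X" and x: "x \<in> X" and r: "r < P" "r < 2 ^ T"
    and a: "\<And>p. p < P \<Longrightarrow> p < 2 ^ T \<Longrightarrow> a (c p x) \<longleftrightarrow> p = r \<and> v"
  shows "clev (gather c P X T) a (c 0 x) \<longleftrightarrow> v"
  using r a
proof (induction T arbitrary: r a)
  case 0
  then show ?case by (simp add: gather_def)
next
  case (Suc T)
  define b where "b = lev (gather_lev c P X T) a"
  have g: "clev (gather c P X (Suc T)) a = clev (gather c P X T) b"
    by (simp add: gather_def b_def)
  have "r mod 2 ^ T \<le> r" by simp
  show ?case unfolding g
  \<comment> \<open>Folding the upper half of the rows onto the lower one moves the occupied row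
    \<open>r\<close> to \<open>r mod 2 ^ T\<close>.\<close>
  proof (rule Suc.IH[of "r mod 2 ^ T"])
    show "r mod 2 ^ T < P" using Suc.prems(1) \<open>r mod 2 ^ T \<le> r\<close> by linarith
    show "r mod 2 ^ T < 2 ^ T" by simp
    fix p assume p: "p < P" "p < 2 ^ T"
    have "r mod 2 ^ T = (if r < 2 ^ T then r else r - 2 ^ T)"
      using Suc.prems(2) by (simp add: mod_if[of r] le_mod_geq)
    then show "b (c p x) \<longleftrightarrow> p = r mod 2 ^ T \<and> v"
      unfolding b_def gather_lev_cell[OF inj p(1) x]
      using Suc.prems(1,2) Suc.prems(3)[of p] Suc.prems(3)[of "p + 2 ^ T"] p by auto
  qed
qed

section \<open>Conjunctions along binary heaps\<close>

definition and_nodes :: "nat \<Rightarrow> nat \<Rightarrow> nat \<Rightarrow> (nat \<times> nat) set" where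
  "and_nodes P K t = {(p, j). p < P \<and> 2 ^ t \<le> j \<and> j < 2 ^ Suc t \<and> j < K}"

text \<open>Each row is a binary heap: node \<open>j\<close> has children \<open>2 j\<close> and \<open>2 j + 1\<close>,
  and the leaves are \<open>K, \<dots>, 2 K - 1\<close>.\<close>

definition and_lev :: "(nat \<Rightarrow> nat \<Rightarrow> nat) \<Rightarrow> nat \<Rightarrow> nat \<Rightarrow> nat \<Rightarrow> rop set" where
  "and_lev c P K t = (\<lambda>i. CCX (c (fst i) (2 * snd i)) (c (fst i) (2 * snd i + 1)) (c (fst i) (snd i))) ` and_nodes P K t"

definition and_heap :: "(nat \<Rightarrow> nat \<Rightarrow> nat) \<Rightarrow> nat \<Rightarrow> nat \<Rightarrow> nat \<Rightarrow> rop set list" where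
  "and_heap c P K T = map (and_lev c P K) (rev [0..<T])"

lemma two_mult_ne: "2 * j \<noteq> Suc (2 * i)" "Suc (2 * i) \<noteq> 2 * (j::nat)"
  by presburger+

lemma and_lev_ok:
  assumes inj: "grid_inj c P {..<2 * K}" and N: "\<And>p j. p < P \<Longrightarrow> j < 2 * K \<Longrightarrow> c p j < N"
  shows "level_ok N (and_lev c P K t)"
  unfolding and_lev_def
proof (rule level_ok_image)
  show "finite (and_nodes P K t)"
    by (rule finite_subset[of _ "{..<P} \<times> {..<K}"]) (auto simp: and_nodes_def)
next
  fix i assume "i \<in> and_nodes P K t"
  then obtain p j where i: "i = (p, j)" "p < P" "0 < j" "j < K"
    by (auto simp: and_nodes_def)
  then show "rop_ok N (CCX (c (fst i) (2 * snd i)) (c (fst i) (2 * snd i + 1)) (c (fst i) (snd i)))"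
    using N by (auto simp: rop_ok_def supp_def grid_injD[OF inj])
next
  fix i i' assume "i \<in> and_nodes P K t" "i' \<in> and_nodes P K t" "i \<noteq> i'"
  then show "supp (CCX (c (fst i) (2 * snd i)) (c (fst i) (2 * snd i + 1)) (c (fst i) (snd i))) \<inter>
      supp (CCX (c (fst i') (2 * snd i')) (c (fst i') (2 * snd i' + 1)) (c (fst i') (snd i'))) = {}"
    by (auto simp: and_nodes_def supp_def grid_injD[OF inj] two_mult_ne)
qed

lemma and_heap_supp: "R \<in> set (and_heap c P K T) \<Longrightarrow> r \<in> R \<Longrightarrow> q \<in> supp r \<Longrightarrow> \<exists>p<P. \<exists>j<2 * K. q = c p j"
proof -
  assume h: "R \<in> set (and_heap c P K T)" "r \<in> R" "q \<in> supp r"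
  then obtain p j where "p < P" "j < K" "q \<in> {c p (2 * j), c p (2 * j + 1), c p j}"
    by (auto simp: and_heap_def and_lev_def and_nodes_def supp_def)
  moreover from \<open>j < K\<close> have "2 * j < 2 * K" "2 * j + 1 < 2 * K" "j < 2 * K" by auto
  ultimately show ?thesis by blast
qed

lemma and_lev_cell:
  assumes inj: "grid_inj c P {..<2 * K}" and "p < P" "j < 2 * K"
  shows "lev (and_lev c P K t) a (c p j) \<longleftrightarrow>
    (a (c p j) \<noteq> (2 ^ t \<le> j \<and> j < 2 ^ Suc t \<and> j < K \<and> a (c p (2 * j)) \<and> a (c p (2 * j + 1))))"
proof -
  have "(\<exists>i\<in>and_nodes P K t. c (fst i) (snd i) = c p j \<and> a (c (fst i) (2 * snd i)) \<and> a (c (fst i) (2 * snd i + 1)))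
     \<longleftrightarrow> (\<exists>i\<in>and_nodes P K t. fst i = p \<and> snd i = j \<and> a (c (fst i) (2 * snd i)) \<and> a (c (fst i) (2 * snd i + 1)))"
    using assms(2,3) by (intro bex_cong[OF refl]) (auto simp: and_nodes_def grid_injD[OF inj])
  also have "\<dots> \<longleftrightarrow> (2 ^ t \<le> j \<and> j < 2 ^ Suc t \<and> j < K \<and> a (c p (2 * j)) \<and> a (c p (2 * j + 1)))"
    using assms(2) by (auto simp: and_nodes_def)
  finally show ?thesis by (auto simp: and_lev_def lev_def fires_def)
qed

text \<open>The final state is described by a recursion within itself: each inner node is the
  conjunction of the final values of its children. Node 0 is excluded because it would be its own
  child.\<close>

lemma and_heap_cell:
  assumes inj: "grid_inj c P {..<2 * K}" and p: "p < P"
    and z: "\<And>j. 0 < j \<Longrightarrow> j < K \<Longrightarrow> j < 2 ^ T \<Longrightarrow> \<not> a (c p j)"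
  shows "\<forall>j<2 * K. clev (and_heap c P K T) a (c p j) \<longleftrightarrow>
     (if 0 < j \<and> j < K \<and> j < 2 ^ T
      then clev (and_heap c P K T) a (c p (2 * j)) \<and> clev (and_heap c P K T) a (c p (2 * j + 1))
      else a (c p j))"
  using z
proof (induction T arbitrary: a)
  case 0
  then show ?case by (auto simp: and_heap_def)
next
  case (Suc T)
  define b where "b = lev (and_lev c P K T) a"
  have g: "clev (and_heap c P K (Suc T)) a = clev (and_heap c P K T) b"
    by (simp add: and_heap_def b_def)
  define e where "e = clev (and_heap c P K T) b"
  have b: "b (c p j) \<longleftrightarrow>
    (a (c p j) \<noteq> (2 ^ T \<le> j \<and> j < 2 ^ Suc T \<and> j < K \<and> a (c p (2 * j)) \<and> a (c p (2 * j + 1))))"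
    if "j < 2 * K" for j
    unfolding b_def by (rule and_lev_cell[OF inj p that])
  have IH: "e (c p j) \<longleftrightarrow> (if 0 < j \<and> j < K \<and> j < 2 ^ T
      then e (c p (2 * j)) \<and> e (c p (2 * j + 1)) else b (c p j))" if "j < 2 * K" for j
    using Suc.IH[of b] Suc.prems b that unfolding e_def by auto
  show ?case unfolding g e_def[symmetric]
  proof (intro allI impI)
    fix j assume j: "j < 2 * K"
    consider "0 < j \<and> j < K \<and> j < 2 ^ T" | "2 ^ T \<le> j \<and> j < 2 ^ Suc T \<and> j < K"
      | "\<not> (0 < j \<and> j < K \<and> j < 2 ^ Suc T)" by linarith
    then show "e (c p j) \<longleftrightarrow> (if 0 < j \<and> j < K \<and> j < 2 ^ Suc T
      then e (c p (2 * j)) \<and> e (c p (2 * j + 1)) else a (c p j))"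
    proof cases
      case 1
      then show ?thesis using IH[OF j] by auto
    next
      case 2
      have pos: "0 < j" using 2 by (metis gr0I not_less pos2 zero_less_power)
      have k: "2 * j < 2 * K" "2 * j + 1 < 2 * K" using 2 by auto
      \<comment> \<open>The children of a node of depth \<open>T\<close> have index at least
        \<open>2 ^ Suc T\<close>. Neither this level nor the later ones write there, so they keep
        their initial values.\<close>
      have 3: "\<not> 2 * j < 2 ^ Suc T" "\<not> 2 * j + 1 < 2 ^ Suc T" using 2 by auto
      then have "\<not> 2 * j < 2 ^ T" "\<not> 2 * j + 1 < 2 ^ T" by auto
      then have "e (c p (2 * j)) = a (c p (2 * j))" "e (c p (2 * j + 1)) = a (c p (2 * j + 1))"
        using IH[OF k(1)] IH[OF k(2)] b[OF k(1)] b[OF k(2)] 3 by auto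
      moreover have "e (c p j) = b (c p j)" using IH[OF j] 2 by auto
      moreover have "\<not> a (c p j)" using Suc.prems[of j] 2 pos by auto
      ultimately show ?thesis using b[OF j] 2 pos by auto
    next
      case 3
      then show ?thesis using IH[OF j] b[OF j] by (cases "j = 0") auto
    qed
  qed
qed

text \<open>Every index from 2 to 2 K - 1 has its parent \<open>j div 2\<close> among the inner
  nodes, so truth descends from the root; conversely it climbs from the leaves. This works for every
  positive \<open>K\<close>, not only for powers of two.\<close>

lemma heap_root:
  fixes K :: nat
  assumes K: "0 < K"
    and v: "\<And>j. 0 < j \<Longrightarrow> j < K \<Longrightarrow> v j \<longleftrightarrow> v (2 * j) \<and> v (2 * j + 1)"
  shows "v 1 \<longleftrightarrow> (\<forall>i<K. v (K + i))"
proof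
  assume 1: "v 1"
  have "0 < j \<Longrightarrow> j < 2 * K \<Longrightarrow> v j" for j
  proof (induction j rule: less_induct)
    case (less j)
    show ?case
    proof (cases "j = 1")
      case False
      then have h: "0 < j div 2" "j div 2 < j" "j div 2 < K" using less.prems by auto
      then have "v (j div 2)" using less.IH by auto
      then have "v (2 * (j div 2)) \<and> v (2 * (j div 2) + 1)" using v h by blast
      then show ?thesis by (metis even_two_times_div_two odd_two_times_div_two_succ)
    qed (use 1 in simp)
  qed
  then show "\<forall>i<K. v (K + i)" using K by auto
next
  assume l: "\<forall>i<K. v (K + i)"
  have "0 < j \<Longrightarrow> j < 2 * K \<Longrightarrow> v j" for j
  proof (induction "2 * K - j" arbitrary: j rule: less_induct)
    case less
    show ?case
    proof (cases "j < K")
      case True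
      then have "v (2 * j)" "v (2 * j + 1)" using less.hyps less.prems by auto
      then show ?thesis using v True less.prems by blast
    next
      case False
      then show ?thesis using l less.prems by (metis add_diff_inverse_nat less_diff_conv2 mult_2 not_less)
    qed
  qed
  then show "v 1" using K by auto
qed

lemma and_heap_root:
  assumes inj: "grid_inj c P {..<2 * K}" and p: "p < P" and K: "0 < K" "K \<le> 2 ^ T"
    and z: "\<And>j. 0 < j \<Longrightarrow> j < K \<Longrightarrow> \<not> a (c p j)"
  shows "clev (and_heap c P K T) a (c p 1) \<longleftrightarrow> (\<forall>i<K. a (c p (K + i)))"
proof -
  note h = and_heap_cell[OF inj p, of T a, rule_format]
  have "clev (and_heap c P K T) a (c p 1) \<longleftrightarrow> (\<forall>i<K. clev (and_heap c P K T) a (c p (K + i)))"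
    by (rule heap_root[OF K(1)]) (use h z K(2) in auto)
  moreover have "clev (and_heap c P K T) a (c p (K + i)) = a (c p (K + i))" if "i < K" for i
    using h[of "K + i"] that z by auto
  ultimately show ?thesis by auto
qed

section \<open>Exchanging binary strings with single excitations\<close>

text \<open>\<open>pos\<close> addresses the register, \<open>hot\<close> the excitations and
  \<open>cell p\<close> the private row of the string \<open>w p\<close>; \<open>T\<close> and
  \<open>T'\<close> bound the logarithms of the number of strings and of the number of leaves. A row
  has k + 1 leaves: the spare one becomes constantly true and keeps the heap non-empty when k = 0,
  which occurs for a dictionary with one item.\<close>

locale string_rows =
  fixes N k P T T' :: nat and pos hot :: "nat \<Rightarrow> nat" and cell :: "nat \<Rightarrow> nat \<Rightarrow> nat" and w :: "nat \<Rightarrow> asg"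
  assumes pos_less: "\<And>i. i < k \<Longrightarrow> pos i < N"
    and hot_less: "\<And>p. p < P \<Longrightarrow> hot p < N"
    and cell_less: "\<And>p j. p < P \<Longrightarrow> j < 2 * Suc k \<Longrightarrow> cell p j < N"
    and pos_inj: "inj_on pos {..<k}"
    and hot_inj: "inj_on hot {..<P}"
    and cell_inj: "grid_inj cell P {..<2 * Suc k}"
    and pos_hot: "\<And>i p. i < k \<Longrightarrow> p < P \<Longrightarrow> pos i \<noteq> hot p"
    and pos_cell: "\<And>i p j. i < k \<Longrightarrow> p < P \<Longrightarrow> j < 2 * Suc k \<Longrightarrow> pos i \<noteq> cell p j"
    and hot_cell: "\<And>p p' j. p < P \<Longrightarrow> p' < P \<Longrightarrow> j < 2 * Suc k \<Longrightarrow> hot p \<noteq> cell p' j"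
    and P_pos: "0 < P" and P_le: "P \<le> 2 ^ T" and k_le: "Suc k \<le> 2 ^ T'"
    and strings_distinct: "\<And>p p'. p < P \<Longrightarrow> p' < P \<Longrightarrow> \<forall>i<k. w p (pos i) = w p' (pos i) \<Longrightarrow> p = p'"
begin

abbreviation "leaf p i \<equiv> cell p (Suc k + i)"

definition load_x where "load_x = (\<lambda>i. CX (pos i) (leaf 0 i)) ` {..<k}"

text \<open>A copied input bit, negated where the string has a zero, says whether the two agree. The
  index i = k passes the implication vacuously, which sets the spare leaf to true.\<close>

definition negate where
  "negate = (\<lambda>i. NOT (leaf (fst i) (snd i))) ` {(p, i). p < P \<and> i < Suc k \<and> (i < k \<longrightarrow> \<not> w p (pos i))}"

definition match_comp where
  "match_comp = load_x # fan leaf P {..<k} T @ negate # and_heap cell P (Suc k) T'"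

definition match_out where "match_out = (\<lambda>p. CX (cell p 1) (hot p)) ` {..<P}"

definition match where "match = match_comp @ match_out # rev match_comp"

definition load_hot where "load_hot = (\<lambda>p. CX (hot p) (cell p 0)) ` {..<P}"

definition mask where
  "mask = (\<lambda>i. CX (cell (fst i) (snd i)) (leaf (fst i) (snd i))) ` {(p, i). p < P \<and> i < k \<and> w p (pos i)}"

text \<open>A hot qubit can control one gate per level, so its value is first spread over the cells
  0, ..., k - 1 of its row. The masked strings of all rows are then summed into row 0.\<close>

definition emit_comp where
  "emit_comp = load_hot # fan (\<lambda>i p. cell p i) k {..<P} T' @ mask # gather leaf P {..<k} T"

definition emit_out where "emit_out = (\<lambda>i. CX (leaf 0 i) (pos i)) ` {..<k}"

definition emit where "emit = emit_comp @ emit_out # rev emit_comp"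

lemma cell_eq: "p < P \<Longrightarrow> p' < P \<Longrightarrow> j < 2 * Suc k \<Longrightarrow> j' < 2 * Suc k \<Longrightarrow> cell p j = cell p' j' \<longleftrightarrow> p = p' \<and> j = j'"
  using grid_injD[OF cell_inj] by simp

lemma leaf_inj: "grid_inj leaf P {..<k}"
  unfolding grid_inj_def by (simp add: cell_eq)

lemma row_inj: "grid_inj (\<lambda>i p. cell p i) k {..<P}"
  unfolding grid_inj_def by (auto simp: cell_eq)

lemma hot_eq: "p < P \<Longrightarrow> p' < P \<Longrightarrow> hot p = hot p' \<longleftrightarrow> p = p'"
  using hot_inj by (auto simp: inj_on_def)

lemma pos_eq: "i < k \<Longrightarrow> i' < k \<Longrightarrow> pos i = pos i' \<longleftrightarrow> i = i'"
  using pos_inj by (auto simp: inj_on_def)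

definition scratch0 :: "asg \<Rightarrow> bool" where
  "scratch0 a \<longleftrightarrow> (\<forall>p<P. \<forall>j<2 * Suc k. \<not> a (cell p j))"

lemma match_comp_root:
  assumes a: "scratch0 a" and p: "p < P"
  shows "clev match_comp a (cell p 1) \<longleftrightarrow> (\<forall>i<k. a (pos i) = w p (pos i))"
proof -
  define a1 where "a1 = lev load_x a"
  define a2 where "a2 = clev (fan leaf P {..<k} T) a1"
  define a3 where "a3 = lev negate a2"
  have a1: "a1 (leaf p i) \<longleftrightarrow> p = 0 \<and> a (pos i)" if "p < P" "i < k" for p i
    using that a P_pos unfolding a1_def load_x_def lev_CX_image scratch0_def by (auto simp: cell_eq)
  \<comment> \<open>These are the inner heap nodes and the spare leaf: loading and fan-out leave
    them at zero, as the conjunction requires before the negations.\<close>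
  have a1': "\<not> a1 (cell p j)" if "p < P" "j < Suc k \<or> j = Suc k + k" for p j
    using that a P_pos unfolding a1_def load_x_def lev_CX_image scratch0_def by (auto simp: cell_eq)
  have a2: "a2 (leaf p i) \<longleftrightarrow> a (pos i)" if "p < P" "i < k" for p i
    using fan_cell[OF leaf_inj, of i a1 p T] that a1 P_pos P_le by (auto simp: a2_def)
  have a2': "\<not> a2 (cell p j)" if "p < P" "j < Suc k \<or> j = Suc k + k" for p j
  proof -
    have "a2 (cell p j) = a1 (cell p j)" unfolding a2_def
    proof (rule clev_outside)
      fix R r assume "R \<in> set (fan leaf P {..<k} T)" "r \<in> R"
      then obtain p' i where "p' < P" "i < k" "tgt r = leaf p' i"
        using fan_supp[of R leaf P "{..<k}" T r "tgt r"] by (auto simp: supp_def)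
      then show "tgt r \<noteq> cell p j" using that by (auto simp: cell_eq)
    qed
    then show ?thesis using a1' that by simp
  qed
  have a3: "a3 (leaf p i) \<longleftrightarrow> (a2 (leaf p i) \<noteq> (i < k \<longrightarrow> \<not> w p (pos i)))" if "i < Suc k" for i
    using that p unfolding a3_def negate_def lev_NOT_image by (auto simp: cell_eq)
  have a3': "\<not> a3 (cell p j)" if "j < Suc k" for j
    using that p a2'[OF p] unfolding a3_def negate_def lev_NOT_image by (auto simp: cell_eq)
  have "clev match_comp a (cell p 1) \<longleftrightarrow> clev (and_heap cell P (Suc k) T') a3 (cell p 1)"
    by (simp add: match_comp_def a1_def a2_def a3_def)
  also have "\<dots> \<longleftrightarrow> (\<forall>i<Suc k. a3 (leaf p i))"
    by (rule and_heap_root[OF cell_inj p]) (use k_le a3' in auto)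
  also have "\<dots> \<longleftrightarrow> (\<forall>i<k. a (pos i) = w p (pos i))"
    using a3 a2[OF p] a2'[OF p, of "Suc k + k"] by (auto simp: less_Suc_eq)
  finally show ?thesis .
qed

text \<open>The flag \<open>v\<close> tells whether there is an excitation at all, so that the
  excitation at \<open>r\<close> and the vacuum are treated together.\<close>

lemma emit_comp_root:
  assumes a: "scratch0 a" and r: "r < P" and h: "\<And>p. p < P \<Longrightarrow> a (hot p) \<longleftrightarrow> p = r \<and> v" and i: "i < k"
  shows "clev emit_comp a (leaf 0 i) \<longleftrightarrow> v \<and> w r (pos i)"
proof -
  define a1 where "a1 = lev load_hot a"
  define a2 where "a2 = clev (fan (\<lambda>i p. cell p i) k {..<P} T') a1"
  define a3 where "a3 = lev mask a2"
  have a1: "a1 (cell p j) \<longleftrightarrow> j = 0 \<and> a (hot p)" if "p < P" "j < 2 * Suc k" for p j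
    using that a unfolding a1_def load_hot_def lev_CX_image scratch0_def by (auto simp: cell_eq)
  have a2: "a2 (cell p j) \<longleftrightarrow> a (hot p)" if "p < P" "j < k" for p j
    using fan_cell[OF row_inj, of p a1 j T'] that a1 k_le by (auto simp: a2_def)
  have a2': "\<not> a2 (leaf p j)" if "p < P" "j < k" for p j
  proof -
    have "a2 (leaf p j) = a1 (leaf p j)" unfolding a2_def
    proof (rule clev_outside)
      fix R r assume "R \<in> set (fan (\<lambda>i p. cell p i) k {..<P} T')" "r \<in> R"
      then obtain p' i where "p' < P" "i < k" "tgt r = cell p' i"
        using fan_supp[of R "\<lambda>i p. cell p i" k "{..<P}" T' r "tgt r"] by (auto simp: supp_def)
      then show "tgt r \<noteq> leaf p j" using that by (auto simp: cell_eq)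
    qed
    then show ?thesis using a1 that by simp
  qed
  have a3: "a3 (leaf p j) \<longleftrightarrow> w p (pos j) \<and> a (hot p)" if "p < P" "j < k" for p j
    using that a2 a2'[OF that] unfolding a3_def mask_def lev_CX_image by (auto simp: cell_eq)
  have "clev emit_comp a (leaf 0 i) \<longleftrightarrow> clev (gather leaf P {..<k} T) a3 (leaf 0 i)"
    by (simp add: emit_comp_def a1_def a2_def a3_def)
  also have "\<dots> \<longleftrightarrow> v \<and> w r (pos i)"
    by (rule gather_cell[OF leaf_inj _ r]) (use i r P_le a3 h in auto)
  finally show ?thesis .
qed

lemma match_comp_ok: "\<forall>R\<in>set match_comp. level_ok N R"
proof -
  have "level_ok N load_x" unfolding load_x_def
    by (rule level_ok_image) (use pos_less cell_less P_pos pos_cell pos_cell[symmetric] in \<open>auto simp: rop_ok_def supp_def cell_eq pos_eq\<close>)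
  moreover have "level_ok N negate" unfolding negate_def
  proof (rule level_ok_image)
    show "finite {(p, i). p < P \<and> i < Suc k \<and> (i < k \<longrightarrow> \<not> w p (pos i))}"
      by (rule finite_subset[of _ "{..<P} \<times> {..<Suc k}"]) auto
  qed (use cell_less in \<open>auto simp: rop_ok_def supp_def cell_eq\<close>)
  moreover have "level_ok N (fan_lev leaf P {..<k} t)" for t
    by (rule fan_lev_ok[OF leaf_inj]) (use cell_less in auto)
  moreover have "level_ok N (and_lev cell P (Suc k) t)" for t
    by (rule and_lev_ok[OF cell_inj]) (use cell_less in auto)
  ultimately show ?thesis by (auto simp: match_comp_def fan_def and_heap_def)
qed

lemma match_out_ok: "level_ok N match_out"
  unfolding match_out_def
  by (rule level_ok_image) (use hot_less cell_less hot_cell hot_cell[symmetric] in \<open>auto simp: rop_ok_def supp_def cell_eq hot_eq\<close>)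

lemma emit_comp_ok: "\<forall>R\<in>set emit_comp. level_ok N R"
proof -
  have "level_ok N load_hot" unfolding load_hot_def
    by (rule level_ok_image) (use hot_less cell_less hot_cell hot_cell[symmetric] in \<open>auto simp: rop_ok_def supp_def cell_eq hot_eq\<close>)
  moreover have "level_ok N mask" unfolding mask_def
  proof (rule level_ok_image)
    show "finite {(p, i). p < P \<and> i < k \<and> w p (pos i)}"
      by (rule finite_subset[of _ "{..<P} \<times> {..<k}"]) auto
  qed (use cell_less in \<open>auto simp: rop_ok_def supp_def cell_eq\<close>)
  moreover have "level_ok N (fan_lev (\<lambda>i p. cell p i) k {..<P} t)" for t
    by (rule fan_lev_ok[OF row_inj]) (use cell_less in auto)
  moreover have "level_ok N (gather_lev leaf P {..<k} t)" for t
    by (rule gather_lev_ok[OF leaf_inj]) (use cell_less in auto)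
  ultimately show ?thesis by (auto simp: emit_comp_def fan_def gather_def)
qed

lemma emit_out_ok: "level_ok N emit_out"
  unfolding emit_out_def
  by (rule level_ok_image) (use pos_less cell_less P_pos pos_cell pos_cell[symmetric] in \<open>auto simp: rop_ok_def supp_def cell_eq pos_eq\<close>)

lemma match_comp_supp:
  assumes "R \<in> set match_comp" "r \<in> R" "q \<in> supp r"
  shows "(\<exists>i<k. q = pos i) \<or> (\<exists>p<P. \<exists>j<2 * Suc k. q = cell p j)"
proof -
  consider "R = load_x" | "R \<in> set (fan leaf P {..<k} T)" | "R = negate" | "R \<in> set (and_heap cell P (Suc k) T')"
    using assms(1) by (auto simp: match_comp_def)
  then show ?thesis
  proof cases
    case 1
    then obtain i where "i < k" "q = pos i \<or> q = leaf 0 i"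
      using assms by (auto simp: load_x_def supp_def)
    moreover from this have "Suc k + i < 2 * Suc k" by simp
    ultimately show ?thesis using P_pos by blast
  next
    case 2
    then obtain p i where "p < P" "i < k" "q = leaf p i" using fan_supp[OF 2 assms(2,3)] by blast
    moreover from this have "Suc k + i < 2 * Suc k" by simp
    ultimately show ?thesis by blast
  next
    case 3
    then obtain p i where "p < P" "i < Suc k" "q = leaf p i"
      using assms by (auto simp: negate_def supp_def)
    moreover from this have "Suc k + i < 2 * Suc k" by simp
    ultimately show ?thesis by blast
  next
    case 4
    then show ?thesis using and_heap_supp[OF 4 assms(2,3)] by blast
  qed
qed

lemma emit_comp_supp:
  assumes "R \<in> set emit_comp" "r \<in> R" "q \<in> supp r"
  shows "(\<exists>p<P. q = hot p) \<or> (\<exists>p<P. \<exists>j<2 * Suc k. q = cell p j)"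
proof -
  consider "R = load_hot" | "R \<in> set (fan (\<lambda>i p. cell p i) k {..<P} T')" | "R = mask"
    | "R \<in> set (gather leaf P {..<k} T)"
    using assms(1) by (auto simp: emit_comp_def)
  then show ?thesis
  proof cases
    case 1
    then obtain p where "p < P" "q = hot p \<or> q = cell p 0"
      using assms by (auto simp: load_hot_def supp_def)
    then show ?thesis by (metis zero_less_Suc nat_0_less_mult_iff pos2)
  next
    case 2
    then obtain p i where "p < P" "i < k" "q = cell p i" using fan_supp[OF 2 assms(2,3)] by blast
    moreover from this have "i < 2 * Suc k" by simp
    ultimately show ?thesis by blast
  next
    case 3
    then obtain p i where "p < P" "i < k" "q = cell p i \<or> q = leaf p i"
      using assms by (auto simp: mask_def supp_def)
    moreover from this have "i < 2 * Suc k" "Suc k + i < 2 * Suc k" by auto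
    ultimately show ?thesis by blast
  next
    case 4
    then obtain p i where "p < P" "i < k" "q = leaf p i" using gather_supp[OF 4 assms(2,3)] by blast
    moreover from this have "Suc k + i < 2 * Suc k" by simp
    ultimately show ?thesis by blast
  qed
qed

lemma clev_match:
  assumes "scratch0 a"
  shows "clev match a = (\<lambda>q. a q \<noteq> (\<exists>p<P. hot p = q \<and> (\<forall>i<k. a (pos i) = w p (pos i))))"
proof -
  have "clev match a = (\<lambda>q. a q \<noteq> (\<exists>r\<in>match_out. tgt r = q \<and> fires r (clev match_comp a)))"
    unfolding match_def
  proof (rule clev_compute_copy_uncompute[OF match_comp_ok])
    fix R r r' assume h: "R \<in> set match_comp" "r \<in> R" "r' \<in> match_out"
    then obtain p where "p < P" "tgt r' = hot p" by (auto simp: match_out_def)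
    then show "tgt r' \<notin> supp r"
      using match_comp_supp[OF h(1,2)] pos_hot hot_cell by metis
  qed
  also have "\<dots> = (\<lambda>q. a q \<noteq> (\<exists>p<P. hot p = q \<and> clev match_comp a (cell p 1)))"
    by (auto simp: match_out_def fires_def)
  also have "\<dots> = (\<lambda>q. a q \<noteq> (\<exists>p<P. hot p = q \<and> (\<forall>i<k. a (pos i) = w p (pos i))))"
    using match_comp_root[OF assms] by (intro ext) metis
  finally show ?thesis .
qed

section \<open>Encoding a string as an excitation and decoding it\<close>

lemma clev_emit:
  assumes "scratch0 a" "r < P" "\<And>p. p < P \<Longrightarrow> a (hot p) \<longleftrightarrow> p = r \<and> v"
  shows "clev emit a = (\<lambda>q. a q \<noteq> (\<exists>i<k. pos i = q \<and> v \<and> w r (pos i)))"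
proof -
  have "clev emit a = (\<lambda>q. a q \<noteq> (\<exists>r\<in>emit_out. tgt r = q \<and> fires r (clev emit_comp a)))"
    unfolding emit_def
  proof (rule clev_compute_copy_uncompute[OF emit_comp_ok])
    fix R r r' assume h: "R \<in> set emit_comp" "r \<in> R" "r' \<in> emit_out"
    then obtain i where "i < k" "tgt r' = pos i" by (auto simp: emit_out_def)
    then show "tgt r' \<notin> supp r"
      using emit_comp_supp[OF h(1,2)] pos_hot pos_cell by metis
  qed
  also have "\<dots> = (\<lambda>q. a q \<noteq> (\<exists>i<k. pos i = q \<and> clev emit_comp a (leaf 0 i)))"
    by (auto simp: emit_out_def fires_def)
  also have "\<dots> = (\<lambda>q. a q \<noteq> (\<exists>i<k. pos i = q \<and> v \<and> w r (pos i)))"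
    using emit_comp_root[OF assms] by (intro ext) metis
  finally show ?thesis .
qed

definition clean :: "asg \<Rightarrow> bool" where
  "clean a \<longleftrightarrow> scratch0 a \<and> (\<forall>p<P. \<not> a (hot p))"

definition matches :: "asg \<Rightarrow> nat \<Rightarrow> bool" where
  "matches a p \<longleftrightarrow> p < P \<and> (\<forall>i<k. a (pos i) = w p (pos i))"

definition setw :: "asg \<Rightarrow> nat \<Rightarrow> asg" where
  "setw a p q = (if q \<in> pos ` {..<k} then w p q else a q)"

definition clear :: "asg \<Rightarrow> asg" where
  "clear a q \<longleftrightarrow> q \<notin> pos ` {..<k} \<and> a q"

lemma matches_unique: "matches a p \<Longrightarrow> matches a p' \<Longrightarrow> p = p'"
  using strings_distinct unfolding matches_def by metis

lemma clean_clear: "clean a \<Longrightarrow> clean (clear a)"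
  by (auto simp: clean_def scratch0_def clear_def)

lemma scratch0_upd: "scratch0 a \<Longrightarrow> p < P \<Longrightarrow> scratch0 (a(hot p := b))"
  using hot_cell[symmetric] by (auto simp: scratch0_def)

text \<open>\<open>match\<close> raises the excitation of the matched string, and
  \<open>emit\<close> adds that string to the register, where it cancels the original.\<close>

lemma encode_match:
  assumes a: "clean a" and m: "matches a p"
  shows "clev (match @ emit) a = (clear a)(hot p := True)"
proof -
  have p: "p < P" using m by (simp add: matches_def)
  have "clev match a = a(hot p := True)"
  proof
    fix q
    have "(\<exists>p'<P. hot p' = q \<and> (\<forall>i<k. a (pos i) = w p' (pos i))) \<longleftrightarrow> q = hot p"
      using m matches_unique unfolding matches_def by metis
    then show "clev match a q = (a(hot p := True)) q"
      using a clev_match[of a] p by (auto simp: clean_def)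
  qed
  moreover have "clev emit (a(hot p := True)) = (\<lambda>q. (a(hot p := True)) q \<noteq> (\<exists>i<k. pos i = q \<and> True \<and> w p (pos i)))"
    by (rule clev_emit[OF _ p]) (use a p in \<open>auto simp: clean_def scratch0_upd hot_eq\<close>)
  moreover have "\<dots> = (clear a)(hot p := True)"
    using m pos_hot by (auto simp: fun_eq_iff clear_def matches_def)
  ultimately show ?thesis by simp
qed

lemma encode_no_match:
  assumes a: "clean a" and m: "\<And>p. \<not> matches a p"
  shows "clev (match @ emit) a = a" "clev (emit @ match) a = a"
proof -
  have "clev match a = a"
    using a clev_match[of a] m by (auto simp: clean_def matches_def)
  \<comment> \<open>In the vacuum any index can stand for \<open>r\<close>; the value
    \<open>False\<close> suppresses its string.\<close>
  moreover have "clev emit a = (\<lambda>q. a q \<noteq> (\<exists>i<k. pos i = q \<and> False \<and> w 0 (pos i)))"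
    by (rule clev_emit[OF _ P_pos]) (use a in \<open>auto simp: clean_def\<close>)
  ultimately show "clev (match @ emit) a = a" "clev (emit @ match) a = a" by simp_all
qed

text \<open>In the opposite order, \<open>emit\<close> writes the string into the emptied register
  and \<open>match\<close> recognises it and toggles its excitation off. This holds for every
  \<open>p\<close>, since the middle circuit may have moved the excitation.\<close>

lemma decode:
  assumes a: "clean a" and p: "p < P"
  shows "clev (emit @ match) ((clear a)(hot p := True)) = setw a p"
proof -
  have c: "clean (clear a)" using a by (rule clean_clear)
  have "clev emit ((clear a)(hot p := True)) = (\<lambda>q. ((clear a)(hot p := True)) q \<noteq> (\<exists>i<k. pos i = q \<and> True \<and> w p (pos i)))"
    by (rule clev_emit[OF _ p]) (use c p in \<open>auto simp: clean_def scratch0_upd hot_eq\<close>)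
  also have "\<dots> = (setw a p)(hot p := True)"
    using pos_hot p by (auto simp: fun_eq_iff clear_def setw_def)
  finally have 1: "clev emit ((clear a)(hot p := True)) = (setw a p)(hot p := True)" .
  have cs: "clean (setw a p)"
    using a pos_hot[symmetric] pos_cell[symmetric] by (auto simp: clean_def scratch0_def setw_def)
  have "clev match ((setw a p)(hot p := True)) = setw a p"
  proof
    fix q
    let ?b = "(setw a p)(hot p := True)"
    have "(\<forall>i<k. ?b (pos i) = w p' (pos i)) \<longleftrightarrow> p' = p" if "p' < P" for p'
      using strings_distinct[OF p that] pos_hot p by (auto simp: setw_def)
    then have m: "(\<exists>p'<P. hot p' = q \<and> (\<forall>i<k. ?b (pos i) = w p' (pos i))) \<longleftrightarrow> q = hot p"
      using p by metis
    have "scratch0 ?b" using cs p by (simp add: clean_def scratch0_upd)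
    from fun_cong[OF clev_match[OF this], of q]
    have "clev match ?b q \<longleftrightarrow> (?b q \<noteq> (q = hot p))" unfolding m .
    then show "clev match ?b q = setw a p q"
      using cs p by (auto simp: clean_def)
  qed
  then show ?thesis using 1 by simp
qed

definition hot_state :: "(nat \<Rightarrow> complex) \<Rightarrow> asg \<Rightarrow> wave" where
  "hot_state v a = (\<lambda>b. \<Sum>p<P. v p * ket (a(hot p := True)) b)"

text \<open>The vacuum must be fixed because an input that matches no string reaches the circuit
  without an excitation. Quantifying over \<open>a\<close> makes the action independent of all
  spectators.\<close>

definition hot_acts :: "circuit \<Rightarrow> ((nat \<Rightarrow> complex) \<Rightarrow> nat \<Rightarrow> complex) \<Rightarrow> bool" where
  "hot_acts C F \<longleftrightarrow> (\<forall>a. (\<forall>p<P. \<not> a (hot p)) \<longrightarrow>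
     cop C (ket a) = ket a \<and> (\<forall>v. cop C (hot_state v a) = hot_state (F v) a))"

text \<open>Conjugation by the exchange. \<open>match\<close> and \<open>emit\<close> have 2 T + 2
  T' + 5 levels each; both are run before and after \<open>C\<close>, at five layers per
  level.\<close>

lemma sparse_circuit:
  assumes C: "circuit_ok N C" "hot_acts C F"
  shows "\<exists>C'. circuit_ok N C' \<and> length C' = length C + 10 * (4 * T + 4 * T' + 10) \<and>
    (\<forall>a p. clean a \<longrightarrow> matches a p \<longrightarrow>
       cop C' (ket a) = (\<lambda>b. \<Sum>p'<P. F (\<lambda>r. of_bool (r = p)) p' * ket (setw a p') b)) \<and>
    (\<forall>a. clean a \<longrightarrow> (\<forall>p. \<not> matches a p) \<longrightarrow> cop C' (ket a) = ket a)"
proof -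
  have ok: "\<forall>R\<in>set (match @ emit). level_ok N R" "\<forall>R\<in>set (emit @ match). level_ok N R"
    using match_comp_ok match_out_ok emit_comp_ok emit_out_ok by (auto simp: match_def emit_def)
  obtain C1 where C1: "circuit_ok N C1" "length C1 = 5 * length (match @ emit)"
    "\<And>a. cop C1 (ket a) = ket (clev (match @ emit) a)"
    using clev_circuit[OF ok(1)] by blast
  obtain C2 where C2: "circuit_ok N C2" "length C2 = 5 * length (emit @ match)"
    "\<And>a. cop C2 (ket a) = ket (clev (emit @ match) a)"
    using clev_circuit[OF ok(2)] by blast
  define C' where "C' = C1 @ C @ C2"
  have len: "length (match @ emit) = 4 * T + 4 * T' + 10"
    by (simp add: match_def emit_def match_comp_def emit_comp_def fan_def gather_def and_heap_def)
  have "circuit_ok N C'" using C1(1) C2(1) C(1) by (auto simp: C'_def circuit_ok_def)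
  moreover have "length C' = length C + 10 * (4 * T + 4 * T' + 10)"
    using C1(2) C2(2) len by (simp add: C'_def)
  moreover have "cop C' (ket a) = (\<lambda>b. \<Sum>p'<P. F (\<lambda>r. of_bool (r = p)) p' * ket (setw a p') b)"
    if a: "clean a" and m: "matches a p" for a p
  proof -
    have p: "p < P" using m by (simp add: matches_def)
    have h: "\<forall>p<P. \<not> clear a (hot p)" using clean_clear[OF a] by (simp add: clean_def)
    have "ket ((clear a)(hot p := True)) = hot_state (\<lambda>r. of_bool (r = p)) (clear a)"
    proof
      fix b
      have "hot_state (\<lambda>r. of_bool (r = p)) (clear a) b
          = (\<Sum>r<P. if r = p then ket ((clear a)(hot r := True)) b else 0)"
        unfolding hot_state_def by (rule sum.cong) auto
      then show "ket ((clear a)(hot p := True)) b = hot_state (\<lambda>r. of_bool (r = p)) (clear a) b"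
        using p by simp
    qed
    then have "cop C (cop C1 (ket a)) = hot_state (F (\<lambda>r. of_bool (r = p))) (clear a)"
      using C(2) h by (simp add: C1(3) encode_match[OF a m] hot_acts_def del: clev_simps)
    then have "cop C' (ket a) = (\<lambda>b. \<Sum>p'<P. F (\<lambda>r. of_bool (r = p)) p' * cop C2 (ket ((clear a)(hot p' := True))) b)"
      by (simp add: C'_def hot_state_def cop_sum)
    then show ?thesis by (simp add: C2(3) decode[OF a] del: clev_simps)
  qed
  moreover have "cop C' (ket a) = ket a" if a: "clean a" and m: "\<forall>p. \<not> matches a p" for a
  proof -
    have "cop C (ket a) = ket a" using C(2) a by (simp add: hot_acts_def clean_def)
    then show ?thesis using encode_no_match[OF a] m by (simp add: C'_def C1(3) C2(3) del: clev_simps)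
  qed
  ultimately show ?thesis by blast
qed

end

section \<open>Unitaries on single excitations\<close>

type_synonym amp = "nat \<Rightarrow> complex"

text \<open>Amplitudes are total functions on the naturals, so the inner products see only the first
  \<open>P\<close> coordinates while the inverse laws hold everywhere. The adjoint is carried along
  because UNPREP is realised by the inverse of a preparation circuit.\<close>

definition adjoint_pair :: "nat \<Rightarrow> (amp \<Rightarrow> amp) \<Rightarrow> (amp \<Rightarrow> amp) \<Rightarrow> bool" where
  "adjoint_pair P F F' \<longleftrightarrow>
    (\<forall>v w. (\<Sum>r<P. cnj (F v r) * w r) = (\<Sum>r<P. cnj (v r) * F' w r)) \<and>
    (\<forall>v. F' (F v) = v) \<and> (\<forall>v. F (F' v) = v)"

definition unit_amp :: "nat \<Rightarrow> amp" where
  "unit_amp j = (\<lambda>r. of_bool (r = j))"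

definition amp_mat :: "nat \<Rightarrow> (amp \<Rightarrow> amp) \<Rightarrow> complex mat" where
  "amp_mat P F = mat P P (\<lambda>(i,j). F (unit_amp j) i)"

lemma adjoint_pair_sym: "adjoint_pair P F F' \<Longrightarrow> adjoint_pair P F' F"
proof -
  assume h: "adjoint_pair P F F'"
  have "(\<Sum>r<P. cnj (F' v r) * w r) = (\<Sum>r<P. cnj (v r) * F w r)" for v w
  proof -
    have "cnj (\<Sum>r<P. cnj (F w r) * v r) = cnj (\<Sum>r<P. cnj (w r) * F' v r)"
      using h by (simp add: adjoint_pair_def)
    then show ?thesis by (simp add: mult.commute)
  qed
  then show ?thesis using h by (simp add: adjoint_pair_def)
qed

lemma adjoint_pair_comp:
  "adjoint_pair P F F' \<Longrightarrow> adjoint_pair P G G' \<Longrightarrow> adjoint_pair P (\<lambda>v. G (F v)) (\<lambda>v. F' (G' v))"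
  by (simp add: adjoint_pair_def)

lemma sum_unit_amp: "j < P \<Longrightarrow> (\<Sum>r<P. f r * unit_amp j r) = f j" "j < P \<Longrightarrow> (\<Sum>r<P. cnj (unit_amp j r) * f r) = f j"
proof -
  assume j: "j < P"
  have "(\<Sum>r<P. f r * unit_amp j r) = (\<Sum>r<P. if r = j then f r else 0)"
    by (rule sum.cong) (auto simp: unit_amp_def)
  then show "(\<Sum>r<P. f r * unit_amp j r) = f j" using j by simp
  have "(\<Sum>r<P. cnj (unit_amp j r) * f r) = (\<Sum>r<P. if r = j then f r else 0)"
    by (rule sum.cong) (auto simp: unit_amp_def)
  then show "(\<Sum>r<P. cnj (unit_amp j r) * f r) = f j" using j by simp
qed

lemma cadj_amp_mat:
  assumes "adjoint_pair P F F'"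
  shows "cadj (amp_mat P F) = amp_mat P F'"
proof (rule eq_matI)
  fix i j assume "i < dim_row (amp_mat P F')" "j < dim_col (amp_mat P F')"
  then have ij: "i < P" "j < P" by (simp_all add: amp_mat_def)
  have "(\<Sum>r<P. cnj (F (unit_amp i) r) * unit_amp j r) = (\<Sum>r<P. cnj (unit_amp i r) * F' (unit_amp j) r)"
    using assms by (simp add: adjoint_pair_def)
  then have "cnj (F (unit_amp i) j) = F' (unit_amp j) i" using ij by (simp add: sum_unit_amp)
  then show "cadj (amp_mat P F) $$ (i, j) = amp_mat P F' $$ (i, j)"
    using ij by (simp add: cadj_def amp_mat_def)
qed (simp_all add: cadj_def amp_mat_def)

lemma unitary_amp_mat:
  assumes "adjoint_pair P F F'"
  shows "unitary_mat P (amp_mat P F)"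
  unfolding unitary_mat_def
proof (intro conjI eq_matI)
  fix i j assume "i < dim_row (1\<^sub>m P :: complex mat)" "j < dim_col (1\<^sub>m P :: complex mat)"
  then have ij: "i < P" "j < P" by simp_all
  have "(cadj (amp_mat P F) * amp_mat P F) $$ (i, j) = (\<Sum>r<P. cnj (F (unit_amp i) r) * F (unit_amp j) r)"
    using ij by (simp add: cadj_def amp_mat_def scalar_prod_def lessThan_atLeast0)
  also have "\<dots> = unit_amp j i"
    using assms ij by (simp add: adjoint_pair_def sum_unit_amp unit_amp_def[of i])
      (simp add: unit_amp_def)
  finally show "(cadj (amp_mat P F) * amp_mat P F) $$ (i, j) = 1\<^sub>m P $$ (i, j)"
    using ij by (simp add: unit_amp_def)
qed (simp_all add: cadj_def amp_mat_def)

text \<open>Local index 2 is an excitation on the first qubit and index 1 one on the second. The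
  block with rows (\<alpha>, \<beta>) and (\<gamma>, \<delta>) acts on these two; the states with no
  or two excitations are fixed.\<close>

definition mix4 :: "complex \<Rightarrow> complex \<Rightarrow> complex \<Rightarrow> complex \<Rightarrow> complex mat" where
  "mix4 \<alpha> \<beta> \<gamma> \<delta> = mat 4 4 (\<lambda>(i,j). if i = j \<and> (i = 0 \<or> i = 3) then 1
     else if i = 2 \<and> j = 2 then \<alpha> else if i = 2 \<and> j = 1 then \<beta>
     else if i = 1 \<and> j = 2 then \<gamma> else if i = 1 \<and> j = 1 then \<delta> else 0)"

text \<open>Both products of the block with its adjoint are listed, so that the adjoint block
  satisfies the predicate by commutativity alone.\<close>

definition unitary2 :: "complex \<Rightarrow> complex \<Rightarrow> complex \<Rightarrow> complex \<Rightarrow> bool" where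
  "unitary2 \<alpha> \<beta> \<gamma> \<delta> \<longleftrightarrow>
     cnj \<alpha> * \<alpha> + cnj \<gamma> * \<gamma> = 1 \<and> cnj \<beta> * \<beta> + cnj \<delta> * \<delta> = 1 \<and>
     cnj \<alpha> * \<beta> + cnj \<gamma> * \<delta> = 0 \<and> cnj \<beta> * \<alpha> + cnj \<delta> * \<gamma> = 0 \<and>
     \<alpha> * cnj \<alpha> + \<beta> * cnj \<beta> = 1 \<and> \<gamma> * cnj \<gamma> + \<delta> * cnj \<delta> = 1 \<and>
     \<alpha> * cnj \<gamma> + \<beta> * cnj \<delta> = 0 \<and> \<gamma> * cnj \<alpha> + \<delta> * cnj \<beta> = 0"

lemma unitary2_adj: "unitary2 \<alpha> \<beta> \<gamma> \<delta> \<Longrightarrow> unitary2 (cnj \<alpha>) (cnj \<gamma>) (cnj \<beta>) (cnj \<delta>)"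
  by (simp add: unitary2_def mult.commute)

lemma unitary_mix4: "unitary2 \<alpha> \<beta> \<gamma> \<delta> \<Longrightarrow> unitary_mat 4 (mix4 \<alpha> \<beta> \<gamma> \<delta>)"
  by (auto simp: unitary_mat_def mix4_def cadj_def scalar_prod_def unitary2_def add.commute dest!: less_4_cases
        simp: sum_lessThan_4[unfolded lessThan_atLeast0] intro!: eq_matI)

text \<open>The coordinates \<open>x\<close> and \<open>x + h\<close> are mixed for
  \<open>x < X\<close>. The separate bound \<open>X\<close> serves the induction over the gates of a
  layer, which ends at \<open>X = h\<close>.\<close>

definition mix :: "nat \<Rightarrow> nat \<Rightarrow> amp \<Rightarrow> amp \<Rightarrow> amp \<Rightarrow> amp \<Rightarrow> amp \<Rightarrow> amp" where
  "mix h X A B C D v i =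
    (if i < X then A i * v i + B i * v (i + h)
     else if h \<le> i \<and> i < h + X then C (i - h) * v (i - h) + D (i - h) * v i else v i)"

lemma sum_pairs:
  fixes f :: "nat \<Rightarrow> 'a::comm_monoid_add"
  assumes "2 * h \<le> P"
  shows "(\<Sum>r<P. f r) = (\<Sum>r<h. f r + f (r + h)) + (\<Sum>r = 2 * h..<P. f r)"
proof -
  have "(\<Sum>r<P. f r) = (\<Sum>r<2 * h. f r) + (\<Sum>r = 2 * h..<P. f r)"
    using assms by (metis lessThan_atLeast0 sum.atLeastLessThan_concat zero_le)
  also have "(\<Sum>r<2 * h. f r) = (\<Sum>r<h. f r) + (\<Sum>r = h..<2 * h. f r)"
    by (metis lessThan_atLeast0 sum.atLeastLessThan_concat zero_le le_add1 mult_2)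
  also have "(\<Sum>r = h..<2 * h. f r) = (\<Sum>r<h. f (r + h))"
    using sum.shift_bounds_nat_ivl[of f 0 h h] by (simp add: mult_2 lessThan_atLeast0)
  finally show ?thesis by (simp add: sum.distrib)
qed

text \<open>The pairs are disjoint, so everything reduces to 2 x 2 blocks. The cancellation law
  \<open>inv\<close> is used twice, for the given blocks and for their adjoints.\<close>

lemma mix_adjoint:
  assumes h: "2 * h \<le> P" and u: "\<And>x. x < h \<Longrightarrow> unitary2 (A x) (B x) (C x) (D x)"
  shows "adjoint_pair P (mix h h A B C D)
    (mix h h (\<lambda>x. cnj (A x)) (\<lambda>x. cnj (C x)) (\<lambda>x. cnj (B x)) (\<lambda>x. cnj (D x)))"
proof -
  have inv: "mix h h (\<lambda>x. cnj (A x)) (\<lambda>x. cnj (C x)) (\<lambda>x. cnj (B x)) (\<lambda>x. cnj (D x)) (mix h h A B C D v) = v"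
    if u: "\<And>x. x < h \<Longrightarrow> unitary2 (A x) (B x) (C x) (D x)" for A B C D v
  proof
    fix i
    consider "i < h" | j where "i = j + h" "j < h" | "2 * h \<le> i"
      by (metis add.commute le_add_diff_inverse less_diff_conv2 mult_2 not_less)
    then show "mix h h (\<lambda>x. cnj (A x)) (\<lambda>x. cnj (C x)) (\<lambda>x. cnj (B x)) (\<lambda>x. cnj (D x)) (mix h h A B C D v) i = v i"
    proof cases
      case 1
      have "cnj (A i) * (A i * v i + B i * v (i + h)) + cnj (C i) * (C i * v i + D i * v (i + h))
          = (cnj (A i) * A i + cnj (C i) * C i) * v i + (cnj (A i) * B i + cnj (C i) * D i) * v (i + h)"
        by (simp add: algebra_simps)
      also have "\<dots> = v i" using u[OF 1] by (simp add: unitary2_def)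
      finally show ?thesis using 1 by (simp add: mix_def)
    next
      case (2 j)
      have "cnj (B j) * (A j * v j + B j * v (j + h)) + cnj (D j) * (C j * v j + D j * v (j + h))
          = (cnj (B j) * A j + cnj (D j) * C j) * v j + (cnj (B j) * B j + cnj (D j) * D j) * v (j + h)"
        by (simp add: algebra_simps)
      also have "\<dots> = v (j + h)" using u[OF 2(2)] by (simp add: unitary2_def)
      finally show ?thesis using 2 by (simp add: mix_def)
    next
      case 3
      then show ?thesis by (simp add: mix_def)
    qed
  qed
  have "(\<Sum>r<P. cnj (mix h h A B C D v r) * w r) = (\<Sum>r<P. cnj (v r) *
     mix h h (\<lambda>x. cnj (A x)) (\<lambda>x. cnj (C x)) (\<lambda>x. cnj (B x)) (\<lambda>x. cnj (D x)) w r)" for v w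
    unfolding sum_pairs[OF h]
    by (rule arg_cong2[where f = "(+)"]; rule sum.cong) (auto simp: mix_def algebra_simps)
  moreover have "mix h h A B C D (mix h h (\<lambda>x. cnj (A x)) (\<lambda>x. cnj (C x)) (\<lambda>x. cnj (B x)) (\<lambda>x. cnj (D x)) v) = v" for v
    using inv[of "\<lambda>x. cnj (A x)" "\<lambda>x. cnj (C x)" "\<lambda>x. cnj (B x)" "\<lambda>x. cnj (D x)" v] u unitary2_adj by simp
  ultimately show ?thesis using inv[OF u] by (simp add: adjoint_pair_def)
qed

context string_rows
begin

definition mix_gate :: "nat \<Rightarrow> nat \<Rightarrow> complex \<Rightarrow> complex \<Rightarrow> complex \<Rightarrow> complex \<Rightarrow> gate" where
  "mix_gate p q \<alpha> \<beta> \<gamma> \<delta> = G2 (hot p) (hot q) (mix4 \<alpha> \<beta> \<gamma> \<delta>)"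

lemma mix_gate_ket:
  assumes pq: "p < P" "q < P" "p \<noteq> q" and a: "\<not> a (hot p)" "\<not> a (hot q)"
  shows "gop (mix_gate p q \<alpha> \<beta> \<gamma> \<delta>) (ket a) = ket a"
    "gop (mix_gate p q \<alpha> \<beta> \<gamma> \<delta>) (ket (a(hot p := True))) =
       (\<lambda>b. \<alpha> * ket (a(hot p := True)) b + \<gamma> * ket (a(hot q := True)) b)"
    "gop (mix_gate p q \<alpha> \<beta> \<gamma> \<delta>) (ket (a(hot q := True))) =
       (\<lambda>b. \<beta> * ket (a(hot p := True)) b + \<delta> * ket (a(hot q := True)) b)"
proof -
  have ne: "hot p \<noteq> hot q" using pq hot_eq by simp
  have e: "a(hot p := False, hot q := False) = a" "a(hot p := True, hot q := False) = a(hot p := True)"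
     "a(hot p := False, hot q := True) = a(hot q := True)"
     "a(hot q := True, hot p := False) = a(hot q := True)" 
     "a(hot q := True, hot p := True, hot q := False) = a(hot p := True)"
     "a(hot q := True, hot p := False, hot q := True) = a(hot q := True)"
    using a ne by (auto simp: fun_eq_iff)
  have wf: "gate_wf (mix_gate p q \<alpha> \<beta> \<gamma> \<delta>)" using ne by (simp add: mix_gate_def)
  show "gop (mix_gate p q \<alpha> \<beta> \<gamma> \<delta>) (ket a) = ket a"
    using a ne e by (intro ext) (simp add: gop_ket[OF wf], simp add: mix_gate_def mix4_def sum_lessThan_4)
  show "gop (mix_gate p q \<alpha> \<beta> \<gamma> \<delta>) (ket (a(hot p := True))) =
       (\<lambda>b. \<alpha> * ket (a(hot p := True)) b + \<gamma> * ket (a(hot q := True)) b)"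
    using a ne e by (intro ext) (simp add: gop_ket[OF wf], simp add: mix_gate_def mix4_def sum_lessThan_4)
  show "gop (mix_gate p q \<alpha> \<beta> \<gamma> \<delta>) (ket (a(hot q := True))) =
       (\<lambda>b. \<beta> * ket (a(hot p := True)) b + \<delta> * ket (a(hot q := True)) b)"
    using a ne e by (intro ext) (simp add: gop_ket[OF wf], simp add: mix_gate_def mix4_def sum_lessThan_4)
qed

lemma mix_gate_hot_state:
  assumes pq: "p < P" "q < P" "p \<noteq> q" and a: "\<forall>p<P. \<not> a (hot p)"
  shows "gop (mix_gate p q \<alpha> \<beta> \<gamma> \<delta>) (hot_state v a)
    = hot_state (v(p := \<alpha> * v p + \<beta> * v q, q := \<gamma> * v p + \<delta> * v q)) a"
proof
  fix b
  let ?k = "\<lambda>r. ket (a(hot r := True)) b" and ?g = "gop (mix_gate p q \<alpha> \<beta> \<gamma> \<delta>)"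
  have split: "(\<Sum>r<P. f r) = f p + (f q + (\<Sum>r\<in>{..<P} - {p} - {q}. f r))" for f :: "nat \<Rightarrow> complex"
    using pq by (subst sum.remove[of _ p], simp, simp, subst sum.remove[of _ q]) auto
  have ap: "\<not> a (hot p)" "\<not> a (hot q)" using a pq by auto
  note k = mix_gate_ket[OF pq ap]
  \<comment> \<open>An excitation elsewhere is part of the background: the gate sees two empty
    qubits.\<close>
  have other: "?g (ket (a(hot r := True))) b = ?k r" if "r \<in> {..<P} - {p} - {q}" for r
  proof -
    have "\<not> (a(hot r := True)) (hot p)" "\<not> (a(hot r := True)) (hot q)"
      using that a pq by (auto simp: hot_eq)
    then show ?thesis by (rule fun_cong[OF mix_gate_ket(1)[where a = "a(hot r := True)", OF pq]])
  qed
  have "?g (hot_state v a) b = (\<Sum>r<P. v r * ?g (ket (a(hot r := True))) b)"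
    by (simp add: hot_state_def gop_sum)
  also have "\<dots> = v p * (\<alpha> * ?k p + \<gamma> * ?k q) + (v q * (\<beta> * ?k p + \<delta> * ?k q)
      + (\<Sum>r\<in>{..<P} - {p} - {q}. v r * ?k r))"
    unfolding split by (simp add: k other)
  also have "\<dots> = hot_state (v(p := \<alpha> * v p + \<beta> * v q, q := \<gamma> * v p + \<delta> * v q)) a b"
    unfolding hot_state_def split using pq by (simp add: algebra_simps)
  finally show "?g (hot_state v a) b = hot_state (v(p := \<alpha> * v p + \<beta> * v q, q := \<gamma> * v p + \<delta> * v q)) a b" .
qed

definition mix_layer :: "nat \<Rightarrow> nat \<Rightarrow> amp \<Rightarrow> amp \<Rightarrow> amp \<Rightarrow> amp \<Rightarrow> layer" where
  "mix_layer h X A B C D = map (\<lambda>x. mix_gate x (x + h) (A x) (B x) (C x) (D x)) [0..<X]"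

lemma mix_layer_hot_state:
  assumes h: "2 * h \<le> P" "X \<le> h" and a: "\<forall>p<P. \<not> a (hot p)"
  shows "lop (mix_layer h X A B C D) (hot_state v a) = hot_state (mix h X A B C D v) a"
  using h(2)
proof (induction X arbitrary: v)
  case 0
  have "mix h 0 A B C D v = v" by (auto simp: mix_def fun_eq_iff)
  then show ?case by (simp add: mix_layer_def)
next
  case (Suc X)
  have "lop (mix_layer h (Suc X) A B C D) (hot_state v a)
      = lop (mix_layer h X A B C D) (hot_state (v(X := A X * v X + B X * v (X + h),
          X + h := C X * v X + D X * v (X + h))) a)"
    using Suc.prems h a by (simp add: mix_layer_def mix_gate_hot_state)
  also have "\<dots> = hot_state (mix h X A B C D (v(X := A X * v X + B X * v (X + h),
          X + h := C X * v X + D X * v (X + h)))) a"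
    using Suc by simp
  also have "mix h X A B C D (v(X := A X * v X + B X * v (X + h),
          X + h := C X * v X + D X * v (X + h))) = mix h (Suc X) A B C D v"
    using Suc.prems by (auto simp: mix_def fun_eq_iff less_Suc_eq)
  finally show ?case .
qed

lemma mix_layer_acts:
  assumes h: "2 * h \<le> P"
  shows "hot_acts [mix_layer h h A B C D] (mix h h A B C D)"
  unfolding hot_acts_def
proof (intro allI impI conjI)
  fix a v assume a: "\<forall>p<P. \<not> a (hot p)"
  show "cop [mix_layer h h A B C D] (hot_state v a) = hot_state (mix h h A B C D v) a"
    using mix_layer_hot_state[OF h _ a] by simp
  have "lop (mix_layer h X A B C D) (ket a) = ket a" if "X \<le> h" for X
    using that
  proof (induction X)
    case (Suc X)
    then have "gop (mix_gate X (X + h) (A X) (B X) (C X) (D X)) (ket a) = ket a"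
      using a h by (intro mix_gate_ket) auto
    then show ?case using Suc by (simp add: mix_layer_def)
  qed (simp add: mix_layer_def)
  then show "cop [mix_layer h h A B C D] (ket a) = ket a" by simp
qed

lemma mix_layer_ok:
  assumes h: "2 * h \<le> P" and u: "\<And>x. x < h \<Longrightarrow> unitary2 (A x) (B x) (C x) (D x)"
  shows "layer_ok N (mix_layer h h A B C D)"
  unfolding mix_layer_def
proof (rule layer_ok_map)
  fix x assume "x \<in> set [0..<h]"
  then show "gate_ok N (mix_gate x (x + h) (A x) (B x) (C x) (D x))"
    using h u hot_less unitary_mix4 by (simp add: mix_gate_def hot_eq)
next
  fix x y assume "x \<in> set [0..<h]" "y \<in> set [0..<h]" "x \<noteq> y"
  then show "gate_support (mix_gate x (x + h) (A x) (B x) (C x) (D x)) \<inter>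
      gate_support (mix_gate y (y + h) (A y) (B y) (C y) (D y)) = {}"
    using h by (simp add: mix_gate_def hot_eq)
qed simp

lemma hot_acts_append: "hot_acts C F \<Longrightarrow> hot_acts C' G \<Longrightarrow> hot_acts (C @ C') (\<lambda>v. G (F v))"
  by (simp add: hot_acts_def)

text \<open>The root of the preparation tree: a single amplitude of modulus one is a phase on
  excitation 0.\<close>

lemma hot_acts_phase:
  "hot_acts [[G1 (hot 0) (mat 2 2 (\<lambda>(i,j). if i = j then (if i = 0 then 1 else z) else 0))]] (\<lambda>v. v(0 := z * v 0))"
  (is "hot_acts [[?g]] _")
  unfolding hot_acts_def
proof (intro allI impI conjI)
  fix a v assume a: "\<forall>p<P. \<not> a (hot p)"
  have k: "gop ?g (ket c) = (\<lambda>b. (if c (hot 0) then z else 1) * ket c b)" for c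
  proof
    fix b
    have e: "c(hot 0 := c (hot 0)) = c" by auto
    show "gop ?g (ket c) b = (if c (hot 0) then z else 1) * ket c b"
      using e by (cases "c (hot 0)") (simp_all add: gop_ket sum_lessThan_2)
  qed
  show "cop [[?g]] (ket a) = ket a" using a P_pos by (simp add: k)
  have "gop ?g (hot_state v a) = (\<lambda>b. \<Sum>r<P. v r * gop ?g (ket (a(hot r := True))) b)"
    by (simp add: hot_state_def gop_sum)
  also have "\<dots> = hot_state (v(0 := z * v 0)) a"
    unfolding hot_state_def k using a P_pos
    by (intro ext sum.cong) (auto simp: hot_eq)
  finally show "cop [[?g]] (hot_state v a) = hot_state (v(0 := z * v 0)) a" by simp
qed

lemma phase_ok:
  assumes "cmod z = 1"
  shows "circuit_ok N [[G1 (hot 0) (mat 2 2 (\<lambda>(i,j). if i = j then (if i = 0 then 1 else z) else 0))]]"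
proof -
  have "cnj z * z = 1" using assms by (metis complex_norm_square mult.commute of_real_1 one_power2)
  then have "unitary_mat 2 (mat 2 2 (\<lambda>(i,j). if i = j then (if i = 0 then 1 else z) else 0))"
    by (auto simp: unitary_mat_def cadj_def scalar_prod_def less_2_cases_iff
        sum_lessThan_2[unfolded lessThan_atLeast0] intro!: eq_matI)
  then show ?thesis using hot_less P_pos by (simp add: circuit_ok_def layer_ok_def)
qed

text \<open>A binary tree of two-level rotations: at each step, the amplitude at \<open>x < 2 ^ t\<close>
  is distributed over \<open>x\<close> and \<open>x + 2 ^ t\<close>.\<close>

lemma hot_state_preparation:
  assumes "2 ^ t \<le> P" "\<And>i. 2 ^ t \<le> i \<Longrightarrow> v i = 0" "(\<Sum>i<2 ^ t. (cmod (v i))\<^sup>2) = 1"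
  shows "\<exists>C C' F F'. circuit_ok N C \<and> circuit_ok N C' \<and> length C = Suc t \<and> length C' = Suc t \<and>
    hot_acts C F \<and> hot_acts C' F' \<and> adjoint_pair P F F' \<and> F (unit_amp 0) = v"
  using assms
proof (induction t arbitrary: v)
  case 0
  define z where "z = v 0"
  have z: "cmod z = 1" using 0(3) by (simp add: z_def power2_eq_1_iff) (smt (verit) norm_ge_zero)
  then have zz: "cnj z * z = 1" by (metis complex_norm_square mult.commute of_real_1 one_power2)
  have adj: "adjoint_pair P (\<lambda>v. v(0 := z * v 0)) (\<lambda>v. v(0 := cnj z * v 0))"
    unfolding adjoint_pair_def
  proof (intro conjI allI)
    fix v w :: amp
    show "(\<Sum>r<P. cnj ((v(0 := z * v 0)) r) * w r) = (\<Sum>r<P. cnj (v r) * (w(0 := cnj z * w 0)) r)"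
      by (rule sum.cong) (auto simp: mult_ac)
  qed (use zz in \<open>auto simp: fun_eq_iff mult.assoc[symmetric] mult.commute\<close>)
  have "(unit_amp 0)(0 := z * unit_amp 0 0) = v"
    using 0(2) by (auto simp: fun_eq_iff unit_amp_def z_def)
  moreover have "cmod (cnj z) = 1" using z by simp
  ultimately show ?case
    using adj phase_ok[OF z] phase_ok[of "cnj z"] hot_acts_phase[of z] hot_acts_phase[of "cnj z"]
    by (metis (no_types, lifting) length_Cons list.size(3))
next
  case (Suc t)
  define h :: nat where "h = 2 ^ t"
  have h: "2 * h \<le> P" "h \<le> P" using Suc.prems(1) by (simp_all add: h_def)
  \<comment> \<open>\<open>s x\<close> is the joint norm of the amplitudes at \<open>x\<close> and
    \<open>x + h\<close>. The shorter vector consists of these norms, so this last layer of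
    rotations inserts all phases.\<close>
  define s where "s x = sqrt ((cmod (v x))\<^sup>2 + (cmod (v (x + h)))\<^sup>2)" for x
  define v' :: amp where "v' x = (if x < h then complex_of_real (s x) else 0)" for x
  have "(\<Sum>i<h. (cmod (v' i))\<^sup>2) = (\<Sum>i<h. (cmod (v i))\<^sup>2 + (cmod (v (i + h)))\<^sup>2)"
    by (rule sum.cong) (auto simp: v'_def s_def)
  also have "\<dots> = 1" using Suc.prems(3) sum_pairs[of h "2 * h" "\<lambda>i. (cmod (v i))\<^sup>2"] by (simp add: h_def)
  finally have "(\<Sum>i<2 ^ t. (cmod (v' i))\<^sup>2) = 1" by (simp add: h_def)
  moreover have "2 ^ t \<le> P" "\<And>i. 2 ^ t \<le> i \<Longrightarrow> v' i = 0" using h(2) by (simp_all add: h_def v'_def)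
  ultimately obtain C C' F F' where IH: "circuit_ok N C" "circuit_ok N C'" "length C = Suc t" "length C' = Suc t"
    "hot_acts C F" "hot_acts C' F'" "adjoint_pair P F F'" "F (unit_amp 0) = v'"
    using Suc.IH[of v'] by blast
  \<comment> \<open>(A x, B x) is the normalised pair; a pair of norm zero gets the identity
    block.\<close>
  define A where "A x = (if s x = 0 then 1 else v x / complex_of_real (s x))" for x
  define B where "B x = (if s x = 0 then 0 else v (x + h) / complex_of_real (s x))" for x
  have AB: "cnj (A x) * A x + cnj (B x) * B x = 1" for x
  proof (cases "s x = 0")
    case False
    have "(s x)\<^sup>2 = (cmod (v x))\<^sup>2 + (cmod (v (x + h)))\<^sup>2" by (simp add: s_def)
    then have "complex_of_real (s x) * complex_of_real (s x) = v x * cnj (v x) + v (x + h) * cnj (v (x + h))"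
      by (metis complex_norm_square of_real_add of_real_mult power2_eq_square of_real_power)
    moreover have "complex_of_real (s x) * complex_of_real (s x) \<noteq> 0" using False by simp
    ultimately show ?thesis using False by (simp add: A_def B_def add_divide_distrib[symmetric] mult.commute)
  qed (simp add: A_def B_def)
  \<comment> \<open>The unit column (A x, B x) is completed by an orthogonal one to a unitary
    block.\<close>
  have u: "unitary2 (A x) (- cnj (B x)) (B x) (cnj (A x))" for x
    using AB[of x] by (simp add: unitary2_def algebra_simps)
  define L where "L = mix_layer h h A (\<lambda>x. - cnj (B x)) B (\<lambda>x. cnj (A x))"
  \<comment> \<open>The double conjugates keep the shape in which \<open>unitary2_adj\<close> and
    \<open>mix_adjoint\<close> deliver the adjoint block.\<close>
  define L' where "L' = mix_layer h h (\<lambda>x. cnj (A x)) (\<lambda>x. cnj (B x)) (\<lambda>x. cnj (- cnj (B x))) (\<lambda>x. cnj (cnj (A x)))"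
  define M where "M = mix h h A (\<lambda>x. - cnj (B x)) B (\<lambda>x. cnj (A x))"
  define M' where "M' = mix h h (\<lambda>x. cnj (A x)) (\<lambda>x. cnj (B x)) (\<lambda>x. cnj (- cnj (B x))) (\<lambda>x. cnj (cnj (A x)))"
  have L: "layer_ok N L" "layer_ok N L'" "hot_acts [L] M" "hot_acts [L'] M'" "adjoint_pair P M M'"
    unfolding L_def L'_def M_def M'_def
    by (rule mix_layer_ok[OF h(1)], rule u, rule mix_layer_ok[OF h(1)], rule unitary2_adj[OF u],
        (rule mix_layer_acts[OF h(1)])+, rule mix_adjoint[OF h(1)], rule u)
  have "M v' = v"
  proof
    fix i
    have zero: "v i = 0 \<and> v (i + h) = 0" if "s i = 0" for i
    proof -
      have "(cmod (v i))\<^sup>2 + (cmod (v (i + h)))\<^sup>2 = 0" using that by (simp add: s_def)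
      then show ?thesis by (simp add: add_nonneg_eq_0_iff)
    qed
    consider "i < h" | j where "i = j + h" "j < h" | "2 * h \<le> i"
      by (metis add.commute le_add_diff_inverse less_diff_conv2 mult_2 not_less)
    then show "M v' i = v i"
    proof cases
      case 3
      then show ?thesis using Suc.prems(2)[of i] by (simp add: M_def mix_def v'_def h_def)
    qed (use zero in \<open>auto simp: M_def mix_def v'_def A_def B_def\<close>)
  qed
  then have "M (F (unit_amp 0)) = v" using IH(8) by simp
  moreover have "circuit_ok N (C @ [L])" "circuit_ok N ([L'] @ C')"
    using IH(1,2) L(1,2) by (auto simp: circuit_ok_def)
  moreover have "hot_acts (C @ [L]) (\<lambda>v. M (F v))" "hot_acts ([L'] @ C') (\<lambda>v. F' (M' v))"
    using hot_acts_append IH(5,6) L(3,4) by blast+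
  moreover have "adjoint_pair P (\<lambda>v. M (F v)) (\<lambda>v. F' (M' v))"
    by (rule adjoint_pair_comp[OF IH(7) L(5)])
  moreover have "length (C @ [L]) = Suc (Suc t)" "length ([L'] @ C') = Suc (Suc t)" using IH(3,4) by simp_all
  ultimately show ?case by blast
qed

end

section \<open>Circuits acting on a register with clean ancillas\<close>

text \<open>\<open>bit x\<close> is false from qubit \<open>k\<close> on, so this also says that all
  further qubits start and end at zero, without mentioning how many there are.\<close>

definition reg_impl :: "nat \<Rightarrow> circuit \<Rightarrow> complex mat \<Rightarrow> bool" where
  "reg_impl k C U \<longleftrightarrow> (\<forall>x::nat<2 ^ k. cop C (ket (bit x)) = (\<lambda>b. \<Sum>i<2 ^ k. U $$ (i, x) * ket (bit (i::nat)) b))"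

lemma reg_impl_append:
  assumes "reg_impl k C U" "reg_impl k C' U'" "U \<in> carrier_mat (2 ^ k) (2 ^ k)" "U' \<in> carrier_mat (2 ^ k) (2 ^ k)"
  shows "reg_impl k (C @ C') (U' * U)"
  unfolding reg_impl_def
proof (intro allI impI ext)
  fix x b assume x: "x < (2::nat) ^ k"
  have "cop (C @ C') (ket (bit x)) b = (\<Sum>i<2 ^ k. U $$ (i, x) * cop C' (ket (bit i)) b)"
    using assms(1) x by (simp add: reg_impl_def cop_sum)
  also have "\<dots> = (\<Sum>i<2 ^ k. \<Sum>j<2 ^ k. U' $$ (j, i) * U $$ (i, x) * ket (bit j) b)"
    using assms(2) by (simp add: reg_impl_def sum_distrib_left mult_ac)
  also have "\<dots> = (\<Sum>j<2 ^ k. (\<Sum>i<2 ^ k. U' $$ (j, i) * U $$ (i, x)) * ket (bit j) b)"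
    by (subst sum.swap) (simp add: sum_distrib_right)
  also have "\<dots> = (\<Sum>j<2 ^ k. (U' * U) $$ (j, x) * ket (bit j) b)"
    using assms(3,4) x by (intro sum.cong) (auto simp: scalar_prod_def lessThan_atLeast0)
  finally show "cop (C @ C') (ket (bit x)) b = (\<Sum>j<2 ^ k. (U' * U) $$ (j, x) * ket (bit j) b)" .
qed

lemma reg_impl_implements:
  assumes "reg_impl k C U" "circuit_ok (k + anc) C"
  shows "implements k anc C U"
  unfolding implements_def
proof (intro allI impI)
  fix x i :: nat assume xi: "x < 2 ^ k" "i < 2 ^ (k + anc)"
  have "x < 2 ^ (k + anc)" using xi(1) by (meson le_add1 less_le_trans one_le_numeral power_increasing)
  then have "circ_mat (k + anc) C $$ (i, x) = cop C (ket (bit x)) (bit i)"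
    using circ_mat_entry assms(2) xi(2) by blast
  also have "\<dots> = (\<Sum>j<2 ^ k. if j = i then U $$ (j, x) else 0)"
  proof -
    have "cop C (ket (bit x)) (bit i) = (\<Sum>j<2 ^ k. U $$ (j, x) * ket (bit j) (bit i))"
      using assms(1) xi(1) by (simp add: reg_impl_def)
    also have "\<dots> = (\<Sum>j<2 ^ k. if j = i then U $$ (j, x) else 0)"
      by (rule sum.cong) (auto simp: ket_bit)
    finally show ?thesis .
  qed
  also have "\<dots> = (if i < 2 ^ k then U $$ (i, x) else 0)" by simp
  finally show "circ_mat (k + anc) C $$ (i, x) = (if i < 2 ^ k then U $$ (i, x) else 0)" .
qed

definition fun_mat :: "nat \<Rightarrow> (nat \<Rightarrow> nat) \<Rightarrow> complex mat" where
  "fun_mat d f = mat d d (\<lambda>(i,x). if i = f x then 1 else 0)"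

lemma unitary_fun_mat:
  assumes "inj_on f {..<d}" "f ` {..<d} \<subseteq> {..<d}"
  shows "unitary_mat d (fun_mat d f)"
  unfolding unitary_mat_def
proof (intro conjI eq_matI)
  fix i j assume "i < dim_row (1\<^sub>m d :: complex mat)" "j < dim_col (1\<^sub>m d :: complex mat)"
  then have ij: "i < d" "j < d" by simp_all
  then have f: "f i < d" "f i = f j \<longleftrightarrow> i = j" using assms by (auto simp: inj_on_def)
  have "(cadj (fun_mat d f) * fun_mat d f) $$ (i, j) = (\<Sum>r<d. cnj (if r = f i then 1 else 0) * (if r = f j then 1 else 0))"
    using ij by (simp add: cadj_def fun_mat_def scalar_prod_def lessThan_atLeast0)
  also have "\<dots> = (\<Sum>r<d. if r = f i then (if f i = f j then 1 else 0) else 0)"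
    by (rule sum.cong) auto
  finally show "(cadj (fun_mat d f) * fun_mat d f) $$ (i, j) = 1\<^sub>m d $$ (i, j)"
    using ij f by simp
qed (simp_all add: cadj_def fun_mat_def)

lemma reg_impl_fun_mat:
  assumes "\<And>x. x < 2 ^ k \<Longrightarrow> f x < 2 ^ k" "\<And>x. x < 2 ^ k \<Longrightarrow> cop C (ket (bit x)) = ket (bit (f x))"
  shows "reg_impl k C (fun_mat (2 ^ k) f)"
  unfolding reg_impl_def
proof (intro allI impI ext)
  fix x b assume x: "x < (2::nat) ^ k"
  have "(\<Sum>i<2 ^ k. fun_mat (2 ^ k) f $$ (i, x) * ket (bit i) b) = (\<Sum>i<2 ^ k. if i = f x then ket (bit i) b else 0)"
    using x by (intro sum.cong) (auto simp: fun_mat_def)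
  then show "cop C (ket (bit x)) b = (\<Sum>i<2 ^ k. fun_mat (2 ^ k) f $$ (i, x) * ket (bit i) b)"
    using assms[OF x] by simp
qed

lemma bit_shift_add:
  fixes p y :: nat
  assumes y: "y < 2 ^ N"
  shows "bit (p * 2 ^ N + y) q = (if q < N then bit y q else bit p (q - N))"
proof (cases "q < N")
  case True
  then have "(2::nat) ^ N = 2 ^ q * 2 ^ (N - q)" by (simp flip: power_add)
  then have "p * 2 ^ N + y = y + p * 2 ^ (N - q) * 2 ^ q" by (simp only: mult_ac add_ac)
  then have "(p * 2 ^ N + y) div 2 ^ q = p * 2 ^ (N - q) + y div 2 ^ q"
    by (simp only: div_mult_self1 power_not_zero zero_neq_numeral not_False_eq_True)
  then show ?thesis using True by (simp add: bit_iff_odd)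
next
  case False
  then have "(2::nat) ^ q = 2 ^ N * 2 ^ (q - N)" by (simp flip: power_add)
  then have "(p * 2 ^ N + y) div 2 ^ q = (p * 2 ^ N + y) div 2 ^ N div 2 ^ (q - N)"
    by (simp add: div_mult2_eq)
  then show ?thesis using False y by (simp add: bit_iff_odd)
qed

lemma less_expI: "(\<And>q. N \<le> q \<Longrightarrow> \<not> bit (x::nat) q) \<Longrightarrow> x < 2 ^ N"
  using ex_bit_eq[of N "bit x"] by (auto simp: bit_eq_iff_nat)

lemma unitary_kron_id:
  assumes "unitary_mat d P"
  shows "unitary_mat (d * 2 ^ k) (kron_id P k)"
proof -
  let ?B = "2 ^ k :: nat"
  have P: "P \<in> carrier_mat d d" "cadj P * P = 1\<^sub>m d" using assms by (auto simp: unitary_mat_def)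
  have "(cadj (kron_id P k) * kron_id P k) $$ (i, j) = 1\<^sub>m (d * ?B) $$ (i, j)"
    if ij: "i < d * ?B" "j < d * ?B" for i j
  proof -
    have dij: "i div ?B < d" "j div ?B < d" using ij by (simp_all add: less_mult_imp_div_less)
    have "(cadj (kron_id P k) * kron_id P k) $$ (i, j) = (\<Sum>r<d * ?B. cnj (kron_id P k $$ (r, i)) * kron_id P k $$ (r, j))"
      using ij P(1) by (simp add: cadj_def kron_id_def scalar_prod_def lessThan_atLeast0)
    also have "\<dots> = (\<Sum>r | r < d * ?B \<and> r mod ?B = i mod ?B.
        if i mod ?B = j mod ?B then cnj (P $$ (r div ?B, i div ?B)) * P $$ (r div ?B, j div ?B) else 0)"
      using ij P(1) by (intro sum.mono_neutral_cong_right) (auto simp: kron_id_def)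
    also have "\<dots> = (\<Sum>l<d. if i mod ?B = j mod ?B then cnj (P $$ (l, i div ?B)) * P $$ (l, j div ?B) else 0)"
    proof (rule sum.reindex_bij_witness[where j = "\<lambda>r. r div ?B" and i = "\<lambda>l. l * ?B + i mod ?B"])
      fix l assume "l \<in> {..<d}"
      then have "Suc l * ?B \<le> d * ?B" by (intro mult_le_mono1) simp
      moreover have "i mod ?B < ?B" by simp
      ultimately have "l * ?B + i mod ?B < d * ?B" unfolding mult_Suc by linarith
      then show "l * ?B + i mod ?B \<in> {r. r < d * ?B \<and> r mod ?B = i mod ?B}" by simp
    next
      fix r assume "r \<in> {r. r < d * ?B \<and> r mod ?B = i mod ?B}"
      then show "r div ?B * ?B + i mod ?B = r" "r div ?B \<in> {..<d}"
        using div_mult_mod_eq[of r ?B] by (auto simp: less_mult_imp_div_less)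
    qed auto
    also have "\<dots> = (if i mod ?B = j mod ?B then (cadj P * P) $$ (i div ?B, j div ?B) else 0)"
      using dij P(1) by (auto simp: cadj_def scalar_prod_def lessThan_atLeast0)
    also have "\<dots> = 1\<^sub>m (d * ?B) $$ (i, j)"
      using dij ij P(2) div_mult_mod_eq[of i ?B] div_mult_mod_eq[of j ?B] by (cases "i = j") auto
    finally show ?thesis .
  qed
  then show ?thesis using P(1) unfolding unitary_mat_def
    by (intro conjI eq_matI) (auto simp: kron_id_def cadj_def)
qed

lemma unitary_times:
  assumes "unitary_mat d U" "unitary_mat d V"
  shows "unitary_mat d (U * V)"
proof -
  have c: "U \<in> carrier_mat d d" "V \<in> carrier_mat d d" using assms by (auto simp: unitary_mat_def)
  then have c': "cadj U \<in> carrier_mat d d" "cadj V \<in> carrier_mat d d" by (auto simp: cadj_def)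
  have "cadj (U * V) = cadj V * cadj U"
    using c by (intro eq_matI) (auto simp: cadj_def scalar_prod_def mult.commute intro!: sum.cong)
  then have "cadj (U * V) * (U * V) = cadj V * (cadj U * U * V)"
    using c c' by (simp add: assoc_mult_mat[of _ d d _ d _ d])
  also have "\<dots> = 1\<^sub>m d" using assms c c' by (simp add: unitary_mat_def)
  finally show ?thesis using c by (simp add: unitary_mat_def)
qed

text \<open>Above \<open>R\<close> register qubits lie \<open>P\<close> hot qubits and then
  \<open>P\<close> rows of 2 (k + 1) cells, in total P (2 k + 3) ancillas.\<close>

lemma string_rows_layout:
  assumes "\<And>i. i < k \<Longrightarrow> pos i < R" "inj_on pos {..<k}" "0 < P" "P \<le> 2 ^ T" "Suc k \<le> 2 ^ T'"
    "R + P * (2 * k + 3) \<le> N"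
    "\<And>p p'. p < P \<Longrightarrow> p' < P \<Longrightarrow> \<forall>i<k. w p (pos i) = w p' (pos i) \<Longrightarrow> p = p'"
  shows "string_rows N k P T T' pos (\<lambda>p. R + p) (\<lambda>p j. R + P + (p * (2 * Suc k) + j)) w"
proof
  have cl: "p * (2 * Suc k) + j < P * (2 * Suc k)" if "p < P" "j < 2 * Suc k" for p j
  proof -
    have "p * (2 * Suc k) + j < Suc p * (2 * Suc k)" using that by simp
    also have "\<dots> \<le> P * (2 * Suc k)" using that by (intro mult_le_mono1) simp
    finally show ?thesis .
  qed
  have N: "R + P + P * (2 * Suc k) \<le> N" using assms(6) by (simp add: algebra_simps)
  show "i < k \<Longrightarrow> pos i < N" for i using assms(1)[of i] N by simp
  show "p < P \<Longrightarrow> R + p < N" for p using N by simp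
  show "p < P \<Longrightarrow> j < 2 * Suc k \<Longrightarrow> R + P + (p * (2 * Suc k) + j) < N" for p j
    using cl[of p j] N by linarith
  have uniq: "p = p' \<and> j = j'" if "p * (2 * Suc k) + j = p' * (2 * Suc k) + j'" "j < 2 * Suc k" "j' < 2 * Suc k" for p p' j j'
  proof -
    have "(p * (2 * Suc k) + j) div (2 * Suc k) = p" "(p' * (2 * Suc k) + j') div (2 * Suc k) = p'"
      using that(2,3) by (simp_all del: mult_Suc_right)
    then show ?thesis using that(1) by simp
  qed
  show "grid_inj (\<lambda>p j. R + P + (p * (2 * Suc k) + j)) P {..<2 * Suc k}"
    unfolding grid_inj_def
  proof (intro allI impI ballI)
    fix p p' j j' assume "j \<in> {..<2 * Suc k}" "j' \<in> {..<2 * Suc k}"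
      "R + P + (p * (2 * Suc k) + j) = R + P + (p' * (2 * Suc k) + j')"
    then show "p = p' \<and> j = j'" by (intro uniq) (simp_all only: add_left_cancel lessThan_iff)
  qed
  show "i < k \<Longrightarrow> p < P \<Longrightarrow> pos i \<noteq> R + p" for i p using assms(1)[of i] by simp
  show "i < k \<Longrightarrow> p < P \<Longrightarrow> j < 2 * Suc k \<Longrightarrow> pos i \<noteq> R + P + (p * (2 * Suc k) + j)" for i p j
    using assms(1)[of i] by simp
qed (use assms in \<open>auto simp: inj_on_def\<close>)

section \<open>State preparation and transpositions on a register\<close>

text \<open>A column of the tensor product with the identity lives on the indices with the same low
  part, one for each value of the high part.\<close>

lemma kron_amp_sum:
  fixes f :: "nat \<Rightarrow> complex"
  assumes "M \<in> carrier_mat d d" "x < d * 2 ^ k"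
  shows "(\<Sum>i<d * 2 ^ k. kron_id M k $$ (i, x) * f i)
    = (\<Sum>l<d. M $$ (l, x div 2 ^ k) * f (l * 2 ^ k + x mod 2 ^ k))"
proof -
  let ?B = "2 ^ k :: nat"
  have "(\<Sum>i<d * ?B. kron_id M k $$ (i, x) * f i)
      = (\<Sum>i | i < d * ?B \<and> i mod ?B = x mod ?B. M $$ (i div ?B, x div ?B) * f i)"
    using assms by (intro sum.mono_neutral_cong_right) (auto simp: kron_id_def)
  also have "\<dots> = (\<Sum>l<d. M $$ (l, x div ?B) * f (l * ?B + x mod ?B))"
  proof (rule sum.reindex_bij_witness[where j = "\<lambda>r. r div ?B" and i = "\<lambda>l. l * ?B + x mod ?B"])
    fix l assume "l \<in> {..<d}"
    then have "Suc l * ?B \<le> d * ?B" by (intro mult_le_mono1) simp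
    moreover have "x mod ?B < ?B" by simp
    ultimately have "l * ?B + x mod ?B < d * ?B" unfolding mult_Suc by linarith
    then show "l * ?B + x mod ?B \<in> {r. r < d * ?B \<and> r mod ?B = x mod ?B}" by simp
  next
    fix r assume r: "r \<in> {r. r < d * ?B \<and> r mod ?B = x mod ?B}"
    then show e: "r div ?B * ?B + x mod ?B = r" "r div ?B \<in> {..<d}"
      using div_mult_mod_eq[of r ?B] by (auto simp: less_mult_imp_div_less)
    show "M $$ (r div ?B, x div ?B) * f (r div ?B * ?B + x mod ?B) = M $$ (r div ?B, x div ?B) * f r"
      by (simp only: e)
  qed auto
  finally show ?thesis .
qed

text \<open>The strings are all 2 ^ m values of the idx register, so every basis state matches. The
  deletion and system qubits are spectators, which yields the tensor factor of the identity.\<close>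

lemma prep_circuit:
  fixes v :: amp
  assumes v: "\<And>i. 2 ^ m \<le> i \<Longrightarrow> v i = 0" "(\<Sum>i<2 ^ m. (cmod (v i))\<^sup>2) = 1"
    and T: "m \<le> T" "Suc m \<le> 2 ^ T'" and N: "m + 1 + n + 2 ^ m * (2 * m + 3) \<le> N"
  shows "\<exists>M C C'. unitary_mat (2 ^ m) M \<and> unitary_mat (2 ^ m) (cadj M) \<and> cadj (cadj M) = M \<and>
    (\<forall>l<2 ^ m. M $$ (l, 0) = v l) \<and>
    circuit_ok N C \<and> circuit_ok N C' \<and>
    length C = Suc m + 10 * (4 * T + 4 * T' + 10) \<and> length C' = Suc m + 10 * (4 * T + 4 * T' + 10) \<and>
    reg_impl (m + 1 + n) C (kron_id M (n + 1)) \<and> reg_impl (m + 1 + n) C' (kron_id (cadj M) (n + 1))"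
proof -
  let ?B = "2 ^ (n + 1) :: nat"
  \<comment> \<open>The value \<open>p\<close> is shifted above the \<open>n\<close> system qubits
    and the deletion qubit, which has position \<open>n\<close>.\<close>
  define w where "w p = (bit (p * ?B + 0) :: asg)" for p :: nat
  have wpos: "w p (n + 1 + i) = bit p i" for p i
    unfolding w_def by (subst bit_shift_add) auto
  define ps where "ps = (\<lambda>i. n + 1 + i)"
  define ht where "ht = (\<lambda>p. (m + 1 + n) + p)"
  define cl where "cl = (\<lambda>p j. (m + 1 + n) + 2 ^ m + (p * (2 * Suc m) + j))"
  interpret string_rows N m "2 ^ m" T T' ps ht cl w
    unfolding ps_def ht_def cl_def
  proof (rule string_rows_layout)
    fix p p' :: nat assume p: "p < 2 ^ m" "p' < 2 ^ m" "\<forall>i<m. w p (n + 1 + i) = w p' (n + 1 + i)"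
    have "\<forall>i<m. bit p i = bit p' i" using p(3) unfolding wpos .
    then have "bit p i = bit p' i" for i
      using bit_less_exp[OF p(1), of i] bit_less_exp[OF p(2), of i] by (cases "i < m") auto
    then show "p = p'" by (simp add: bit_eq_iff)
  qed (use T N in \<open>auto simp: inj_on_def\<close>)
  have clean: "clean (bit x)" if "x < 2 ^ (m + 1 + n)" for x :: nat
    using bit_less_exp[OF that] unfolding clean_def scratch0_def by (auto simp: ht_def cl_def)
  have impl: "\<exists>C'. circuit_ok N C' \<and> length C' = length C + 10 * (4 * T + 4 * T' + 10) \<and>
      reg_impl (m + 1 + n) C' (kron_id (amp_mat (2 ^ m) F) (n + 1))"
    if C: "circuit_ok N C" "hot_acts C F" for C F
  proof -
    obtain C' where C': "circuit_ok N C'" "length C' = length C + 10 * (4 * T + 4 * T' + 10)"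
      "\<And>a p. clean a \<Longrightarrow> matches a p \<Longrightarrow>
       cop C' (ket a) = (\<lambda>b. \<Sum>p'<2 ^ m. F (\<lambda>r. of_bool (r = p)) p' * ket (setw a p') b)"
      using sparse_circuit[OF C] by blast
    have "cop C' (ket (bit x)) b = (\<Sum>i<2 ^ (m + 1 + n). kron_id (amp_mat (2 ^ m) F) (n + 1) $$ (i, x) * ket (bit i) b)"
      if x: "x < 2 ^ (m + 1 + n)" for x :: nat and b
    proof -
      let ?l = "x div ?B" and ?y = "x mod ?B"
      have B: "2 ^ (m + 1 + n) = 2 ^ m * ?B" by (simp add: power_add mult_ac)
      have l: "?l < 2 ^ m" using x unfolding B by (simp add: less_mult_imp_div_less)
      have bx: "bit x q = (if q < n + 1 then bit ?y q else bit ?l (q - (n + 1)))" for q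
        using bit_shift_add[of ?y "n + 1" ?l q] by (simp only: div_mult_mod_eq mod_less_divisor pos2 zero_less_power)
      have "matches (bit x) ?l" using l unfolding matches_def unfolding ps_def wpos by (simp add: bx)
      then have "cop C' (ket (bit x)) b = (\<Sum>p'<2 ^ m. F (unit_amp ?l) p' * ket (setw (bit x) p') b)"
        using C'(3)[OF clean[OF x]] by (simp add: unit_amp_def)
      also have "\<dots> = (\<Sum>p'<2 ^ m. amp_mat (2 ^ m) F $$ (p', ?l) * ket (bit (p' * ?B + ?y)) b)"
      proof (rule sum.cong[OF refl])
        fix p' :: nat assume p': "p' \<in> {..<2 ^ m}"
        have "setw (bit x) p' = bit (p' * ?B + ?y)"
        proof
          fix q
          have w: "w p' q = (if q < n + 1 then False else bit p' (q - (n + 1)))"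
            unfolding w_def by (subst bit_shift_add) auto
          have r: "q \<in> ps ` {..<m} \<longleftrightarrow> n + 1 \<le> q \<and> q < n + 1 + m"
            by (auto simp: ps_def image_iff intro!: bexI[of _ "q - (n + 1)"])
          have z: "\<not> bit p' (q - (n + 1))" "\<not> bit ?l (q - (n + 1))" if "n + 1 + m \<le> q"
            using that bit_less_exp[of p' m "q - (n + 1)"] bit_less_exp[OF l, of "q - (n + 1)"] p' by auto
          show "setw (bit x) p' q = bit (p' * ?B + ?y) q"
            unfolding setw_def r bx[of q] w bit_shift_add[of ?y "n + 1" p' q, OF mod_less_divisor[OF zero_less_power[OF pos2]]]
            using z by auto
        qed
        then show "F (unit_amp ?l) p' * ket (setw (bit x) p') b = amp_mat (2 ^ m) F $$ (p', ?l) * ket (bit (p' * ?B + ?y)) b"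
          using p' l by (simp add: amp_mat_def)
      qed
      also have "\<dots> = (\<Sum>i<2 ^ m * ?B. kron_id (amp_mat (2 ^ m) F) (n + 1) $$ (i, x) * ket (bit i) b)"
        by (rule kron_amp_sum[symmetric]) (use x in \<open>simp_all only: B\<close>, simp add: amp_mat_def)
      finally show ?thesis unfolding B .
    qed
    then show ?thesis using C'(1,2) unfolding reg_impl_def by blast
  qed
  obtain C C' F F' where h: "circuit_ok N C" "circuit_ok N C'" "length C = Suc m" "length C' = Suc m"
    "hot_acts C F" "hot_acts C' F'" "adjoint_pair (2 ^ m) F F'" "F (unit_amp 0) = v"
    using hot_state_preparation[of m v] v by blast
  note adj = cadj_amp_mat[OF h(7)] cadj_amp_mat[OF adjoint_pair_sym[OF h(7)]]
  obtain D where D: "circuit_ok N D" "length D = length C + 10 * (4 * T + 4 * T' + 10)"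
      "reg_impl (m + 1 + n) D (kron_id (amp_mat (2 ^ m) F) (n + 1))"
    using impl[OF h(1,5)] by blast
  obtain D' where D': "circuit_ok N D'" "length D' = length C' + 10 * (4 * T + 4 * T' + 10)"
      "reg_impl (m + 1 + n) D' (kron_id (amp_mat (2 ^ m) F') (n + 1))"
    using impl[OF h(2,6)] by blast
  have "\<forall>l<2 ^ m. amp_mat (2 ^ m) F $$ (l, 0) = v l" using h(8) by (simp add: amp_mat_def)
  then show ?thesis
    using D D' h(3,4) unitary_amp_mat[OF h(7)] unitary_amp_mat[OF adjoint_pair_sym[OF h(7)]]
    by (intro exI[of _ "amp_mat (2 ^ m) F"] exI[of _ D] exI[of _ D']) (simp add: adj)
qed

section \<open>Simultaneous transpositions of basis strings\<close>

definition swap_half :: "nat \<Rightarrow> nat \<Rightarrow> nat" where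
  "swap_half s p = (if p < s then p + s else p - s)"

definition swap_strings :: "nat \<Rightarrow> (nat \<Rightarrow> nat) \<Rightarrow> nat \<Rightarrow> nat" where
  "swap_strings s str x = (if \<exists>p<2 * s. str p = x then str (swap_half s (THE p. p < 2 * s \<and> str p = x)) else x)"

lemma swap_strings_str:
  assumes "inj_on str {..<2 * s}" "p < 2 * s"
  shows "swap_strings s str (str p) = str (swap_half s p)"
proof -
  have "(THE r. r < 2 * s \<and> str r = str p) = p"
    using assms by (intro the_equality) (auto simp: inj_on_def)
  then show ?thesis using assms(2) by (auto simp: swap_strings_def)
qed

lemma swap_strings_other: "(\<And>p. p < 2 * s \<Longrightarrow> str p \<noteq> x) \<Longrightarrow> swap_strings s str x = x"
  by (auto simp: swap_strings_def)

lemma swap_half_less: "p < 2 * s \<Longrightarrow> swap_half s p < 2 * s"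
  by (auto simp: swap_half_def)

lemma swap_half_swap_half: "p < 2 * s \<Longrightarrow> swap_half s (swap_half s p) = p"
  by (auto simp: swap_half_def)

lemma swap_strings_swap_strings:
  assumes "inj_on str {..<2 * s}"
  shows "swap_strings s str (swap_strings s str x) = x"
proof (cases "\<exists>p<2 * s. str p = x")
  case True
  then obtain p where p: "p < 2 * s" "str p = x" by blast
  then show ?thesis
    using swap_strings_str[OF assms p(1)] swap_strings_str[OF assms swap_half_less[OF p(1)]]
    by (simp add: swap_half_swap_half)
next
  case False
  then show ?thesis using swap_strings_other[of s str x] by auto
qed

lemma swap_strings_less:
  assumes "inj_on str {..<2 * s}" "\<And>p. p < 2 * s \<Longrightarrow> str p < d" "x < d"
  shows "swap_strings s str x < d"
  using swap_strings_str[OF assms(1)] swap_strings_other[of s str x] assms(2,3) swap_half_less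
  by metis

text \<open>The strings with numbers p and p + s may differ in many bits, but their excitations
  occupy just two qubits. All s transpositions are therefore disjoint two-qubit swaps in one
  layer.\<close>

lemma swap_strings_circuit:
  assumes inj: "inj_on str {..<2 * s}" and less: "\<And>p. p < 2 * s \<Longrightarrow> str p < 2 ^ k" and s: "0 < s"
    and T: "2 * s \<le> 2 ^ T" "Suc k \<le> 2 ^ T'" and N: "k + 2 * s * (2 * k + 3) \<le> N"
  shows "\<exists>C. circuit_ok N C \<and> length C = 1 + 10 * (4 * T + 4 * T' + 10) \<and>
    (\<forall>x<2 ^ k. cop C (ket (bit x)) = ket (bit (swap_strings s str x)))"
proof -
  define ps :: "nat \<Rightarrow> nat" where "ps = (\<lambda>i. i)"
  define ht where "ht = (\<lambda>p. k + p)"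
  define cl where "cl = (\<lambda>p j. k + 2 * s + (p * (2 * Suc k) + j))"
  interpret string_rows N k "2 * s" T T' ps ht cl "\<lambda>p. bit (str p)"
    unfolding ps_def ht_def cl_def
  proof (rule string_rows_layout)
    fix p p' :: nat assume p: "p < 2 * s" "p' < 2 * s" "\<forall>i<k. bit (str p) i = bit (str p') i"
    then have "bit (str p) i = bit (str p') i" for i
      using bit_less_exp[OF less[OF p(1)], of i] bit_less_exp[OF less[OF p(2)], of i] by (cases "i < k") auto
    then have "str p = str p'" by (simp add: bit_eq_iff)
    from inj_onD[OF inj this] show "p = p'" using p(1,2) by simp
  qed (use s T N in auto)
  let ?F = "mix s s (\<lambda>_. 0) (\<lambda>_. 1) (\<lambda>_. 1) (\<lambda>_. 0)"
  have u: "unitary2 0 1 1 0" by (simp add: unitary2_def)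
  have h: "2 * s \<le> 2 * s" by simp
  define L where "L = mix_layer s s (\<lambda>_. 0) (\<lambda>_. 1) (\<lambda>_. 1) (\<lambda>_. 0)"
  have L: "circuit_ok N [L]" "hot_acts [L] ?F"
    unfolding L_def circuit_ok_def using mix_layer_ok[OF h u] mix_layer_acts[OF h] by auto
  obtain C where C: "circuit_ok N C" "length C = length [L] + 10 * (4 * T + 4 * T' + 10)"
    "\<And>a p. clean a \<Longrightarrow> matches a p \<Longrightarrow>
       cop C (ket a) = (\<lambda>b. \<Sum>p'<2 * s. ?F (\<lambda>r. of_bool (r = p)) p' * ket (setw a p') b)"
    "\<And>a. clean a \<Longrightarrow> (\<And>p. \<not> matches a p) \<Longrightarrow> cop C (ket a) = ket a"
    using sparse_circuit[OF L] by blast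
  have "cop C (ket (bit x)) = ket (bit (swap_strings s str x))" if x: "x < 2 ^ k" for x :: nat
  proof -
    have clean: "clean (bit x)"
      using bit_less_exp[OF x] unfolding clean_def scratch0_def by (auto simp: ht_def cl_def)
    have m: "matches (bit x) p \<longleftrightarrow> p < 2 * s \<and> str p = x" for p
    proof -
      have "str p = x" if "p < 2 * s" "\<forall>i<k. bit x i = bit (str p) i"
      proof -
        have "bit (str p) i = bit x i" for i
          using that(2) bit_less_exp[OF less[OF that(1)], of i] bit_less_exp[OF x, of i] by (cases "i < k") auto
        then show ?thesis by (simp add: bit_eq_iff)
      qed
      then show ?thesis unfolding matches_def by (auto simp: ps_def)
    qed
    show ?thesis
    proof (cases "\<exists>p<2 * s. str p = x")
      case True
      then obtain p where p: "p < 2 * s" "str p = x" by blast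
      have set: "setw (bit x) p' = bit (str p')" if "p' < 2 * s" for p'
        using bit_less_exp[OF x] bit_less_exp[OF less[OF that]] unfolding setw_def by (auto simp: ps_def fun_eq_iff)
      \<comment> \<open>The block with zero diagonal moves the unit amplitude at \<open>p\<close> to
        its partner.\<close>
      have F: "?F (\<lambda>r. of_bool (r = p)) p' = of_bool (p' = swap_half s p)" if "p' < 2 * s" for p'
        using that p(1) by (auto simp: mix_def swap_half_def)
      have "matches (bit x) p" using m p by blast
      from C(3)[OF clean this] have "cop C (ket (bit x)) =
          (\<lambda>b. \<Sum>p'<2 * s. ?F (\<lambda>r. of_bool (r = p)) p' * ket (setw (bit x) p') b)" .
      also have "\<dots> = (\<lambda>b. \<Sum>p'<2 * s. if p' = swap_half s p then ket (bit (str p')) b else 0)"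
      proof (intro ext sum.cong[OF refl])
        fix b p' assume "p' \<in> {..<2 * s}"
        then have p': "p' < 2 * s" by simp
        show "?F (\<lambda>r. of_bool (r = p)) p' * ket (setw (bit x) p') b
            = (if p' = swap_half s p then ket (bit (str p')) b else 0)"
          unfolding F[OF p'] set[OF p'] by simp
      qed
      also have "\<dots> = ket (bit (str (swap_half s p)))"
        using swap_half_less[OF p(1)] by simp
      finally show ?thesis using swap_strings_str[OF inj p(1)] p(2) by simp
    next
      case False
      then show ?thesis using C(4)[OF clean] m swap_strings_other[of s str x] by auto
    qed
  qed
  then show ?thesis using C(1,2) by auto
qed

lemma flip_bit_involution: "flip_bit q (flip_bit q (x::nat)) = x"
  by (auto simp: bit_eq_iff bit_flip_bit_iff)

lemma flip_bit_less: "q < k \<Longrightarrow> x < 2 ^ k \<Longrightarrow> flip_bit q x < (2::nat) ^ k"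
  by (rule less_expI) (auto simp: bit_flip_bit_iff bit_less_exp)

lemma flip_bit_circuit:
  assumes "q < N"
  shows "\<exists>C. circuit_ok N C \<and> length C = 5 \<and> (\<forall>x::nat. cop C (ket (bit x)) = ket (bit (flip_bit q x)))"
proof -
  have "level_ok N {NOT q}" using assms by (simp add: level_ok_def rop_ok_def supp_def)
  then obtain C where C: "circuit_ok N C" "length C = 5" "\<And>a. cop C (ket a) = ket (lev {NOT q} a)"
    using clev_circuit[of "[{NOT q}]" N] by auto
  have "lev {NOT q} (bit x) = bit (flip_bit q x)" for x :: nat
    by (auto simp: fun_eq_iff lev_def fires_def bit_flip_bit_iff)
  then show ?thesis using C by auto
qed

section \<open>The dictionary encoding\<close>

text \<open>In the encoded block, equal rather than conjugate roots meet: row 0 of UNPREP is the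
  conjugate of the column prescribed for its adjoint. Their product restores the phase of the
  item.\<close>

lemma dsqrt_square: "dsqrt z * dsqrt z = z"
proof -
  have "dsqrt z * dsqrt z = complex_of_real (sqrt (cmod z) * sqrt (cmod z)) * (cis (Arg z / 2) * cis (Arg z / 2))"
    by (simp only: dsqrt_def of_real_mult mult_ac)
  also have "\<dots> = complex_of_real (cmod z) * cis (Arg z)" by (simp add: cis_mult)
  finally show ?thesis by (simp add: rcis_cmod_Arg flip: rcis_def)
qed

lemma cmod_dsqrt_square: "(cmod (dsqrt z))\<^sup>2 = cmod z"
  by (metis dsqrt_square norm_mult power2_eq_square)

lemma block_uniq:
  fixes B :: nat
  assumes "l * B + y = l' * B + y'" "y < B" "y' < B"
  shows "l = l'" "y = y'"
proof -
  have "(l * B + y) div B = l" "(l' * B + y') div B = l'" using assms(2,3) by simp_all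
  then show "l = l'" using assms(1) by simp
  then show "y = y'" using assms(1) by simp
qed

lemma block_less:
  fixes B :: nat
  assumes "l < L" "y < B"
  shows "l * B + y < L * B"
proof -
  have "l * B + y < Suc l * B" using assms(2) by simp
  also have "\<dots> \<le> L * B" using assms(1) by (intro mult_le_mono1) simp
  finally show ?thesis .
qed

lemma times_mat_entry:
  fixes A B :: "complex mat"
  assumes "A \<in> carrier_mat d d" "B \<in> carrier_mat d d" "i < d" "j < d"
  shows "(A * B) $$ (i, j) = (\<Sum>r<d. A $$ (i, r) * B $$ (r, j))"
  using assms by (auto simp: scalar_prod_def lessThan_atLeast0)

lemma kron_id_carrier: "M \<in> carrier_mat d d \<Longrightarrow> kron_id M k \<in> carrier_mat (d * 2 ^ k) (d * 2 ^ k)"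
  by (auto simp: kron_id_def)

lemma kron_id_entry:
  assumes "M \<in> carrier_mat d d" "l < d" "l' < d" "y < 2 ^ k" "y' < 2 ^ k"
  shows "kron_id M k $$ (l * 2 ^ k + y, l' * 2 ^ k + y') = (if y = y' then M $$ (l, l') else 0)"
  using assms block_less[OF assms(2,4)] block_less[OF assms(3,5)] by (auto simp: kron_id_def)

locale dictionary =
  fixes n s0 m :: nat and Aval :: "nat \<Rightarrow> complex" and S :: "nat \<Rightarrow> nat set"
    and c :: "nat \<Rightarrow> nat \<Rightarrow> nat" and A :: "complex mat"
  assumes s0: "0 < s0" and m: "s0 \<le> 2 ^ m"
    and items: "\<And>l. l < s0 \<Longrightarrow> Aval l \<noteq> 0 \<and> S l \<noteq> {} \<and> S l \<subseteq> {..<2 ^ n} \<and>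
              inj_on (c l) (S l) \<and> c l ` S l \<subseteq> {..<2 ^ n}"
    and distinct_pairs: "\<And>l l' j j'. l < s0 \<Longrightarrow> l' < s0 \<Longrightarrow> j \<in> S l \<Longrightarrow> j' \<in> S l' \<Longrightarrow>
         (l, j) \<noteq> (l', j') \<Longrightarrow> (c l j, j) \<noteq> (c l' j', j')"
    and A_entry: "\<And>i j. i < 2 ^ n \<Longrightarrow> j < 2 ^ n \<Longrightarrow>
         A $$ (i,j) = (\<Sum>l<s0. if j \<in> S l \<and> c l j = i then Aval l else 0)"
begin

definition "\<alpha> = (\<Sum>l<s0. cmod (Aval l))"

definition "nnz = card {(i,j). i < 2 ^ n \<and> j < 2 ^ n \<and> A $$ (i,j) \<noteq> 0}"

definition "pairs = {(l, j). l < s0 \<and> j \<in> S l}"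

abbreviation "B \<equiv> (2::nat) ^ (n + 1)"

lemma alpha_pos: "0 < \<alpha>"
  unfolding \<alpha>_def using s0 items by (intro sum_pos) auto

lemma S_less: "l < s0 \<Longrightarrow> j \<in> S l \<Longrightarrow> j < 2 ^ n" and c_less: "l < s0 \<Longrightarrow> j \<in> S l \<Longrightarrow> c l j < 2 ^ n"
  using items by blast+

lemma finite_pairs: "finite pairs"
  by (rule finite_subset[of _ "{..<s0} \<times> {..<2 ^ n}"]) (auto simp: pairs_def S_less)

text \<open>Distinct dictionary pairs occupy distinct matrix positions, so no entry of
  \<open>A\<close> is a sum of two items and nothing cancels.\<close>

lemma card_pairs: "card pairs = nnz"
proof -
  have "bij_betw (\<lambda>(l, j). (c l j, j)) pairs {(i,j). i < 2 ^ n \<and> j < 2 ^ n \<and> A $$ (i,j) \<noteq> 0}"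
    (is "bij_betw ?g _ ?Z")
    unfolding bij_betw_def
  proof (intro conjI subset_antisym subsetI)
    show "inj_on (\<lambda>(l, j). (c l j, j)) pairs"
      using distinct_pairs by (fastforce simp: inj_on_def pairs_def)
  next
    fix x assume "x \<in> (\<lambda>(l, j). (c l j, j)) ` pairs"
    then obtain l j where x: "x = (c l j, j)" "l < s0" "j \<in> S l" by (auto simp: pairs_def)
    have lt: "c l j < 2 ^ n" "j < 2 ^ n" using S_less c_less x by auto
    have "A $$ (c l j, j) = (\<Sum>l'<s0. if l' = l then Aval l else 0)"
      unfolding A_entry[OF lt] using x distinct_pairs[of _ l j j] by (intro sum.cong) auto
    then show "x \<in> {(i,j). i < 2 ^ n \<and> j < 2 ^ n \<and> A $$ (i,j) \<noteq> 0}"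
      using x lt items by simp
  next
    fix x assume "x \<in> {(i,j). i < 2 ^ n \<and> j < 2 ^ n \<and> A $$ (i,j) \<noteq> 0}"
    then obtain i j where x: "x = (i, j)" "i < 2 ^ n" "j < 2 ^ n" "A $$ (i, j) \<noteq> 0" by blast
    have "\<exists>l<s0. j \<in> S l \<and> c l j = i"
    proof (rule ccontr)
      assume "\<not> (\<exists>l<s0. j \<in> S l \<and> c l j = i)"
      then have "(\<Sum>l<s0. if j \<in> S l \<and> c l j = i then Aval l else 0) = 0" by (intro sum.neutral) auto
      then show False using A_entry[OF x(2,3)] x(4) by simp
    qed
    then obtain l where "l < s0" "j \<in> S l" "c l j = i" by blast
    then show "x \<in> (\<lambda>(l, j). (c l j, j)) ` pairs" using x by (force simp: pairs_def)
  qed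
  then show ?thesis unfolding nnz_def by (rule bij_betw_same_card)
qed

text \<open>Every item owns at least one entry. Hence the index register has at most about as many
  values as there are entries, and PREP can reuse the ancillas of the oracle.\<close>

lemma s0_le: "s0 \<le> nnz"
proof -
  have "\<forall>l\<in>{..<s0}. \<exists>j. j \<in> S l" using items by blast
  then obtain f where f: "\<forall>l\<in>{..<s0}. f l \<in> S l" by metis
  have "card ((\<lambda>l. (l, f l)) ` {..<s0}) \<le> card pairs"
    using f by (intro card_mono finite_pairs) (auto simp: pairs_def)
  then show ?thesis by (simp add: card_pairs card_image inj_on_def)
qed

text \<open>Flipping the deletion qubit sends \<open>|l,0,j\<rangle>\<close> to \<open>|l,1,j\<rangle>\<close>; swapping \<open>|l,1,j\<rangle>\<close> with
  \<open>|l,0,c\<^sub>l(j)\<rangle>\<close> for all pairs \<open>(l,j)\<close> of the dictionary then gives the oracle.\<close>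

lemma oracle_strings:
  shows "\<exists>str. inj_on str {..<2 * nnz} \<and> (\<forall>p<2 * nnz. str p < 2 ^ (m + 1 + n)) \<and>
    (\<forall>l<2 ^ m. \<forall>j<2 ^ n. swap_strings nnz str (flip_bit n (l * B + j))
       = (if l < s0 \<and> j \<in> S l then l * B + c l j else l * B + 2 ^ n + j))"
proof -
  obtain e where "bij_betw e {..<nnz} pairs"
    using ex_bij_betw_nat_finite[OF finite_pairs] by (auto simp: card_pairs lessThan_atLeast0)
  then have e: "inj_on e {..<nnz}" "e ` {..<nnz} = pairs" by (auto simp: bij_betw_def)
  have ep: "fst (e p) < s0" "snd (e p) \<in> S (fst (e p))" if "p < nnz" for p
  proof -
    have "e p \<in> pairs" using that e(2) by blast
    then show "fst (e p) < s0" "snd (e p) \<in> S (fst (e p))" by (auto simp: pairs_def)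
  qed
  \<comment> \<open>For the dictionary pair (l, j) with number p, string p is |l,1,j> and its
    partner p + nnz is |l,0,c l j>.\<close>
  define str where "str p = (if p < nnz then fst (e p) * B + (2 ^ n + snd (e p))
     else fst (e (p - nnz)) * B + c (fst (e (p - nnz))) (snd (e (p - nnz))))" for p
  have lt: "2 ^ n + snd (e p) < B" "c (fst (e p)) (snd (e p)) < 2 ^ n" "c (fst (e p)) (snd (e p)) < B"
    if "p < nnz" for p
    using S_less[OF ep[OF that]] c_less[OF ep[OF that]] by auto
  \<comment> \<open>The deletion qubit separates the two halves of the list.\<close>
  have ne: "str p \<noteq> str p'" if "p < nnz" "nnz \<le> p'" "p' < 2 * nnz" for p p'
  proof
    assume h: "str p = str p'"
    have p': "p' - nnz < nnz" using that by simp
    have "2 ^ n + snd (e p) = c (fst (e (p' - nnz))) (snd (e (p' - nnz)))"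
      using h that by (intro block_uniq(2)[OF _ lt(1)[OF that(1)] lt(3)[OF p']]) (simp add: str_def del: power_add power_Suc)
    then show False using lt(2)[OF p'] by simp
  qed
  have inj: "inj_on str {..<2 * nnz}"
  proof (rule inj_onI)
    fix p p' assume p: "p \<in> {..<2 * nnz}" "p' \<in> {..<2 * nnz}" and h: "str p = str p'"
    consider "p < nnz" "p' < nnz" | "p < nnz" "nnz \<le> p'" | "nnz \<le> p" "p' < nnz" | "nnz \<le> p" "nnz \<le> p'"
      by linarith
    then show "p = p'"
    proof cases
      case 1
      then have "fst (e p) * B + (2 ^ n + snd (e p)) = fst (e p') * B + (2 ^ n + snd (e p'))"
        using h by (simp only: str_def if_True)
      note block_uniq[OF this lt(1)[OF 1(1)] lt(1)[OF 1(2)]]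
      then have "e p = e p'" by (simp add: prod_eq_iff)
      then show ?thesis using e(1) 1 by (simp add: inj_on_def)
    next
      case 2
      then show ?thesis using ne[of p p'] h p by simp
    next
      case 3
      then show ?thesis using ne[of p' p] h p by simp
    next
      case 4
      define r r' where "r = p - nnz" and "r' = p' - nnz"
      have r: "r < nnz" "r' < nnz" using 4 p by (auto simp: r_def r'_def)
      have "fst (e r) * B + c (fst (e r)) (snd (e r)) = fst (e r') * B + c (fst (e r')) (snd (e r'))"
        using h 4 by (simp only: str_def r_def r'_def not_less[symmetric] if_False)
      note u = block_uniq[OF this lt(3)[OF r(1)] lt(3)[OF r(2)]]
      \<comment> \<open>Equal strings in the second half already share the item, so injectivity of
        its map \<open>c l\<close> recovers the column.\<close>
      have "inj_on (c (fst (e r))) (S (fst (e r)))" using items ep(1)[OF r(1)] by blast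
      then have "snd (e r) = snd (e r')" using u ep[OF r(1)] ep[OF r(2)] by (auto simp: inj_on_def)
      then have "e r = e r'" using u by (simp add: prod_eq_iff)
      then have "r = r'" using e(1) r by (simp add: inj_on_def)
      then show ?thesis using 4 by (simp add: r_def r'_def)
    qed
  qed
  have bl: "l * B + y < 2 ^ (m + 1 + n)" if "l < s0" "y < B" for l y
  proof -
    have "l < 2 ^ m" using that(1) m by simp
    from block_less[OF this that(2)] show ?thesis by (simp add: power_add)
  qed
  have less: "str p < 2 ^ (m + 1 + n)" if "p < 2 * nnz" for p
  proof (cases "p < nnz")
    case True
    then show ?thesis unfolding str_def using bl[OF ep(1)[OF True] lt(1)[OF True]] by simp
  next
    case False
    then have r: "p - nnz < nnz" using that by simp
    then show ?thesis unfolding str_def using bl[OF ep(1)[OF r] lt(3)[OF r]] False by simp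
  qed
  have "swap_strings nnz str (flip_bit n (l * B + j))
       = (if l < s0 \<and> j \<in> S l then l * B + c l j else l * B + 2 ^ n + j)" if j: "j < 2 ^ n" for l j
  proof -
    have jB: "j < B" "2 ^ n + j < B" using j by auto
    have flip: "flip_bit n (l * B + j) = l * B + (2 ^ n + j)"
    proof (rule bit_eqI)
      fix q
      show "bit (flip_bit n (l * B + j)) q = bit (l * B + (2 ^ n + j)) q"
        unfolding bit_flip_bit_iff bit_shift_add[OF jB(1)] bit_shift_add[OF jB(2)]
        using bit_shift_add[OF j, of 1 q] bit_less_exp[OF j, of q]
        by (auto simp: bit_Suc_0_iff not_less le_less)
    qed
    show ?thesis
    proof (cases "l < s0 \<and> j \<in> S l")
      case True
      then have "(l, j) \<in> e ` {..<nnz}" by (simp add: e(2) pairs_def)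
      then obtain p where p: "p < nnz" "e p = (l, j)" by auto
      then have str: "str p = l * B + (2 ^ n + j)" "str (swap_half nnz p) = l * B + c l j"
        by (simp_all add: str_def swap_half_def)
      have "p < 2 * nnz" using p by simp
      from swap_strings_str[OF inj this] show ?thesis using True by (simp only: flip str simp_thms if_True)
    next
      case False
      \<comment> \<open>For a pair outside the dictionary the flipped state takes part in no swap:
        the first half contains dictionary pairs only, the second half has deletion qubit 0.\<close>
      have "str p \<noteq> l * B + (2 ^ n + j)" if p: "p < 2 * nnz" for p
      proof
        assume h: "str p = l * B + (2 ^ n + j)"
        show False
        proof (cases "p < nnz")
          case True
          then have "fst (e p) * B + (2 ^ n + snd (e p)) = l * B + (2 ^ n + j)"
            using h by (simp only: str_def if_True)
          note block_uniq[OF this lt(1)[OF True] jB(2)]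
          then show False using ep[OF True] False by simp
        next
          case 2: False
          then have r: "p - nnz < nnz" using p by simp
          have "fst (e (p - nnz)) * B + c (fst (e (p - nnz))) (snd (e (p - nnz))) = l * B + (2 ^ n + j)"
            using h 2 by (simp only: str_def if_False)
          note block_uniq[OF this lt(3)[OF r] jB(2)]
          then show False using lt(2)[OF r] by simp
        qed
      qed
      then have "swap_strings nnz str (l * B + (2 ^ n + j)) = l * B + (2 ^ n + j)" by (rule swap_strings_other)
      then show ?thesis using False by (simp only: flip simp_thms if_False add.assoc)
    qed
  qed
  then show ?thesis using inj less by blast
qed

text \<open>Row and column of the block have idx 0, so only column 0 of \<open>P\<close> and row 0
  of \<open>Q\<close> enter. Each item contributes the product of its two roots if the oracle sends
  \<open>j\<close> to \<open>i\<close>.\<close>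

lemma block_encoding_entry:
  assumes f: "\<And>l j. l < 2 ^ m \<Longrightarrow> j < 2 ^ n \<Longrightarrow>
      f (l * B + j) = (if l < s0 \<and> j \<in> S l then l * B + c l j else l * B + 2 ^ n + j)"
    and f_less: "\<And>x. x < 2 ^ (m + 1 + n) \<Longrightarrow> f x < 2 ^ (m + 1 + n)"
    and P: "P \<in> carrier_mat (2 ^ m) (2 ^ m)"
      "\<And>l. l < 2 ^ m \<Longrightarrow> P $$ (l, 0) = (if l < s0 then dsqrt (Aval l) / complex_of_real (sqrt \<alpha>) else 0)"
    and Q: "Q \<in> carrier_mat (2 ^ m) (2 ^ m)"
      "\<And>l. l < 2 ^ m \<Longrightarrow> Q $$ (0, l) = (if l < s0 then dsqrt (Aval l) / complex_of_real (sqrt \<alpha>) else 0)"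
    and ij: "i < 2 ^ n" "j < 2 ^ n"
  shows "(kron_id Q (n + 1) * fun_mat (2 ^ (m + 1 + n)) f * kron_id P (n + 1)) $$ (i, j)
    = A $$ (i, j) / complex_of_real \<alpha>"
proof -
  let ?D = "2 ^ (m + 1 + n) :: nat"
  have D: "?D = 2 ^ m * B" by (simp add: power_add)
  have kc: "kron_id Q (n + 1) \<in> carrier_mat ?D ?D" "kron_id P (n + 1) \<in> carrier_mat ?D ?D"
    unfolding D by (rule kron_id_carrier[OF Q(1)], rule kron_id_carrier[OF P(1)])
  have fc: "fun_mat ?D f \<in> carrier_mat ?D ?D" by (simp add: fun_mat_def)
  have "i < B" "j < B" using ij by auto
  then have ijD: "i < ?D" "j < ?D"
    unfolding D using block_less[of 0 "2 ^ m" i B] block_less[of 0 "2 ^ m" j B] by simp_all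
  have QO: "(kron_id Q (n + 1) * fun_mat ?D f) $$ (i, y) = kron_id Q (n + 1) $$ (i, f y)" if y: "y < ?D" for y
  proof -
    have "(kron_id Q (n + 1) * fun_mat ?D f) $$ (i, y) = (\<Sum>x<?D. kron_id Q (n + 1) $$ (i, x) * fun_mat ?D f $$ (x, y))"
      by (rule times_mat_entry[OF kc(1) fc ijD(1) y])
    also have "\<dots> = (\<Sum>x<?D. if x = f y then kron_id Q (n + 1) $$ (i, x) else 0)"
      using y by (intro sum.cong) (auto simp: fun_mat_def)
    finally show ?thesis using f_less[OF y] by simp
  qed
  have "(kron_id Q (n + 1) * fun_mat ?D f * kron_id P (n + 1)) $$ (i, j)
      = (\<Sum>y<?D. (kron_id Q (n + 1) * fun_mat ?D f) $$ (i, y) * kron_id P (n + 1) $$ (y, j))"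
    by (rule times_mat_entry[OF mult_carrier_mat[OF kc(1) fc] kc(2) ijD])
  also have "\<dots> = (\<Sum>y<?D. kron_id P (n + 1) $$ (y, j) * kron_id Q (n + 1) $$ (i, f y))"
  proof (rule sum.cong[OF refl])
    fix y assume "y \<in> {..<?D}"
    then have y: "y < ?D" by simp
    show "(kron_id Q (n + 1) * fun_mat ?D f) $$ (i, y) * kron_id P (n + 1) $$ (y, j)
        = kron_id P (n + 1) $$ (y, j) * kron_id Q (n + 1) $$ (i, f y)"
      unfolding QO[OF y] by (rule mult.commute)
  qed
  also have "\<dots> = (\<Sum>l<2 ^ m. P $$ (l, j div B) * kron_id Q (n + 1) $$ (i, f (l * B + j mod B)))"
    unfolding D by (rule kron_amp_sum[OF P(1)]) (use ijD(2) D in simp)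
  also have "\<dots> = (\<Sum>l<2 ^ m. P $$ (l, 0) * kron_id Q (n + 1) $$ (i, f (l * B + j)))"
    using \<open>j < B\<close> by (simp only: div_less mod_less)
  also have "\<dots> = (\<Sum>l<2 ^ m. if l < s0 then (if j \<in> S l \<and> c l j = i then Aval l else 0) / complex_of_real \<alpha> else 0)"
  proof (rule sum.cong[OF refl])
    fix l :: nat assume "l \<in> {..<2 ^ m}"
    then have l: "l < 2 ^ m" by simp
    have sq: "complex_of_real (sqrt \<alpha>) * complex_of_real (sqrt \<alpha>) = complex_of_real \<alpha>"
      using alpha_pos by (simp flip: of_real_mult)
    have kQ: "kron_id Q (n + 1) $$ (i, l * B + y) = (if i = y then Q $$ (0, l) else 0)" if y: "y < B" for y
      using kron_id_entry[OF Q(1) _ l \<open>i < B\<close> y, of 0] by simp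
    show "P $$ (l, 0) * kron_id Q (n + 1) $$ (i, f (l * B + j))
        = (if l < s0 then (if j \<in> S l \<and> c l j = i then Aval l else 0) / complex_of_real \<alpha> else 0)"
    proof (cases "l < s0 \<and> j \<in> S l")
      case True
      then have fl: "f (l * B + j) = l * B + c l j" using f[OF l ij(2)] by (simp only: simp_thms if_True)
      have "c l j < B" using c_less[of l j] True by simp
      from kQ[OF this] fl have "kron_id Q (n + 1) $$ (i, f (l * B + j)) = (if i = c l j then Q $$ (0, l) else 0)" by (simp only:)
      then show ?thesis using True P(2)[OF l] Q(2)[OF l] by (simp add: dsqrt_square sq)
    next
      case False
      \<comment> \<open>The deletion qubit is now 1, while every row \<open>i < 2 ^ n\<close> has it
        0, so the term vanishes.\<close>
      then have fl: "f (l * B + j) = l * B + (2 ^ n + j)" using f[OF l ij(2)] by (simp only: simp_thms if_False add.assoc)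
      have "2 ^ n + j < B" using ij by simp
      from kQ[OF this] fl have "kron_id Q (n + 1) $$ (i, f (l * B + j)) = 0" using ij(1) by simp
      then show ?thesis using False by auto
    qed
  qed
  also have "\<dots> = (\<Sum>l<s0. (if j \<in> S l \<and> c l j = i then Aval l else 0) / complex_of_real \<alpha>)"
    using m by (intro sum.mono_neutral_cong_right) auto
  also have "\<dots> = A $$ (i, j) / complex_of_real \<alpha>"
    by (simp add: A_entry[OF ij] sum_divide_distrib)
  finally show ?thesis .
qed

text \<open>Everything the theorem demands except the two size bounds, shared by the general
  construction and the case n = 0.\<close>

definition encoding_circuit ::
    "nat \<Rightarrow> circuit \<Rightarrow> complex mat \<Rightarrow> complex mat \<Rightarrow> complex mat \<Rightarrow> bool" where
  "encoding_circuit anc Circ PREP UNPREP Oc \<longleftrightarrow>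
       unitary_mat (2 ^ m) PREP \<and> unitary_mat (2 ^ m) UNPREP \<and>
       unitary_mat (2 ^ (m + 1 + n)) Oc \<and>
       (\<forall>l<2 ^ m. PREP $$ (l, 0) =
           (if l < s0 then dsqrt (Aval l) / complex_of_real (sqrt \<alpha>) else 0)) \<and>
       (\<forall>l<2 ^ m. cadj UNPREP $$ (l, 0) =
           (if l < s0 then cnj (dsqrt (Aval l)) / complex_of_real (sqrt \<alpha>) else 0)) \<and>
       (\<forall>l<2 ^ m. \<forall>j<2 ^ n. \<forall>i<2 ^ (m + 1 + n).
           Oc $$ (i, l * 2 ^ (n + 1) + j) =
             (if l < s0 \<and> j \<in> S l
              then (if i = l * 2 ^ (n + 1) + c l j then 1 else 0)
              else (if i = l * 2 ^ (n + 1) + 2 ^ n + j then 1 else 0))) \<and>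
       block_encoding (m + 1) n \<alpha> A
         (kron_id UNPREP (n + 1) * Oc * kron_id PREP (n + 1)) \<and>
       circuit_ok (m + 1 + n + anc) Circ \<and>
       implements (m + 1 + n) anc Circ (kron_id UNPREP (n + 1) * Oc * kron_id PREP (n + 1))"

text \<open>The ancilla count is that of the oracle, with 2 nnz strings on all m + 1 + n register
  qubits.\<close>

lemma dictionary_circuit:
  assumes m2: "2 ^ m \<le> 2 * nnz" and T: "2 * nnz \<le> 2 ^ T" "m + n + 2 \<le> 2 ^ T'"
    and anc: "anc = 2 * nnz * (2 * (m + 1 + n) + 3)"
  shows "\<exists>Circ PREP UNPREP Oc. encoding_circuit anc Circ PREP UNPREP Oc \<and>
       circuit_depth Circ = 2 * m + 120 * T + 120 * T' + 308"
proof -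
  let ?k = "m + 1 + n" and ?N = "m + 1 + n + anc" and ?L = "10 * (4 * T + 4 * T' + 10)"
  let ?D = "2 ^ (m + 1 + n) :: nat"
  have nnz: "0 < nnz" using s0 s0_le by simp
  have D: "?D = 2 ^ m * B" by (simp add: power_add)
  have "(2::nat) ^ m \<le> 2 ^ T" using m2 T(1) by (rule order_trans)
  then have mT: "m \<le> T" by simp
  have mT': "Suc m \<le> 2 ^ T'" using T(2) by simp
  have "2 ^ m * (2 * m + 3) \<le> 2 * nnz * (2 * (m + 1 + n) + 3)" using m2 by (intro mult_le_mono) auto
  then have N1: "m + 1 + n + 2 ^ m * (2 * m + 3) \<le> ?N" by (simp add: anc)
  define v where "v l = (if l < s0 then dsqrt (Aval l) / complex_of_real (sqrt \<alpha>) else 0)" for l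
  have sums: "(\<Sum>i<2 ^ m. (cmod (v i))\<^sup>2) = 1"
  proof -
    have "(\<Sum>i<2 ^ m. (cmod (v i))\<^sup>2) = (\<Sum>i<s0. cmod (Aval i) / \<alpha>)"
      using m alpha_pos
      by (intro sum.mono_neutral_cong_right) (auto simp: v_def norm_divide power_divide cmod_dsqrt_square)
    then show ?thesis using alpha_pos by (simp flip: sum_divide_distrib \<alpha>_def)
  qed
  have v0: "v i = 0" "cnj (v i) = 0" if "2 ^ m \<le> i" for i using that m by (simp_all add: v_def)
  obtain P C1 where P: "unitary_mat (2 ^ m) P" "\<forall>l<2 ^ m. P $$ (l, 0) = v l"
    "circuit_ok ?N C1" "length C1 = Suc m + ?L" "reg_impl ?k C1 (kron_id P (n + 1))"
    using prep_circuit[of m v T T' n ?N] v0(1) sums mT mT' N1 by blast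
  \<comment> \<open>\<open>Q\<close> prepares the conjugate amplitudes, and UNPREP is its adjoint;
    conjugating once more, row 0 of UNPREP carries the amplitudes themselves.\<close>
  obtain Q C3 where Q0: "unitary_mat (2 ^ m) Q" and Q: "unitary_mat (2 ^ m) (cadj Q)" "cadj (cadj Q) = Q" "\<forall>l<2 ^ m. Q $$ (l, 0) = cnj (v l)"
    "circuit_ok ?N C3" "length C3 = Suc m + ?L" "reg_impl ?k C3 (kron_id (cadj Q) (n + 1))"
    using prep_circuit[of m "\<lambda>i. cnj (v i)" T T' n ?N] v0(2) sums mT mT' N1 unfolding complex_mod_cnj by blast
  have Qr: "cadj Q $$ (0, l) = v l" if "l < 2 ^ m" for l
  proof -
    have "Q \<in> carrier_mat (2 ^ m) (2 ^ m)" using Q0 by (simp add: unitary_mat_def)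
    then show ?thesis using Q(3) that by (auto simp: cadj_def)
  qed
  obtain str where str: "inj_on str {..<2 * nnz}" "\<forall>p<2 * nnz. str p < ?D"
    "\<forall>l<2 ^ m. \<forall>j<2 ^ n. swap_strings nnz str (flip_bit n (l * B + j))
       = (if l < s0 \<and> j \<in> S l then l * B + c l j else l * B + 2 ^ n + j)"
    using oracle_strings by blast
  define f where "f x = swap_strings nnz str (flip_bit n x)" for x
  have f: "f (l * B + j) = (if l < s0 \<and> j \<in> S l then l * B + c l j else l * B + 2 ^ n + j)"
    if "l < 2 ^ m" "j < 2 ^ n" for l j
    using str(3) that unfolding f_def by blast
  have flip_less: "flip_bit n x < ?D" if "x < ?D" for x by (rule flip_bit_less[OF _ that]) simp
  have f_less: "f x < ?D" if "x < ?D" for x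
    unfolding f_def using swap_strings_less[OF str(1) _ flip_less[OF that]] str(2) by blast
  have f_inj: "inj_on f {..<?D}"
  proof (rule inj_onI)
    fix x y assume "f x = f y"
    then have "swap_strings nnz str (f x) = swap_strings nnz str (f y)" by simp
    then have "flip_bit n x = flip_bit n y" by (simp only: f_def swap_strings_swap_strings[OF str(1)])
    then show "x = y" by (metis flip_bit_involution)
  qed
  obtain C2 where C2: "circuit_ok ?N C2" "length C2 = 1 + ?L"
    "\<forall>x<2 ^ ?k. cop C2 (ket (bit x)) = ket (bit (swap_strings nnz str x))"
    using swap_strings_circuit[of str nnz ?k T T' ?N] str(1,2) nnz T anc by auto
  obtain C0 where C0: "circuit_ok ?N C0" "length C0 = 5" "\<forall>x. cop C0 (ket (bit x)) = ket (bit (flip_bit n (x::nat)))"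
    using flip_bit_circuit[of n ?N] by auto
  define Oc where "Oc = fun_mat ?D f"
  have Oc: "unitary_mat ?D Oc" unfolding Oc_def
    using f_inj f_less by (intro unitary_fun_mat) auto
  have "reg_impl ?k (C0 @ C2) Oc" unfolding Oc_def
    using C0(3) C2(3) flip_less f_less by (intro reg_impl_fun_mat) (simp_all add: f_def)
  define U where "U = kron_id (cadj Q) (n + 1) * Oc * kron_id P (n + 1)"
  have uk: "unitary_mat ?D (kron_id (cadj Q) (n + 1))" "unitary_mat ?D (kron_id P (n + 1))"
    unfolding D by (rule unitary_kron_id[OF Q(1)], rule unitary_kron_id[OF P(1)])
  then have carr: "kron_id (cadj Q) (n + 1) \<in> carrier_mat ?D ?D" "kron_id P (n + 1) \<in> carrier_mat ?D ?D"
     "Oc \<in> carrier_mat ?D ?D" using Oc by (auto simp: unitary_mat_def)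
  define Circ where "Circ = C1 @ (C0 @ C2) @ C3"
  have ok: "circuit_ok ?N Circ" using P(3) Q(4) C0(1) C2(1) by (auto simp: Circ_def circuit_ok_def)
  have "reg_impl ?k Circ (kron_id (cadj Q) (n + 1) * Oc * kron_id P (n + 1))"
    unfolding Circ_def
    by (intro reg_impl_append P(5) Q(6) \<open>reg_impl ?k (C0 @ C2) Oc\<close> carr mult_carrier_mat[OF carr(1,3)])
  then have impl: "implements ?k anc Circ U" unfolding U_def by (rule reg_impl_implements[OF _ ok])
  have "unitary_mat ?D U" unfolding U_def by (intro unitary_times uk Oc)
  moreover have "U $$ (i, j) = A $$ (i, j) / complex_of_real \<alpha>" if "i < 2 ^ n" "j < 2 ^ n" for i j
  proof -
    have "P \<in> carrier_mat (2 ^ m) (2 ^ m)" "cadj Q \<in> carrier_mat (2 ^ m) (2 ^ m)"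
      using P(1) Q(1) by (simp_all add: unitary_mat_def)
    moreover have "P $$ (l, 0) = (if l < s0 then dsqrt (Aval l) / complex_of_real (sqrt \<alpha>) else 0)"
      "cadj Q $$ (0, l) = (if l < s0 then dsqrt (Aval l) / complex_of_real (sqrt \<alpha>) else 0)"
      if "l < 2 ^ m" for l
      using P(2) Qr that by (simp_all only: v_def)
    ultimately show ?thesis
      unfolding U_def Oc_def using that by (intro block_encoding_entry f f_less)
  qed
  ultimately have be: "block_encoding (m + 1) n \<alpha> A U" by (simp add: block_encoding_def)
  have entries: "Oc $$ (i, l * 2 ^ (n + 1) + j) =
             (if l < s0 \<and> j \<in> S l
              then (if i = l * 2 ^ (n + 1) + c l j then 1 else 0)
              else (if i = l * 2 ^ (n + 1) + 2 ^ n + j then 1 else 0))"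
    if l: "l < 2 ^ m" and j: "j < 2 ^ n" and i: "i < ?D" for l j i
  proof -
    have "j < B" using j by simp
    from block_less[OF l this] have "Oc $$ (i, l * B + j) = (if i = f (l * B + j) then 1 else 0)"
      using i unfolding Oc_def fun_mat_def D by simp
    then show ?thesis unfolding f[OF l j] by simp
  qed
  have "encoding_circuit anc Circ P (cadj Q) Oc"
    unfolding encoding_circuit_def
  proof (intro conjI allI impI)
    show "unitary_mat (2 ^ m) P" "unitary_mat (2 ^ m) (cadj Q)" "unitary_mat ?D Oc" by fact+
    show "circuit_ok ?N Circ" by fact
    show "block_encoding (m + 1) n \<alpha> A (kron_id (cadj Q) (n + 1) * Oc * kron_id P (n + 1))"
      using be unfolding U_def .
    show "implements ?k anc Circ (kron_id (cadj Q) (n + 1) * Oc * kron_id P (n + 1))"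
      using impl unfolding U_def .
    show "cadj (cadj Q) $$ (l, 0) =
        (if l < s0 then cnj (dsqrt (Aval l)) / complex_of_real (sqrt \<alpha>) else 0)" if "l < 2 ^ m" for l
      using Q(2,3) that by (simp add: v_def)
    show "P $$ (l, 0) = (if l < s0 then dsqrt (Aval l) / complex_of_real (sqrt \<alpha>) else 0)" if "l < 2 ^ m" for l
      using P(2) that by (simp only: v_def)
    show "Oc $$ (i, l * 2 ^ (n + 1) + j) =
             (if l < s0 \<and> j \<in> S l
              then (if i = l * 2 ^ (n + 1) + c l j then 1 else 0)
              else (if i = l * 2 ^ (n + 1) + 2 ^ n + j then 1 else 0))"
      if "l < 2 ^ m" "j < 2 ^ n" "i < ?D" for l j i
      by (rule entries[OF that])
  qed
  \<comment> \<open>Two preparations with m + 1 inner layers, one swap layer and five layers for the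
    NOT give 2 m + 8; the three exchanges add 120 T + 120 T' + 300.\<close>
  moreover have "circuit_depth Circ = 2 * m + 120 * T + 120 * T' + 308"
    using P(4) Q(5) C0(2) C2(2) by (simp add: circuit_depth_def Circ_def)
  ultimately show ?thesis by blast
qed

end

lemma implements_single_gate:
  assumes "U \<in> carrier_mat 2 2"
  shows "implements 1 0 [[G1 0 U]] U"
proof -
  have "circ_mat 1 [[G1 0 U]] = gate_mat 1 (G1 0 U)"
    using gate_mat_carrier[of 1 "G1 0 U"] by (simp add: layer_mat_def)
  then show ?thesis by (auto simp: implements_def gate_mat_def qbit_def)
qed

text \<open>For n = 0 the required bound leaves no ancillas at all. The register is just the
  deletion qubit, and the whole encoding is a single one-qubit gate; the sole dictionary pair is (0,
  0), so the identity serves as oracle.\<close>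

lemma (in dictionary) dictionary_circuit_no_qubits:
  assumes nm: "n = 0" "m = 0"
  shows "\<exists>Circ PREP UNPREP Oc. encoding_circuit 0 Circ PREP UNPREP Oc \<and> circuit_depth Circ = 1"
proof -
  have s1: "s0 = 1" using m s0 nm by simp
  have "S 0 \<noteq> {}" "S 0 \<subseteq> {0}" using items[of 0] s1 nm by auto
  then have S0: "S 0 = {0}" by blast
  then have c0: "c 0 0 = 0" using c_less[of 0 0] s1 nm by simp
  define z where "z = dsqrt (Aval 0) / complex_of_real (sqrt \<alpha>)"
  have al: "\<alpha> = cmod (Aval 0)" unfolding \<alpha>_def by (simp add: s1)
  have "(cmod z)\<^sup>2 = 1" using alpha_pos by (simp add: z_def norm_divide power_divide cmod_dsqrt_square al)
  then have zz: "cnj z * z = 1" by (metis complex_norm_square mult.commute of_real_1)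
  define P where "P = mat 1 1 (\<lambda>_. z)"
  have P: "unitary_mat (2 ^ m) P"
    using zz nm by (auto simp: unitary_mat_def P_def cadj_def scalar_prod_def intro!: eq_matI)
  define Oc where "Oc = fun_mat (2 ^ (m + 1 + n)) (\<lambda>x. x)"
  have Oc: "unitary_mat (2 ^ (m + 1 + n)) Oc" unfolding Oc_def by (rule unitary_fun_mat) auto
  define U where "U = kron_id P (n + 1) * Oc * kron_id P (n + 1)"
  have D: "2 ^ (m + 1 + n) = 2 ^ m * B" by (simp add: power_add)
  have U: "unitary_mat (2 ^ (m + 1 + n)) U" unfolding U_def
    by (intro unitary_times Oc; unfold D; rule unitary_kron_id[OF P])
  then have U2: "unitary_mat 2 U" using nm by simp
  have "U $$ (i, j) = A $$ (i, j) / complex_of_real \<alpha>" if "i < 2 ^ n" "j < 2 ^ n" for i j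
    unfolding U_def Oc_def
    by (rule block_encoding_entry) (use nm s1 S0 c0 that in \<open>auto simp: P_def z_def\<close>)
  then have be: "block_encoding (m + 1) n \<alpha> A U" using U by (simp add: block_encoding_def)
  have impl: "implements (m + 1 + n) 0 [[G1 0 U]] U"
    using implements_single_gate U2 nm by (simp add: unitary_mat_def)
  have "encoding_circuit 0 [[G1 0 U]] P P Oc"
    unfolding encoding_circuit_def
  proof (intro conjI allI impI)
    show "unitary_mat (2 ^ m) P" "unitary_mat (2 ^ m) P" "unitary_mat (2 ^ (m + 1 + n)) Oc" by fact+
    show "circuit_ok (m + 1 + n + 0) [[G1 0 U]]" using U2 by (simp add: circuit_ok_def layer_ok_def)
    show "block_encoding (m + 1) n \<alpha> A (kron_id P (n + 1) * Oc * kron_id P (n + 1))"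
      using be unfolding U_def .
    show "implements (m + 1 + n) 0 [[G1 0 U]] (kron_id P (n + 1) * Oc * kron_id P (n + 1))"
      using impl unfolding U_def .
    show "cadj P $$ (l, 0) =
        (if l < s0 then cnj (dsqrt (Aval l)) / complex_of_real (sqrt \<alpha>) else 0)" if "l < 2 ^ m" for l
      using that nm s1 by (simp add: cadj_def P_def z_def)
    show "P $$ (l, 0) = (if l < s0 then dsqrt (Aval l) / complex_of_real (sqrt \<alpha>) else 0)" if "l < 2 ^ m" for l
      using that nm s1 by (simp add: P_def z_def)
    show "Oc $$ (i, l * 2 ^ (n + 1) + j) =
             (if l < s0 \<and> j \<in> S l
              then (if i = l * 2 ^ (n + 1) + c l j then 1 else 0)
              else (if i = l * 2 ^ (n + 1) + 2 ^ n + j then 1 else 0))"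
      if "l < 2 ^ m" "j < 2 ^ n" "i < 2 ^ (m + 1 + n)" for l j i
      using that nm s1 S0 c0 by (simp add: Oc_def fun_mat_def)
  qed
  moreover have "circuit_depth [[G1 0 U]] = 1" by (simp add: circuit_depth_def)
  ultimately show ?thesis by blast
qed

section \<open>Depth and ancilla estimates\<close>

lemma nat_ceiling_log2:
  fixes x :: nat
  assumes "1 \<le> x"
  defines "t \<equiv> nat \<lceil>log 2 (real x)\<rceil>"
  shows "x \<le> 2 ^ t" "2 ^ t \<le> 2 * x" "real t \<le> log 2 (real x) + 1"
proof -
  have l: "0 \<le> log 2 (real x)" using assms by simp
  have t: "log 2 (real x) \<le> real t" "real t \<le> log 2 (real x) + 1" using l unfolding t_def by linarith+
  have x: "real x = 2 powr log 2 (real x)" using assms by simp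
  have "real x \<le> 2 powr real t" by (subst x) (use t in simp)
  then have "real x \<le> real (2 ^ t)" by (simp add: powr_realpow)
  then show "x \<le> 2 ^ t" by (simp only: of_nat_le_iff)
  have "2 powr real t \<le> 2 powr (log 2 (real x) + 1)" using t by simp
  also have "\<dots> = 2 * real x" using assms by (simp add: powr_add)
  finally have "real (2 ^ t) \<le> real (2 * x)" by (simp add: powr_realpow)
  then show "2 ^ t \<le> 2 * x" by (simp only: of_nat_le_iff)
  show "real t \<le> log 2 (real x) + 1" by fact
qed

text \<open>\<open>\<bar>K\<bar> + 3\<close> arises from m + n + 2 \<le> (\<bar>K\<bar> + 3) n for n
  \<ge> 1, and 4 \<bar>K\<bar> + 14 from 4 m + 4 n + 10 \<le> (4 \<bar>K\<bar> + 14) n. The summand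
  2000 absorbs the remaining constants generously.\<close>

lemma depth_bound:
  fixes K :: real and n s m T T' :: nat
  assumes n: "1 \<le> n" and s: "1 \<le> s" and mK: "real m \<le> K * real n" and mT: "m \<le> T"
    and T: "real T \<le> log 2 (real (2 * s)) + 1" and T': "real T' \<le> log 2 (real (m + n + 2)) + 1"
  defines "C0 \<equiv> 2000 + 120 * log 2 (\<bar>K\<bar> + 3) + 4 * \<bar>K\<bar>"
  shows "real (2 * m + 120 * T + 120 * T' + 308) \<le> C0 * log 2 (real n * real s) + C0"
    "real (2 * s * (2 * (m + 1 + n) + 3)) \<le> C0 * real n ^ 2 * real s"
proof -
  have n1: "1 \<le> real n" and s1: "1 \<le> real s" using n s by auto
  have mK': "real m \<le> \<bar>K\<bar> * real n" using mK n1
    by (smt (verit) mult_right_mono)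
  have ln: "0 \<le> log 2 (real n)" "0 \<le> log 2 (real s)" using n1 s1 by auto
  have lns: "log 2 (real n * real s) = log 2 (real n) + log 2 (real s)" using n1 s1 by (simp add: log_mult)
  have lK: "0 \<le> log 2 (\<bar>K\<bar> + 3)" by simp
  have Ts: "real T \<le> log 2 (real s) + 2" using T s1 by (simp add: log_mult)
  have "real (m + n + 2) \<le> (\<bar>K\<bar> + 3) * real n" using mK' n1 by (simp add: algebra_simps)
  then have "log 2 (real (m + n + 2)) \<le> log 2 ((\<bar>K\<bar> + 3) * real n)" by simp
  also have "\<dots> = log 2 (\<bar>K\<bar> + 3) + log 2 (real n)" using n1 by (simp add: log_mult)
  finally have Tn: "real T' \<le> log 2 (\<bar>K\<bar> + 3) + log 2 (real n) + 1" using T' by simp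
  have "real (2 * m + 120 * T + 120 * T' + 308) \<le> 122 * real T + 120 * real T' + 308" using mT by simp
  also have "\<dots> \<le> 122 * (log 2 (real n) + log 2 (real s)) + C0"
    using Ts Tn ln unfolding C0_def by simp
  also have "\<dots> \<le> C0 * (log 2 (real n) + log 2 (real s)) + C0"
    using ln lK by (intro add_right_mono mult_right_mono) (simp_all add: C0_def)
  finally show "real (2 * m + 120 * T + 120 * T' + 308) \<le> C0 * log 2 (real n * real s) + C0" by (simp add: lns)
  have C: "4 * \<bar>K\<bar> + 14 \<le> C0" using lK by (simp add: C0_def)
  have "real (2 * s * (2 * (m + 1 + n) + 3)) = real s * (4 * real m + 4 * real n + 10)" by (simp add: algebra_simps)
  also have "\<dots> \<le> real s * ((4 * \<bar>K\<bar> + 14) * real n)"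
    using mK' n1 s1 by (intro mult_left_mono) (simp_all add: algebra_simps)
  \<comment> \<open>The construction is linear in n; the second factor n only matches the claimed
    form.\<close>
  also have "\<dots> \<le> real s * (C0 * (real n * real n))"
  proof (intro mult_left_mono mult_mono)
    show "real n \<le> real n * real n" using n1 mult_left_mono[OF n1, of "real n"] by simp
  qed (use C lK in \<open>auto simp: C0_def\<close>)
  finally show "real (2 * s * (2 * (m + 1 + n) + 3)) \<le> C0 * real n ^ 2 * real s"
    by (simp add: power2_eq_square mult_ac)
qed

theorem theorem3:
  shows "\<forall>K::real. \<exists>C0::real. \<forall>(n::nat) (s0::nat) (Aval::nat \<Rightarrow> complex) (S::nat \<Rightarrow> nat set)
      (c::nat \<Rightarrow> nat \<Rightarrow> nat) (A::complex mat).
    let m = nat \<lceil>log 2 (real s0)\<rceil>;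
        s = card {(i,j). i < 2 ^ n \<and> j < 2 ^ n \<and> A $$ (i,j) \<noteq> 0};
        \<alpha> = (\<Sum>l<s0. cmod (Aval l))
    in
    (s0 \<ge> 1 \<and>
     (\<forall>l<s0. Aval l \<noteq> 0 \<and> S l \<noteq> {} \<and> S l \<subseteq> {..<2 ^ n} \<and>
              inj_on (c l) (S l) \<and> c l ` S l \<subseteq> {..<2 ^ n}) \<and>
     (\<forall>l<s0. \<forall>l'<s0. \<forall>j\<in>S l. \<forall>j'\<in>S l'.
         (l, j) \<noteq> (l', j') \<longrightarrow> (c l j, j) \<noteq> (c l' j', j')) \<and>
     A \<in> carrier_mat (2 ^ n) (2 ^ n) \<and>
     (\<forall>i<2 ^ n. \<forall>j<2 ^ n.
         A $$ (i,j) = (\<Sum>l<s0. if j \<in> S l \<and> c l j = i then Aval l else 0)) \<and>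
     real m \<le> K * real n)
    \<longrightarrow>
    (\<exists>(anc::nat) (Circ::circuit) (PREP::complex mat) (UNPREP::complex mat) (Oc::complex mat).
       unitary_mat (2 ^ m) PREP \<and> unitary_mat (2 ^ m) UNPREP \<and>
       unitary_mat (2 ^ (m + 1 + n)) Oc \<and>
       (\<forall>l<2 ^ m. PREP $$ (l, 0) =
           (if l < s0 then dsqrt (Aval l) / complex_of_real (sqrt \<alpha>) else 0)) \<and>
       (\<forall>l<2 ^ m. cadj UNPREP $$ (l, 0) =
           (if l < s0 then cnj (dsqrt (Aval l)) / complex_of_real (sqrt \<alpha>) else 0)) \<and>
       (\<forall>l<2 ^ m. \<forall>j<2 ^ n. \<forall>i<2 ^ (m + 1 + n).
           Oc $$ (i, l * 2 ^ (n + 1) + j) =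
             (if l < s0 \<and> j \<in> S l
              then (if i = l * 2 ^ (n + 1) + c l j then 1 else 0)
              else (if i = l * 2 ^ (n + 1) + 2 ^ n + j then 1 else 0))) \<and>
       block_encoding (m + 1) n \<alpha> A
         (kron_id UNPREP (n + 1) * Oc * kron_id PREP (n + 1)) \<and>
       circuit_ok (m + 1 + n + anc) Circ \<and>
       implements (m + 1 + n) anc Circ (kron_id UNPREP (n + 1) * Oc * kron_id PREP (n + 1)) \<and>
       real (circuit_depth Circ) \<le> C0 * log 2 (real n * real s) + C0 \<and>
       real anc \<le> C0 * real n ^ 2 * real s)"
proof (rule allI, rule exI, intro allI, unfold Let_def, rule impI)
  fix K :: real and n s0 :: nat and Aval :: "nat \<Rightarrow> complex" and S :: "nat \<Rightarrow> nat set"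
    and c :: "nat \<Rightarrow> nat \<Rightarrow> nat" and A :: "complex mat"
  let ?m = "nat \<lceil>log 2 (real s0)\<rceil>"
  let ?s = "card {(i,j). i < 2 ^ n \<and> j < 2 ^ n \<and> A $$ (i,j) \<noteq> 0}"
  let ?\<alpha> = "\<Sum>l<s0. cmod (Aval l)"
  \<comment> \<open>The constant of \<open>depth_bound\<close>; it depends on \<open>K\<close>
    alone, as the order of the quantifiers demands.\<close>
  let ?C0 = "2000 + 120 * log 2 (\<bar>K\<bar> + 3) + 4 * \<bar>K\<bar>"
  assume h: "s0 \<ge> 1 \<and>
     (\<forall>l<s0. Aval l \<noteq> 0 \<and> S l \<noteq> {} \<and> S l \<subseteq> {..<2 ^ n} \<and>
              inj_on (c l) (S l) \<and> c l ` S l \<subseteq> {..<2 ^ n}) \<and>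
     (\<forall>l<s0. \<forall>l'<s0. \<forall>j\<in>S l. \<forall>j'\<in>S l'.
         (l, j) \<noteq> (l', j') \<longrightarrow> (c l j, j) \<noteq> (c l' j', j')) \<and>
     A \<in> carrier_mat (2 ^ n) (2 ^ n) \<and>
     (\<forall>i<2 ^ n. \<forall>j<2 ^ n.
         A $$ (i,j) = (\<Sum>l<s0. if j \<in> S l \<and> c l j = i then Aval l else 0)) \<and>
     real ?m \<le> K * real n"
  then have s0: "1 \<le> s0" and mK: "real ?m \<le> K * real n" by blast+
  note mlog = nat_ceiling_log2[OF s0]
  interpret D: dictionary n s0 ?m Aval S c A
    by unfold_locales (use h mlog(1) in \<open>blast | simp\<close>)+
  let ?bound = "\<lambda>anc Circ. real (circuit_depth Circ) \<le> ?C0 * log 2 (real n * real D.nnz) + ?C0 \<and>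
       real anc \<le> ?C0 * real n ^ 2 * real D.nnz"
  have "\<exists>anc Circ PREP UNPREP Oc. D.encoding_circuit anc Circ PREP UNPREP Oc \<and> ?bound anc Circ"
  proof (cases "n = 0")
    case True
    \<comment> \<open>For n = 0 the hypothesis on m forces a single item. Below,
      \<open>log 2 0\<close> is 0 by convention, so the depth bound reads \<open>?C0\<close> and the
      ancilla bound 0.\<close>
    then have m0: "?m = 0" using mK by simp
    have "0 \<le> log 2 (\<bar>K\<bar> + 3)" by simp
    then have "real 1 \<le> ?C0 * log 2 (real n * real D.nnz) + ?C0" "real 0 \<le> ?C0 * real n ^ 2 * real D.nnz"
      using True by (simp_all add: log_def)
    moreover obtain Circ PREP UNPREP Oc where
      "D.encoding_circuit 0 Circ PREP UNPREP Oc" "circuit_depth Circ = 1"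
      using D.dictionary_circuit_no_qubits[OF True m0] by blast
    ultimately have "D.encoding_circuit 0 Circ PREP UNPREP Oc \<and> ?bound 0 Circ" by (simp only: simp_thms)
    then show ?thesis by blast
  next
    case False
    then have n: "1 \<le> n" by simp
    have s: "1 \<le> D.nnz" using D.s0_le s0 by simp
    define T where "T = nat \<lceil>log 2 (real (2 * D.nnz))\<rceil>"
    define T' where "T' = nat \<lceil>log 2 (real (?m + n + 2))\<rceil>"
    define anc where "anc = 2 * D.nnz * (2 * (?m + 1 + n) + 3)"
    have "1 \<le> 2 * D.nnz" "1 \<le> ?m + n + 2" using s by auto
    note T = nat_ceiling_log2[OF this(1), folded T_def] and T' = nat_ceiling_log2[OF this(2), folded T'_def]
    have m2: "2 ^ ?m \<le> 2 * D.nnz" using mlog(2) D.s0_le by linarith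
    then have "(2::nat) ^ ?m \<le> 2 ^ T" using T(1) by (rule order_trans)
    then have mT: "?m \<le> T" by simp
    obtain Circ PREP UNPREP Oc where "D.encoding_circuit anc Circ PREP UNPREP Oc"
      "circuit_depth Circ = 2 * ?m + 120 * T + 120 * T' + 308"
      using D.dictionary_circuit[OF m2 T(1) T'(1) anc_def] by blast
    moreover note depth_bound[OF n s mK mT T(3) T'(3), folded anc_def]
    ultimately have "D.encoding_circuit anc Circ PREP UNPREP Oc \<and> ?bound anc Circ"
      by (simp only: simp_thms)
    then show ?thesis by blast
  qed
  then show "\<exists>(anc::nat) (Circ::circuit) (PREP::complex mat) (UNPREP::complex mat) (Oc::complex mat).
       unitary_mat (2 ^ ?m) PREP \<and> unitary_mat (2 ^ ?m) UNPREP \<and>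
       unitary_mat (2 ^ (?m + 1 + n)) Oc \<and>
       (\<forall>l<2 ^ ?m. PREP $$ (l, 0) =
           (if l < s0 then dsqrt (Aval l) / complex_of_real (sqrt ?\<alpha>) else 0)) \<and>
       (\<forall>l<2 ^ ?m. cadj UNPREP $$ (l, 0) =
           (if l < s0 then cnj (dsqrt (Aval l)) / complex_of_real (sqrt ?\<alpha>) else 0)) \<and>
       (\<forall>l<2 ^ ?m. \<forall>j<2 ^ n. \<forall>i<2 ^ (?m + 1 + n).
           Oc $$ (i, l * 2 ^ (n + 1) + j) =
             (if l < s0 \<and> j \<in> S l
              then (if i = l * 2 ^ (n + 1) + c l j then 1 else 0)
              else (if i = l * 2 ^ (n + 1) + 2 ^ n + j then 1 else 0))) \<and>
       block_encoding (?m + 1) n ?\<alpha> A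
         (kron_id UNPREP (n + 1) * Oc * kron_id PREP (n + 1)) \<and>
       circuit_ok (?m + 1 + n + anc) Circ \<and>
       implements (?m + 1 + n) anc Circ (kron_id UNPREP (n + 1) * Oc * kron_id PREP (n + 1)) \<and>
       real (circuit_depth Circ) \<le> ?C0 * log 2 (real n * real ?s) + ?C0 \<and>
       real anc \<le> ?C0 * real n ^ 2 * real ?s"
    unfolding D.encoding_circuit_def D.\<alpha>_def D.nnz_def by (simp only: conj_assoc)
qed

end
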